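(* (Widom's identity for truncated Toeplitz operators.) Let $u$ be an infinite Blaschke product with partial products $u_n$, and let $a,b\in L^\infty(\mathbb T)$. Then for every $n\ge1$, as operators on $L^2(\mathbb T)$, $$P_{u_n}T_u(ab)P_{u_n}=P_{u_n}T_u(a)P_{u_n}T_u(b)P_{u_n}+P_{u_n}H(a)H(\tilde b)P_{u_n}+R_{u_n}H(\tilde a)H(b)R_{u_n}^*.$$
   Context: $\mathbb T$ is the unit circle with normalized Lebesgue measure, $H^2\subset L^2(\mathbb T)$ the Hardy space, $P$ the orthogonal projection of $L^2(\mathbb T)$ onto $H^2$, $Q:=I-P$. For $a\in L^\infty(\mathbb T)$, $M_a$ is multiplication by $a$ and $\tilde a(t):=a(t^{-1})$. $J$ is the operator on $L^2(\mathbb T)$ given by $(Jf)(t)=t^{-1}f(t^{-1})$. The Hankel operator is $H(a):=PM_aQJ$ (on $H^2$ it coincides with $PM_aJ|_{H^2}$). For an inner function $v$, $K^2_v:=H^2\ominus vH^2$ and $P_v=P-M_vPM_{\bar v}$ is the orthogonal projection of $L^2(\mathbb T)$ onto $K^2_v$. The truncated Toeplitz operator is $T_u(a):=P_uM_a|_{K^2_u}$, regarded here as the operator $P_uM_aP_u$ on $L^2(\mathbb T)$. Blaschke factors: $b_0(z)=z$, $b_\lambda(z)=\frac{\lambda-z}{1-\bar\lambda z}\frac{|\lambda|}{\lambda}$ for $\lambda\ne0$. An infinite Blaschke product is $u=\prod_{k\ge1}b_{\lambda_k}$ with $|\lambda_k|\le|\lambda_{k+1}|$ and $\sum_k(1-|\lambda_k|)<\infty$;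 $u_n:=\prod_{k=1}^nb_{\lambda_k}$ and $P_{u_n}$ is the orthogonal projection onto $K^2_{u_n}$. Finally $R_{u_n}:=P_{u_n}M_{u_n}J$, so $R_{u_n}^*=JM_{\overline{u_n}}P_{u_n}$. *)

theory Defs
  imports "HOL-Analysis.Analysis"
begin

type_synonym cfun = "complex \<Rightarrow> complex"
type_synonym cop = "cfun \<Rightarrow> cfun"

definition circ :: "complex measure" where
  "circ = distr (uniform_measure lborel {0..2*pi}) borel (\<lambda>\<theta>. cis \<theta>)"

definition L2 :: "cfun \<Rightarrow> bool" where
  "L2 f \<longleftrightarrow> f \<in> borel_measurable borel \<and> integrable circ (\<lambda>z. (cmod (f z))\<^sup>2)"

definition Linf :: "cfun \<Rightarrow> bool" where
  "Linf a \<longleftrightarrow> a \<in> borel_measurable borel \<and> (\<exists>C. AE z in circ. cmod (a z) \<le> C)"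

definition L2inner :: "cfun \<Rightarrow> cfun \<Rightarrow> complex" where
  "L2inner f g = (\<integral>z. f z * cnj (g z) \<partial>circ)"

text \<open>Fourier coefficients (on the circle, conj z = 1/z).\<close>
definition fcoeff :: "cfun \<Rightarrow> int \<Rightarrow> complex" where
  "fcoeff f k = (\<integral>z. f z * (cnj z) powi k \<partial>circ)"

definition H2 :: "cfun set" where
  "H2 = {g. L2 g \<and> (\<forall>k<0. fcoeff g k = 0)}"

definition Proj :: cop where
  "Proj f = (SOME g. g \<in> H2 \<and> (\<forall>h\<in>H2. L2inner (\<lambda>z. f z - g z) h = 0))"

definition Qproj :: cop where
  "Qproj f = (\<lambda>z. f z - Proj f z)"

definition Mul :: "cfun \<Rightarrow> cop" where
  "Mul a f = (\<lambda>z. a z * f z)"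

definition Jop :: cop where
  "Jop f = (\<lambda>z. inverse z * f (inverse z))"

definition tilde :: "cfun \<Rightarrow> cfun" where
  "tilde a = (\<lambda>z. a (inverse z))"

definition Hankel :: "cfun \<Rightarrow> cop" where
  "Hankel a = Proj \<circ> Mul a \<circ> Qproj \<circ> Jop"

text \<open>Projection onto the model space K_v: P_v = P - M_v P M_conj(v).\<close>
definition Pmodel :: "cfun \<Rightarrow> cop" where
  "Pmodel v f = (\<lambda>z. Proj f z - Mul v (Proj (Mul (\<lambda>w. cnj (v w)) f)) z)"

definition TTO :: "cfun \<Rightarrow> cfun \<Rightarrow> cop" where
  "TTO u a = Pmodel u \<circ> Mul a \<circ> Pmodel u"

definition bfactor :: "complex \<Rightarrow> complex \<Rightarrow> complex" where
  "bfactor c z = (if c = 0 then z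
      else (c - z) / (1 - cnj c * z) * (complex_of_real (cmod c) / c))"

definition partial_blaschke :: "(nat \<Rightarrow> complex) \<Rightarrow> nat \<Rightarrow> cfun" where
  "partial_blaschke lam n = (\<lambda>z. \<Prod>k\<in>{1..n}. bfactor (lam k) z)"

definition blaschke_disc :: "(nat \<Rightarrow> complex) \<Rightarrow> cfun" where
  "blaschke_disc lam = (\<lambda>z. \<Prod>k. bfactor (lam (Suc k)) z)"

definition blaschke_bdry :: "(nat \<Rightarrow> complex) \<Rightarrow> cfun" where
  "blaschke_bdry lam = (\<lambda>\<zeta>. Lim (at_left (1::real)) (\<lambda>r. blaschke_disc lam (complex_of_real r * \<zeta>)))"

definition Rop :: "cfun \<Rightarrow> cop" where
  "Rop v = Pmodel v \<circ> Mul v \<circ> Jop"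

definition Rop_adj :: "cfun \<Rightarrow> cop" where
  "Rop_adj v = Jop \<circ> Mul (\<lambda>z. cnj (v z)) \<circ> Pmodel v"

end

theory Submission
  imports Defs "HOL-Complex_Analysis.Cauchy_Integral_Formula" "HOL-Real_Asymp.Real_Asymp"
begin

text \<open>Write \<open>v\<close> for the partial product \<open>u\<^sub>n\<close> and \<open>g = P\<^sub>v f\<close>. Since \<open>u = v s\<close> with \<open>s\<close> multiplying
  \<open>H\<^sup>2\<close> into itself, \<open>P\<^sub>v P\<^sub>u = P\<^sub>v = P\<^sub>u P\<^sub>v\<close>, so \<open>u\<close> disappears from the identity. With \<open>J P J = Q\<close> the
  two Hankel terms become \<open>P\<^sub>v a Q b g\<close> and \<open>P\<^sub>v a v P (cnj v) b g\<close>, and these add up with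
  \<open>P\<^sub>v a P\<^sub>v b g\<close> because \<open>P\<^sub>v + v P (cnj v) + Q\<close> is the identity.

  The analytic point is that the boundary function \<open>u\<close>, a radial limit, really is \<open>v s\<close> almost
  everywhere. The tails of the product tend to 1 in \<open>L\<^sup>2\<close>, because their means do; an \<open>L\<^sup>2\<close> maximal
  inequality for the Poisson kernel and the Borel-Cantelli lemma turn this into uniform convergence
  along almost every radius of a subsequence of the partial products.\<close>

section \<open>Normalised Lebesgue measure on the circle\<close>

text \<open>Operators act on functions rather than on classes, and \<open>Proj\<close> is a chosen
  representative, so all identities hold almost everywhere and projections are compared through
  their Fourier coefficients. Two facts support this: an integrable function with vanishing
  coefficients is null, and \<open>L2\<close> is complete, so that the choice in \<open>Proj\<close>
  is not empty. The definition of \<open>blaschke_bdry\<close> shapes the rest. Convergence of the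
  partial products on the circle alone would give some boundary function, not necessarily the radial
  limit: the limits in the radius and in the number of factors have to be interchanged, hence an
  estimate of the tails that is uniform in the radius. Moreover \<open>Linf\<close> demands Borel
  measurability on the whole plane, so radial limits are examined also off the circle, even outside
  the disc, where the factors have poles.\<close>

lemma sets_circ [simp, measurable_cong]: "sets circ = sets borel"
  by (simp add: circ_def)

lemma space_circ [simp]: "space circ = UNIV"
  by (simp add: circ_def)

lemma borel_measurable_cis [measurable]: "cis \<in> borel_measurable borel"
  by (intro borel_measurable_continuous_onI continuous_intros)

lemma circ_eq_density:
  "circ = distr (density lborel (\<lambda>\<theta>. ennreal (indicator {0..2*pi} \<theta> / (2*pi)))) borel cis"
proof -
  have "indicator {0..2*pi} \<theta> / ennreal (2*pi) = ennreal (indicator {0..2*pi} \<theta> / (2*pi))" for \<theta> :: real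
    by (auto simp: indicator_def divide_ennreal[symmetric])
  then show ?thesis
    unfolding circ_def uniform_measure_def by simp
qed

lemma nn_integral_circ:
  assumes [measurable]: "f \<in> borel_measurable borel"
  shows "(\<integral>\<^sup>+z. f z \<partial>circ) = (\<integral>\<^sup>+\<theta>. ennreal (indicator {0..2*pi} \<theta> / (2*pi)) * f (cis \<theta>) \<partial>lborel)"
  unfolding circ_eq_density by (simp add: nn_integral_distr nn_integral_density)

lemma borel_measurable_cnj [measurable]: "cnj \<in> borel_measurable borel"
  by (intro borel_measurable_continuous_onI continuous_intros)

lemma emeasure_circ_UNIV [simp]: "emeasure circ UNIV = 1"
proof -
  have "emeasure circ UNIV = (\<integral>\<^sup>+z. 1 \<partial>circ)" by simp
  also have "\<dots> = (\<integral>\<^sup>+\<theta>. ennreal (1 / (2*pi)) * indicator {0..2*pi} \<theta> \<partial>lborel)"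
    by (subst nn_integral_circ) (auto intro!: nn_integral_cong simp: indicator_def)
  also have "\<dots> = 1"
    by (subst nn_integral_cmult_indicator) (auto simp: ennreal_mult[symmetric])
  finally show ?thesis .
qed

interpretation circ: finite_measure circ
  by standard simp

lemma measure_circ_UNIV [simp]: "measure circ UNIV = 1"
  by (simp add: measure_def)

lemma AE_circ_norm_1: "AE z in circ. cmod z = 1"
  unfolding circ_eq_density
  by (subst AE_distr_iff) auto

lemma distr_circ_inverse: "distr circ borel inverse = circ"
proof (rule measure_eqI)
  fix A assume "A \<in> sets (distr circ borel inverse)"
  then have [measurable]: "A \<in> sets borel" by simp
  have [measurable]: "inverse \<in> borel_measurable (borel :: complex measure)"
    by measurable
  have "emeasure (distr circ borel inverse) A = (\<integral>\<^sup>+z. indicator A (inverse z) \<partial>circ)"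
    using nn_integral_distr[of inverse circ borel "indicator A"] by simp
  also have "\<dots> = (\<integral>\<^sup>+\<theta>. ennreal (indicator {0..2*pi} \<theta> / (2*pi)) * indicator A (cis (-\<theta>)) \<partial>lborel)"
    by (subst nn_integral_circ) auto
  \<comment> \<open>The substitution of \<open>2*pi - \<theta>\<close> maps the interval onto itself
    and, by periodicity of \<open>cis\<close>, undoes the sign change that inversion
    produces.\<close>
  also have "\<dots> = (\<integral>\<^sup>+\<theta>. ennreal (indicator {0..2*pi} (2*pi - \<theta>) / (2*pi)) * indicator A (cis (-(2*pi-\<theta>))) \<partial>lborel)"
    by (subst nn_integral_real_affine[where c="-1" and t="2*pi"]) auto
  also have "\<dots> = (\<integral>\<^sup>+\<theta>. ennreal (indicator {0..2*pi} \<theta> / (2*pi)) * indicator A (cis \<theta>) \<partial>lborel)"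
  proof (intro nn_integral_cong arg_cong2[where f="(*)"] arg_cong[where f=ennreal])
    fix \<theta> :: real
    have "cis (-(2*pi-\<theta>)) = cis \<theta>" by (simp add: complex_eq_iff cos_diff sin_diff)
    then show "indicator A (cis (-(2*pi-\<theta>))) = (indicator A (cis \<theta>) :: ennreal)" by simp
  qed (auto simp: indicator_def)
  also have "\<dots> = emeasure circ A"
    by (subst nn_integral_circ[symmetric]) auto
  finally show "emeasure (distr circ borel inverse) A = emeasure circ A" .
qed simp

lemma integral_circ_inverse:
  fixes f :: "complex \<Rightarrow> 'b::{banach, second_countable_topology}"
  assumes [measurable]: "f \<in> borel_measurable borel"
  shows "(\<integral>z. f (inverse z) \<partial>circ) = (\<integral>z. f z \<partial>circ)"
  by (subst (2) distr_circ_inverse[symmetric], subst integral_distr) auto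

lemma integrable_circ_inverse:
  fixes f :: "complex \<Rightarrow> 'b::{banach, second_countable_topology}"
  assumes [measurable]: "f \<in> borel_measurable borel"
  shows "integrable circ (\<lambda>z. f (inverse z)) \<longleftrightarrow> integrable circ f"
  by (subst (2) distr_circ_inverse[symmetric], subst integrable_distr_eq) auto

lemma AE_circ_inverse:
  assumes "AE z in circ. P z" shows "AE z in circ. P (inverse z)"
proof -
  have "AE z in distr circ borel inverse. P z" unfolding distr_circ_inverse by (rule assms)
  then show ?thesis by (intro AE_distrD[where f=inverse and M'=borel]) auto
qed

lemma integrable_circ_bounded:
  fixes f :: "complex \<Rightarrow> 'b::{banach, second_countable_topology}"
  assumes [measurable]: "f \<in> borel_measurable borel" and "\<And>z. cmod z = 1 \<Longrightarrow> norm (f z) \<le> C"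
  shows "integrable circ f"
  using AE_circ_norm_1 by (intro circ.integrable_const_bound[of _ C]) (auto elim!: eventually_mono intro: assms)

lemma inverse_eq_cnj: "cmod z = 1 \<Longrightarrow> inverse z = cnj z"
  by (rule inverse_unique) (metis complex_norm_square of_real_1 one_power2)

section \<open>Cauchy's formula as an integral over the circle\<close>

lemma integral_circ_cis:
  fixes f :: "complex \<Rightarrow> complex"
  assumes [measurable]: "f \<in> borel_measurable borel" and cont: "continuous_on (sphere 0 1) f"
  shows "((\<lambda>\<theta>. f (cis \<theta>)) has_integral (2 * pi * (\<integral>z. f z \<partial>circ))) {0..2*pi}"
proof -
  have c: "continuous_on {0..2*pi} (\<lambda>\<theta>. f (cis \<theta>))"
    by (intro continuous_on_compose2[OF cont] continuous_intros) auto
  then have si: "set_integrable lborel {0..2*pi} (\<lambda>\<theta>. f (cis \<theta>))"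
    by (rule borel_integrable_atLeastAtMost')
  have "(\<integral>z. f z \<partial>circ) = (\<integral>\<theta>. (indicator {0..2*pi} \<theta> / (2*pi)) *\<^sub>R f (cis \<theta>) \<partial>lborel)"
    unfolding circ_eq_density by (simp add: integral_distr integral_density)
  also have "\<dots> = (\<integral>\<theta>. (1/(2*pi)) *\<^sub>R (indicator {0..2*pi} \<theta> *\<^sub>R f (cis \<theta>)) \<partial>lborel)"
    by (intro Bochner_Integration.integral_cong) auto
  also have "\<dots> = (1/(2*pi)) *\<^sub>R (LINT \<theta>:{0..2*pi}|lborel. f (cis \<theta>))"
    unfolding set_lebesgue_integral_def by (rule integral_scaleR_right)
  also have "(LINT \<theta>:{0..2*pi}|lborel. f (cis \<theta>)) = integral {0..2*pi} (\<lambda>\<theta>. f (cis \<theta>))"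
    using si by (rule set_borel_integral_eq_integral)
  finally have "2 * pi * (\<integral>z. f z \<partial>circ) = integral {0..2*pi} (\<lambda>\<theta>. f (cis \<theta>))"
    by (simp add: scaleR_conv_of_real)
  then show ?thesis
    using integrable_integral[OF integrable_continuous_real[OF c]] by simp
qed

text \<open>On the circle \<open>z - w = z * (1 - w * cnj z)\<close> and dz = i z d\<theta>, so the
  contour integral of \<open>f z / (z - w)\<close> turns into an integral against normalised arc
  length.\<close>

lemma circ_Cauchy:
  assumes [measurable]: "f \<in> borel_measurable borel" and hol: "f holomorphic_on cball 0 1" and w: "cmod w < 1"
  shows "(\<integral>z. f z / (1 - w * cnj z) \<partial>circ) = f w"
proof -
  have ne: "1 - w * cnj z \<noteq> 0" if "cmod z = 1" for z
  proof
    assume "1 - w * cnj z = 0"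
    then have "cmod (w * cnj z) = 1" by (metis norm_one right_minus_eq)
    then show False using that w by (simp add: norm_mult)
  qed
  have "((\<lambda>u. f u / (u - w)) has_contour_integral (2 * of_real pi * \<i> * f w)) (circlepath 0 1)"
    using hol w by (intro Cauchy_integral_circlepath_simple) auto
  then have 1: "((\<lambda>t. f (cis t) / (cis t - w) * \<i> * cis t) has_integral (2 * of_real pi * \<i> * f w)) {0..2*pi}"
    unfolding circlepath_def by (subst (asm) has_contour_integral_part_circlepath_iff) auto
  have 2: "((\<lambda>t. \<i> * (f (cis t) / (1 - w * cnj (cis t)))) has_integral \<i> * (2 * pi * (\<integral>z. f z / (1 - w * cnj z) \<partial>circ))) {0..2*pi}"
  proof (intro has_integral_mult_right integral_circ_cis[of "\<lambda>z. f z / (1 - w * cnj z)"])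
    have "continuous_on (sphere 0 1) f"
      using holomorphic_on_imp_continuous_on[OF hol] by (rule continuous_on_subset) auto
    then show "continuous_on (sphere 0 1) (\<lambda>z. f z / (1 - w * cnj z))"
      using ne by (intro continuous_intros) auto
  qed measurable
  have "f (cis t) / (cis t - w) * \<i> * cis t = \<i> * (f (cis t) / (1 - w * cnj (cis t)))" for t
  proof -
    have "cis t - w = cis t * (1 - w * cnj (cis t))"
      by (simp add: algebra_simps cis_cnj cis_mult)
    then show ?thesis by simp
  qed
  then have "2 * of_real pi * \<i> * f w = \<i> * (2 * pi * (\<integral>z. f z / (1 - w * cnj z) \<partial>circ))"
    using has_integral_unique[OF 1] 2 by simp
  then show ?thesis by simp
qed

corollary circ_mean_value:
  assumes "f \<in> borel_measurable borel" and "f holomorphic_on cball 0 1"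
  shows "(\<integral>z. f z \<partial>circ) = f 0"
  using circ_Cauchy[OF assms, of 0] by simp

section \<open>Square-integrable functions and Fourier coefficients\<close>

lemma borel_measurable_powi [measurable (raw)]:
  fixes f :: "'a \<Rightarrow> complex"
  assumes [measurable]: "f \<in> borel_measurable M"
  shows "(\<lambda>x. f x powi k) \<in> borel_measurable M"
  unfolding power_int_def by measurable

lemma borel_measurable_cnj' [measurable (raw)]:
  "f \<in> borel_measurable M \<Longrightarrow> (\<lambda>x. cnj (f x)) \<in> borel_measurable M"
  by measurable

lemma L2D [measurable_dest]: "L2 f \<Longrightarrow> f \<in> borel_measurable borel"
  by (simp add: L2_def)

lemma L2_integrable: "L2 f \<Longrightarrow> integrable circ (\<lambda>z. (cmod (f z))\<^sup>2)"
  by (simp add: L2_def)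

lemma LinfD [measurable_dest]: "Linf f \<Longrightarrow> f \<in> borel_measurable borel"
  by (simp add: Linf_def)

lemma two_mult_le_squares: "2 * (x * y) \<le> x\<^sup>2 + (y::real)\<^sup>2"
  using sum_squares_bound[of x y] by simp

lemma L2_integrable_mult:
  assumes [measurable]: "L2 f" "L2 g"
  shows "integrable circ (\<lambda>z. f z * g z)"
proof (rule Bochner_Integration.integrable_bound)
  show "integrable circ (\<lambda>z. (cmod (f z))\<^sup>2 + (cmod (g z))\<^sup>2)"
    using assms by (intro Bochner_Integration.integrable_add L2_integrable)
  show "AE z in circ. norm (f z * g z) \<le> norm ((cmod (f z))\<^sup>2 + (cmod (g z))\<^sup>2)"
  proof (rule AE_I2)
    fix z
    have "0 \<le> cmod (f z) * cmod (g z)" by simp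
    with two_mult_le_squares[of "cmod (f z)" "cmod (g z)"]
    have "cmod (f z) * cmod (g z) \<le> (cmod (f z))\<^sup>2 + (cmod (g z))\<^sup>2" by linarith
    then show "norm (f z * g z) \<le> norm ((cmod (f z))\<^sup>2 + (cmod (g z))\<^sup>2)"
      by (simp add: norm_mult)
  qed
qed measurable

lemma L2_bounded:
  assumes [measurable]: "f \<in> borel_measurable borel" and "\<And>z. cmod z = 1 \<Longrightarrow> cmod (f z) \<le> C"
  shows "L2 f"
  unfolding L2_def
  using assms(2) by (auto intro!: integrable_circ_bounded[where C="C\<^sup>2"] power_mono)

lemma Linf_bounded:
  assumes [measurable]: "f \<in> borel_measurable borel" and "\<And>z. cmod z = 1 \<Longrightarrow> cmod (f z) \<le> C"
  shows "Linf f"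
  unfolding Linf_def using assms AE_circ_norm_1 by (auto elim!: eventually_mono intro!: exI[of _ C])

lemma L2_mult:
  assumes "Linf a" "L2 f" shows "L2 (\<lambda>z. a z * f z)"
proof -
  from assms have [measurable]: "a \<in> borel_measurable borel" "f \<in> borel_measurable borel" by (auto simp: L2D LinfD)
  obtain C where C: "AE z in circ. cmod (a z) \<le> C" using assms by (auto simp: Linf_def)
  have "integrable circ (\<lambda>z. (cmod (a z * f z))\<^sup>2)"
  proof (rule Bochner_Integration.integrable_bound)
    show "integrable circ (\<lambda>z. C\<^sup>2 * (cmod (f z))\<^sup>2)" using assms by (intro integrable_mult_right L2_integrable)
    show "AE z in circ. norm ((cmod (a z * f z))\<^sup>2) \<le> norm (C\<^sup>2 * (cmod (f z))\<^sup>2)"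
      using C by eventually_elim (auto simp: norm_mult power_mult_distrib intro!: mult_right_mono power_mono)
  qed measurable
  then show ?thesis unfolding L2_def by auto
qed

lemma L2_Mul: "Linf a \<Longrightarrow> L2 f \<Longrightarrow> L2 (Mul a f)"
  unfolding Mul_def by (rule L2_mult)

lemma L2_cmult: "L2 f \<Longrightarrow> L2 (\<lambda>z. c * f z)"
  by (rule L2_mult) (auto simp: Linf_def)

lemma Linf_mult:
  assumes a: "Linf a" and b: "Linf b" shows "Linf (\<lambda>z. a z * b z)"
proof -
  from a b have [measurable]: "a \<in> borel_measurable borel" "b \<in> borel_measurable borel" by (auto simp: LinfD)
  obtain C D where C: "AE z in circ. cmod (a z) \<le> C" and D: "AE z in circ. cmod (b z) \<le> D"
    using a b by (auto simp: Linf_def)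
  have "AE z in circ. cmod (a z * b z) \<le> \<bar>C\<bar> * \<bar>D\<bar>"
    using C D by eventually_elim (auto simp: norm_mult intro!: mult_mono)
  then show ?thesis unfolding Linf_def by auto
qed

lemma Linf_cnj: "Linf a \<Longrightarrow> Linf (\<lambda>z. cnj (a z))"
  unfolding Linf_def by auto

lemma L2_add:
  assumes [measurable]: "L2 f" "L2 g" shows "L2 (\<lambda>z. f z + g z)"
proof -
  have "integrable circ (\<lambda>z. (cmod (f z + g z))\<^sup>2)"
  proof (rule Bochner_Integration.integrable_bound)
    show "integrable circ (\<lambda>z. 2 * (cmod (f z))\<^sup>2 + 2 * (cmod (g z))\<^sup>2)"
      using assms by (intro Bochner_Integration.integrable_add integrable_mult_right L2_integrable)
    show "AE z in circ. norm ((cmod (f z + g z))\<^sup>2) \<le> norm (2 * (cmod (f z))\<^sup>2 + 2 * (cmod (g z))\<^sup>2)"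
    proof (rule AE_I2)
      fix z
      have "(cmod (f z + g z))\<^sup>2 \<le> (cmod (f z) + cmod (g z))\<^sup>2"
        by (intro power_mono norm_triangle_ineq) auto
      also have "\<dots> \<le> 2 * (cmod (f z))\<^sup>2 + 2 * (cmod (g z))\<^sup>2"
        using two_mult_le_squares[of "cmod (f z)" "cmod (g z)"] by (simp add: power2_sum)
      finally show "norm ((cmod (f z + g z))\<^sup>2) \<le> norm (2 * (cmod (f z))\<^sup>2 + 2 * (cmod (g z))\<^sup>2)" by simp
    qed
  qed measurable
  then show ?thesis unfolding L2_def by auto
qed

lemma L2_diff: "L2 f \<Longrightarrow> L2 g \<Longrightarrow> L2 (\<lambda>z. f z - g z)"
  using L2_add[of f "\<lambda>z. (-1) * g z"] L2_cmult[of g "-1"] by simp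

lemma L2_sum: "(\<And>i. i \<in> I \<Longrightarrow> L2 (f i)) \<Longrightarrow> L2 (\<lambda>z. \<Sum>i\<in>I. f i z)"
proof (induction I rule: infinite_finite_induct)
  case (insert x F)
  then show ?case using L2_add by simp
qed (auto intro: L2_bounded)

lemma L2_cnj: "L2 f \<Longrightarrow> L2 (\<lambda>z. cnj (f z))"
  unfolding L2_def by auto

lemma L2_powi: "L2 (\<lambda>z. z powi k)"
  by (rule L2_bounded[of _ 1]) (auto simp: norm_power_int)

lemma L2_Jop:
  assumes "L2 f" shows "L2 (Jop f)"
proof -
  have [measurable]: "f \<in> borel_measurable borel" by (rule L2D) fact
  have "integrable circ (\<lambda>z. (cmod (f (inverse z)))\<^sup>2)"
    by (subst integrable_circ_inverse) (auto simp: L2_integrable assms)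
  moreover have "(\<lambda>z. f (inverse z)) \<in> borel_measurable borel" by measurable
  ultimately have "L2 (\<lambda>z. f (inverse z))" unfolding L2_def by simp
  moreover have "Linf inverse" by (rule Linf_bounded[of _ 1]) (auto simp: norm_inverse)
  ultimately show ?thesis unfolding Jop_def by (intro L2_mult)
qed

lemma Linf_tilde: "Linf a \<Longrightarrow> Linf (tilde a)"
  using AE_circ_inverse unfolding Linf_def tilde_def by fastforce

section \<open>Squared norm and inner product\<close>

definition nsq :: "cfun \<Rightarrow> real" where
  "nsq f = (\<integral>z. (cmod (f z))\<^sup>2 \<partial>circ)"

lemma nsq_nonneg: "0 \<le> nsq f"
  unfolding nsq_def by (rule Bochner_Integration.integral_nonneg) auto

lemma L2inner_self: "L2inner f f = of_real (nsq f)"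
  unfolding L2inner_def nsq_def
  unfolding complex_norm_square[symmetric] of_real_power[symmetric] by (rule integral_complex_of_real)

lemma L2inner_integrable: "L2 f \<Longrightarrow> L2 g \<Longrightarrow> integrable circ (\<lambda>z. f z * cnj (g z))"
  by (intro L2_integrable_mult L2_cnj)

lemma L2inner_diff_left: "L2 f \<Longrightarrow> L2 g \<Longrightarrow> L2 h \<Longrightarrow> L2inner (\<lambda>z. f z - g z) h = L2inner f h - L2inner g h"
  unfolding L2inner_def by (simp add: algebra_simps L2inner_integrable)

lemma L2inner_diff_right: "L2 f \<Longrightarrow> L2 g \<Longrightarrow> L2 h \<Longrightarrow> L2inner h (\<lambda>z. f z - g z) = L2inner h f - L2inner h g"
  unfolding L2inner_def by (simp add: algebra_simps L2inner_integrable)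

lemma L2inner_commute: "L2inner g f = cnj (L2inner f g)"
  unfolding L2inner_def Bochner_Integration.integral_cnj[symmetric] by (simp add: mult.commute)

lemma L2inner_Cauchy_Schwarz:
  assumes [measurable]: "L2 f" "L2 g"
  shows "(cmod (L2inner f g))\<^sup>2 \<le> nsq f * nsq g"
proof -
  have int: "integrable circ (\<lambda>z. cmod (f z * cnj (g z)))"
    by (intro integrable_norm L2inner_integrable assms)
  have sq: "(\<integral>\<^sup>+z. (ennreal (cmod (h z)))\<^sup>2 \<partial>circ) = ennreal (nsq h)" if "L2 h" for h
    unfolding nsq_def using that
    by (subst nn_integral_eq_integral[symmetric]) (auto simp: L2_integrable ennreal_power)
  have "cmod (L2inner f g) \<le> (\<integral>z. cmod (f z * cnj (g z)) \<partial>circ)"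
    unfolding L2inner_def by (rule integral_norm_bound)
  then have "ennreal ((cmod (L2inner f g))\<^sup>2) \<le> (ennreal (\<integral>z. cmod (f z * cnj (g z)) \<partial>circ))\<^sup>2"
    by (simp add: ennreal_power power_mono)
  also have "ennreal (\<integral>z. cmod (f z * cnj (g z)) \<partial>circ) = (\<integral>\<^sup>+z. ennreal (cmod (f z)) * ennreal (cmod (g z)) \<partial>circ)"
    by (subst nn_integral_eq_integral[symmetric]) (use int in \<open>auto simp: norm_mult ennreal_mult\<close>)
  also have "\<dots>\<^sup>2 \<le> ennreal (nsq f) * ennreal (nsq g)"
    using Cauchy_Schwarz_nn_integral[of "\<lambda>z. ennreal (cmod (f z))" circ "\<lambda>z. ennreal (cmod (g z))"]
    by (simp add: sq assms)
  finally show ?thesis by (simp add: nsq_nonneg ennreal_mult[symmetric])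
qed

lemma L2inner_tendsto_0:
  assumes "L2 w" "\<And>n. L2 (d n)" "(\<lambda>n. nsq (d n)) \<longlonglongrightarrow> 0"
  shows "(\<lambda>n. L2inner w (d n)) \<longlonglongrightarrow> 0"
proof -
  have "(\<lambda>n. nsq w * nsq (d n)) \<longlonglongrightarrow> 0" using tendsto_mult_right_zero[OF assms(3)] by simp
  then have "(\<lambda>n. (cmod (L2inner w (d n)))\<^sup>2) \<longlonglongrightarrow> 0"
    by (rule tendsto_0_le[where K=1]) (use L2inner_Cauchy_Schwarz assms in \<open>auto intro!: always_eventually simp: abs_mult nsq_nonneg\<close>)
  then have "(\<lambda>n. sqrt ((cmod (L2inner w (d n)))\<^sup>2)) \<longlonglongrightarrow> sqrt 0" by (rule tendsto_real_sqrt)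
  then show ?thesis by (simp add: tendsto_norm_zero_iff)
qed

section \<open>Rules for Fourier coefficients\<close>

lemma fcoeff_eq_L2inner: "fcoeff f k = L2inner f (\<lambda>z. z powi k)"
  unfolding fcoeff_def L2inner_def by (simp add: complex_cnj_power_int)

lemma fcoeff_integrable:
  "integrable circ f \<Longrightarrow> integrable circ (\<lambda>z. f z * (cnj z) powi k)"
proof (rule Bochner_Integration.integrable_bound[of _ f])
  assume [measurable]: "integrable circ f"
  show "(\<lambda>z. f z * (cnj z) powi k) \<in> borel_measurable circ" by measurable
  show "AE z in circ. norm (f z * cnj z powi k) \<le> norm (f z)"
    using AE_circ_norm_1 by eventually_elim (simp add: norm_mult norm_power_int)
qed

lemma L2_imp_integrable: "L2 f \<Longrightarrow> integrable circ f"
  using L2_integrable_mult[of f "\<lambda>z. 1", OF _ L2_bounded[of "\<lambda>z. 1" 1]] by simp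

lemma fcoeff_add: "integrable circ f \<Longrightarrow> integrable circ g \<Longrightarrow> fcoeff (\<lambda>z. f z + g z) k = fcoeff f k + fcoeff g k"
  unfolding fcoeff_def by (simp add: algebra_simps fcoeff_integrable)

lemma fcoeff_diff: "integrable circ f \<Longrightarrow> integrable circ g \<Longrightarrow> fcoeff (\<lambda>z. f z - g z) k = fcoeff f k - fcoeff g k"
  unfolding fcoeff_def by (simp add: algebra_simps fcoeff_integrable)

lemma fcoeff_cmult: "fcoeff (\<lambda>z. c * f z) k = c * fcoeff f k"
  unfolding fcoeff_def by (simp add: mult.assoc)

lemma fcoeff_cong_AE:
  assumes [measurable]: "f \<in> borel_measurable borel" "g \<in> borel_measurable borel" and "AE z in circ. f z = g z"
  shows "fcoeff f k = fcoeff g k"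
  unfolding fcoeff_def by (rule integral_cong_AE) (use assms(3) in auto)

lemma fcoeff_shift:
  assumes [measurable]: "f \<in> borel_measurable borel"
  shows "fcoeff (\<lambda>z. z powi m * f z) k = fcoeff f (k - m)"
  unfolding fcoeff_def
proof (rule integral_cong_AE)
  show "AE z in circ. z powi m * f z * cnj z powi k = f z * cnj z powi (k - m)"
    using AE_circ_norm_1
  proof eventually_elim
    fix z assume "cmod z = 1"
    then have "cnj z = inverse z" "z \<noteq> 0" by (auto simp: inverse_eq_cnj)
    then show "z powi m * f z * cnj z powi k = f z * cnj z powi (k - m)"
      by (simp add: power_int_inverse power_int_diff divide_inverse)
  qed
qed measurable

text \<open>Orthogonality of the powers comes from the mean value property: on the circle the
  integrand is a nonnegative power of z for k < 0 and the conjugate of one for k >= 0.\<close>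

lemma fcoeff_one: "fcoeff (\<lambda>z. 1) k = of_bool (k = 0)"
proof -
  have pos: "(\<integral>z. z ^ n \<partial>circ) = of_bool (n = 0)" for n :: nat
    by (subst circ_mean_value) (auto intro!: holomorphic_intros)
  have "(\<integral>z. cnj z powi k \<partial>circ) = of_bool (k = 0)"
  proof (cases "k \<ge> 0")
    case True
    have "(\<integral>z. cnj z powi k \<partial>circ) = (\<integral>z. cnj (z ^ nat k) \<partial>circ)"
      using True by (simp add: power_int_def)
    also have "\<dots> = cnj (\<integral>z. z ^ nat k \<partial>circ)" by (rule Bochner_Integration.integral_cnj)
    finally show ?thesis using True by (auto simp: pos)
  next
    case False
    have "(\<integral>z. cnj z powi k \<partial>circ) = (\<integral>z. z ^ nat (-k) \<partial>circ)"
    proof (rule integral_cong_AE)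
      show "AE z in circ. cnj z powi k = z ^ nat (-k)"
        using AE_circ_norm_1
      proof eventually_elim
        fix z assume "cmod z = 1"
        then have "cnj z = inverse z" by (auto simp: inverse_eq_cnj)
        then show "cnj z powi k = z ^ nat (-k)" using False by (simp add: power_int_def)
      qed
    qed measurable
    then show ?thesis using False by (simp add: pos)
  qed
  then show ?thesis by (simp add: fcoeff_def)
qed

lemma fcoeff_powi: "fcoeff (\<lambda>z. z powi j) k = of_bool (j = k)"
  using fcoeff_shift[of "\<lambda>z. 1" j k] by (auto simp: fcoeff_one)

text \<open>\<open>Jop\<close> reflects frequencies about -1/2 and so swaps the nonnegative with the
  negative ones; every exchange between \<open>H2\<close> and its complement comes from
  this.\<close>

lemma fcoeff_Jop:
  assumes [measurable]: "f \<in> borel_measurable borel"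
  shows "fcoeff (Jop f) k = fcoeff f (- k - 1)"
proof -
  have "fcoeff (Jop f) k = (\<integral>z. z * f z * cnj (inverse z) powi k \<partial>circ)"
    unfolding fcoeff_def Jop_def by (subst integral_circ_inverse[symmetric]) auto
  also have "\<dots> = fcoeff f (- k - 1)"
    unfolding fcoeff_def
  proof (rule integral_cong_AE)
    show "AE z in circ. z * f z * cnj (inverse z) powi k = f z * cnj z powi (- k - 1)"
      using AE_circ_norm_1
    proof eventually_elim
      fix z assume "cmod z = 1"
      then have "cnj z = inverse z" "z \<noteq> 0" by (auto simp: inverse_eq_cnj)
      then show "z * f z * cnj (inverse z) powi k = f z * cnj z powi (- k - 1)"
        by (simp add: power_int_inverse power_int_diff power_int_minus divide_inverse)
    qed
  qed measurable
  finally show ?thesis .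
qed

lemma fcoeff_sum:
  assumes "\<And>i. i \<in> I \<Longrightarrow> integrable circ (f i)"
  shows "fcoeff (\<lambda>z. \<Sum>i\<in>I. f i z) k = (\<Sum>i\<in>I. fcoeff (f i) k)"
  unfolding fcoeff_def using assms
  by (simp add: sum_distrib_right Bochner_Integration.integral_sum fcoeff_integrable)

section \<open>Uniqueness of Fourier coefficients and completeness\<close>

lemma fcoeff_times_powi_zero:
  assumes "integrable circ w" and "\<And>k. fcoeff w k = 0"
  shows "integrable circ (\<lambda>z. z powi m * w z)" and "fcoeff (\<lambda>z. z powi m * w z) k = 0"
proof -
  have [measurable]: "w \<in> borel_measurable borel" using assms(1) by simp
  show "integrable circ (\<lambda>z. z powi m * w z)"
  proof (rule Bochner_Integration.integrable_bound[of _ w])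
    show "AE z in circ. norm (z powi m * w z) \<le> norm (w z)"
      using AE_circ_norm_1 by eventually_elim (simp add: norm_mult norm_power_int)
  qed (use assms in auto)
  show "fcoeff (\<lambda>z. z powi m * w z) k = 0"
    using assms by (subst fcoeff_shift) auto
qed

text \<open>On the circle a real-linear function of z is a combination of z and 1/z, so multiplying
  by it only shifts frequencies by one. The induction varies \<open>w\<close> because a product of
  polynomials is applied as two successive multiplications.\<close>

lemma fcoeff_polynomial_mult_zero:
  assumes "real_polynomial_function p" and "integrable circ w" and "\<And>k. fcoeff w k = 0"
  shows "integrable circ (\<lambda>z. of_real (p z) * w z) \<and> (\<forall>k. fcoeff (\<lambda>z. of_real (p z) * w z) k = 0)"
  using assms
proof (induction p arbitrary: w rule: real_polynomial_function.induct)
  case (linear f)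
  have [measurable]: "w \<in> borel_measurable borel" using linear(2) by simp
  have [measurable]: "f \<in> borel_measurable borel"
    using linear(1) by (intro borel_measurable_continuous_onI linear_continuous_on)
  \<comment> \<open>The coefficients of z and \<open>cnj z\<close> in
    \<open>Re z * f 1 + Im z * f \<i>\<close>.\<close>
  define \<alpha> \<beta> where "\<alpha> = (of_real (f 1) - \<i> * of_real (f \<i>)) / 2" and "\<beta> = (of_real (f 1) + \<i> * of_real (f \<i>)) / 2"
  have ae: "AE z in circ. of_real (f z) * w z = \<alpha> * (z powi 1 * w z) + \<beta> * (z powi (-1) * w z)"
    using AE_circ_norm_1
  proof eventually_elim
    fix z assume z: "cmod z = 1"
    have "f z = f (Re z *\<^sub>R 1 + Im z *\<^sub>R \<i>)"
      by (rule arg_cong[where f=f]) (simp add: complex_eq_iff)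
    also have "\<dots> = Re z * f 1 + Im z * f \<i>"
      using linear(1) by (simp add: linear_simps)
    finally have "of_real (f z) = \<alpha> * z + \<beta> * cnj z"
      unfolding \<alpha>_def \<beta>_def by (simp add: complex_eq_iff field_simps)
    then show "of_real (f z) * w z = \<alpha> * (z powi 1 * w z) + \<beta> * (z powi (-1) * w z)"
      using z by (simp add: inverse_eq_cnj algebra_simps power_int_minus)
  qed
  have int: "integrable circ (\<lambda>z. z powi m * w z)" and co: "fcoeff (\<lambda>z. z powi m * w z) k = 0" for m k
    by (intro fcoeff_times_powi_zero linear)+
  have "integrable circ (\<lambda>z. \<alpha> * (z powi 1 * w z) + \<beta> * (z powi (-1) * w z))"
    by (intro Bochner_Integration.integrable_add integrable_mult_right int)
  moreover have "fcoeff (\<lambda>z. \<alpha> * (z powi 1 * w z) + \<beta> * (z powi (-1) * w z)) k = 0" for k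
    by (subst fcoeff_add) (intro integrable_mult_right int | simp only: fcoeff_cmult co mult_zero_right add_0)+
  moreover have "fcoeff (\<lambda>z. of_real (f z) * w z) k = fcoeff (\<lambda>z. \<alpha> * (z powi 1 * w z) + \<beta> * (z powi (-1) * w z)) k" for k
    by (rule fcoeff_cong_AE[OF _ _ ae]) measurable
  moreover have "integrable circ (\<lambda>z. of_real (f z) * w z) \<longleftrightarrow> integrable circ (\<lambda>z. \<alpha> * (z powi 1 * w z) + \<beta> * (z powi (-1) * w z))"
    by (rule integrable_cong_AE[OF _ _ ae]) measurable
  ultimately show ?case by auto
next
  case (const c)
  then show ?case by (simp add: fcoeff_cmult)
next
  case (add f g)
  then show ?case by (simp add: algebra_simps fcoeff_add)
next
  case (mult f g)
  have "integrable circ (\<lambda>z. of_real (f z) * (of_real (g z) * w z)) \<and> (\<forall>k. fcoeff (\<lambda>z. of_real (f z) * (of_real (g z) * w z)) k = 0)"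
    using mult.IH(2)[OF mult.prems] by (intro mult.IH(1)) auto
  then show ?case by (simp add: mult.assoc)
qed

text \<open>Stone-Weierstrass on the compact circle reduces the claim to polynomials, with an error
  at most e times the integral of \<open>cmod (w z)\<close>.\<close>

lemma integral_continuous_mult_zero:
  fixes \<phi> :: "complex \<Rightarrow> real"
  assumes w: "integrable circ w" and co: "\<And>k. fcoeff w k = 0" and cont: "continuous_on UNIV \<phi>"
  shows "(\<integral>z. of_real (\<phi> z) * w z \<partial>circ) = 0"
proof -
  have [measurable]: "w \<in> borel_measurable borel" using w by simp
  have [measurable]: "\<phi> \<in> borel_measurable borel" using cont by (rule borel_measurable_continuous_onI)
  define N where "N = (\<integral>z. cmod (w z) \<partial>circ)"
  have N: "0 \<le> N" unfolding N_def by (rule Bochner_Integration.integral_nonneg) auto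
  have le: "cmod (\<integral>z. of_real (\<phi> z) * w z \<partial>circ) \<le> e * N" if e: "e > 0" for e
  proof -
    have "continuous_on (sphere 0 1) \<phi>" using cont continuous_on_subset by blast
    from Stone_Weierstrass_real_polynomial_function[OF compact_sphere this e]
    obtain p where p: "real_polynomial_function p" "\<And>z. z \<in> sphere 0 1 \<Longrightarrow> \<bar>\<phi> z - p z\<bar> < e"
      by blast
    have [measurable]: "p \<in> borel_measurable borel"
      using p(1) by (intro borel_measurable_continuous_onI)
        (simp add: continuous_on_polymonial_function real_polynomial_function_eq)
    note P = fcoeff_polynomial_mult_zero[OF p(1) w co]
    have "(\<integral>z. of_real (p z) * w z \<partial>circ) = 0"
      using conjunct2[OF P, rule_format, of 0] by (simp add: fcoeff_def)
    have ae: "AE z in circ. cmod (of_real (\<phi> z - p z) * w z) \<le> e * cmod (w z)"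
      using AE_circ_norm_1
    proof eventually_elim
      fix z assume "cmod z = 1"
      then show "cmod (of_real (\<phi> z - p z) * w z) \<le> e * cmod (w z)"
        using p(2)[of z] unfolding norm_mult norm_of_real by (intro mult_right_mono) auto
    qed
    have i: "integrable circ (\<lambda>z. of_real (\<phi> z - p z) * w z)"
    proof (rule Bochner_Integration.integrable_bound)
      show "integrable circ (\<lambda>z. e * cmod (w z))" using w by auto
      show "AE z in circ. norm (of_real (\<phi> z - p z) * w z) \<le> norm (e * cmod (w z))"
        using ae by eventually_elim (use e in auto)
    qed measurable
    have "(\<integral>z. of_real (\<phi> z) * w z \<partial>circ) = (\<integral>z. of_real (\<phi> z - p z) * w z + of_real (p z) * w z \<partial>circ)"
      by (simp add: algebra_simps)
    also have "\<dots> = (\<integral>z. of_real (\<phi> z - p z) * w z \<partial>circ)"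
      using i P \<open>(\<integral>z. of_real (p z) * w z \<partial>circ) = 0\<close> by (subst Bochner_Integration.integral_add) auto
    also have "cmod \<dots> \<le> (\<integral>z. e * cmod (w z) \<partial>circ)"
      using i w ae by (intro order_trans[OF integral_norm_bound integral_mono_AE]) auto
    also have "\<dots> = e * N" by (simp add: N_def)
    finally show ?thesis .
  qed
  have "cmod (\<integral>z. of_real (\<phi> z) * w z \<partial>circ) \<le> 0"
  proof (rule field_le_epsilon)
    fix d :: real assume d: "0 < d"
    have "cmod (\<integral>z. of_real (\<phi> z) * w z \<partial>circ) \<le> d / (N + 1) * N" using N d by (intro le) auto
    also have "\<dots> \<le> d" using N d by (simp add: field_simps)
    finally show "cmod (\<integral>z. of_real (\<phi> z) * w z \<partial>circ) \<le> 0 + d" by simp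
  qed
  then show ?thesis by simp
qed

text \<open>A function is null once its integrals over all Borel sets vanish. Closed sets generate
  the Borel sets and are stable under intersection, and their indicators are pointwise limits of
  continuous functions, so the Dynkin argument applies.\<close>

lemma fcoeff_unique:
  assumes w: "integrable circ w" and co: "\<And>k. fcoeff w k = 0"
  shows "AE z in circ. w z = 0"
proof (rule circ.density_zero[OF w])
  have [measurable]: "w \<in> borel_measurable borel" using w by simp
  have si: "set_integrable circ A w" if "A \<in> sets borel" for A
    unfolding set_integrable_def using that w by (intro integrable_mult_indicator) auto
  have tot: "(\<integral>z. w z \<partial>circ) = 0" using co[of 0] by (simp add: fcoeff_def)
  fix A assume "A \<in> sets circ"
  then have "A \<in> sigma_sets UNIV (Collect closed)" by (simp add: borel_eq_closed)
  then show "set_lebesgue_integral circ A w = 0"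
  proof (induction A rule: sigma_sets_induct_disjoint[rotated 2, consumes 1, case_names basic empty compl union stable sub])
    case stable show ?case by (auto simp: Int_stable_def)
  next
    case sub show ?case by auto
  next
    case empty then show ?case by (simp add: set_lebesgue_integral_def)
  next
    case (basic A)
    then have cl: "closed A" by simp
    then have [measurable]: "A \<in> sets borel" by (rule borel_closed)
    show ?case
    proof (cases "A = {}")
      case False
      \<comment> \<open>Continuous, with values between 0 and 1, equal to 1 on \<open>A\<close>; at
        a point outside it is eventually 0, since the distance to a closed set is positive
        there.\<close>
      define \<phi> where "\<phi> n z = max 0 (1 - real n * infdist z A)" for n z
      have [measurable]: "\<phi> n \<in> borel_measurable borel" for n
        unfolding \<phi>_def by (intro borel_measurable_continuous_onI continuous_intros)
      have lim: "(\<lambda>n. \<phi> n z) \<longlonglongrightarrow> indicator A z" for z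
      proof (cases "z \<in> A")
        case True then show ?thesis by (simp add: \<phi>_def)
      next
        case z: False
        then have pos: "infdist z A > 0"
          using cl False in_closed_iff_infdist_zero[of A z] infdist_nonneg[of z A] by linarith
        have "\<forall>\<^sub>F n in sequentially. 1 / infdist z A \<le> real n"
          using filterlim_real_sequentially unfolding filterlim_at_top by blast
        then have "\<forall>\<^sub>F n in sequentially. \<phi> n z = 0"
          by eventually_elim (use pos in \<open>simp add: \<phi>_def field_simps\<close>)
        then show ?thesis using z by (simp add: tendsto_eventually)
      qed
      have "(\<lambda>n. \<integral>z. of_real (\<phi> n z) * w z \<partial>circ) \<longlonglongrightarrow> (\<integral>z. of_real (indicator A z) * w z \<partial>circ)"
      proof (rule integral_dominated_convergence[where w="\<lambda>z. cmod (w z)"])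
        show "integrable circ (\<lambda>z. cmod (w z))" using w by simp
        show "AE z in circ. (\<lambda>n. of_real (\<phi> n z) * w z) \<longlonglongrightarrow> of_real (indicator A z) * w z"
          by (intro AE_I2 tendsto_intros lim)
        show "AE z in circ. norm (of_real (\<phi> n z) * w z) \<le> cmod (w z)" for n
        proof (intro AE_I2)
          fix z
          have "\<bar>\<phi> n z\<bar> \<le> 1" unfolding \<phi>_def using infdist_nonneg[of z A] by (auto simp: max_def)
          then have "\<bar>\<phi> n z\<bar> * cmod (w z) \<le> 1 * cmod (w z)" by (rule mult_right_mono) simp
          then show "norm (of_real (\<phi> n z) * w z) \<le> cmod (w z)" by (simp add: norm_mult)
        qed
      qed measurable
      moreover have "(\<integral>z. of_real (\<phi> n z) * w z \<partial>circ) = 0" for n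
        unfolding \<phi>_def by (intro integral_continuous_mult_zero w co continuous_intros)
      ultimately have "(\<integral>z. of_real (indicator A z) * w z \<partial>circ) = 0"
        by (simp add: LIMSEQ_const_iff)
      then show ?thesis by (simp add: set_lebesgue_integral_def scaleR_conv_of_real)
    qed (simp add: set_lebesgue_integral_def)
  next
    case (compl A)
    then have A: "A \<in> sets borel" by (simp add: borel_eq_closed)
    have "set_lebesgue_integral circ (UNIV - A \<union> A) w = set_lebesgue_integral circ (UNIV - A) w + set_lebesgue_integral circ A w"
      using A by (intro set_integral_Un si) auto
    then show ?case using compl tot by (simp add: set_lebesgue_integral_def)
  next
    case (union A)
    then have A: "A i \<in> sets borel" for i by (auto simp: borel_eq_closed)
    have "set_lebesgue_integral circ (\<Union>i. A i) w = (\<Sum>i. set_lebesgue_integral circ (A i) w)"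
      using A union(1) by (intro lebesgue_integral_countable_add si) (auto simp: disjoint_family_on_def)
    then show ?case using union by simp
  qed
qed

text \<open>Riesz-Fischer: a fast subsequence converges almost everywhere, its pointwise limit is
  the candidate, and Fatou's lemma carries the Cauchy bound for \<open>F n - F (r j)\<close> over to
  \<open>F n - g\<close>.\<close>

lemma L2_complete:
  assumes L2F: "\<And>n. L2 (F n)"
    and Cauchy: "\<And>e. e > 0 \<Longrightarrow> \<exists>N. \<forall>m\<ge>N. \<forall>n\<ge>N. nsq (\<lambda>z. F m z - F n z) \<le> e"
  shows "\<exists>g. L2 g \<and> (\<lambda>n. nsq (\<lambda>z. F n z - g z)) \<longlonglongrightarrow> 0"
proof -
  have [measurable]: "F n \<in> borel_measurable borel" for n by (rule L2D) fact
  have "\<forall>j. \<exists>N. \<forall>m\<ge>N. \<forall>n\<ge>N. nsq (\<lambda>z. F m z - F n z) \<le> (1/4)^j" by (intro allI Cauchy) auto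
  then obtain N where N: "\<And>j m n. m \<ge> N j \<Longrightarrow> n \<ge> N j \<Longrightarrow> nsq (\<lambda>z. F m z - F n z) \<le> (1/4)^j"
    by metis
  \<comment> \<open>The sum puts \<open>r j\<close> above every \<open>N i\<close> with i <= j; the
    summand \<open>j\<close> makes the subsequence cofinal.\<close>
  define r where "r j = (\<Sum>i\<le>j. N i) + j" for j
  have rN: "r i \<ge> N j" if "i \<ge> j" for i j
    using member_le_sum[of j "{..i}" N] that by (auto simp: r_def)
  have rj: "r j \<ge> j" for j by (simp add: r_def)
  define d where "d j z = cmod (F (r (Suc j)) z - F (r j) z)" for j z
  have [measurable]: "d j \<in> borel_measurable borel" for j unfolding d_def by measurable
  have L2d: "L2 (\<lambda>z. F m z - F n z)" for m n by (intro L2_diff L2F)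
  have nd: "(\<integral>\<^sup>+z. ennreal (d j z) \<partial>circ) \<le> ennreal ((1/2)^j)" for j
  proof -
    \<comment> \<open>Arithmetic-geometric mean with weight \<open>2^j\<close>, which balances the
      bound \<open>(1/4)^j\<close> on the squared norm against \<open>(1/2)^j\<close>. The mean of
      \<open>d j\<close> is thereby summable without square roots.\<close>
    let ?b = "\<lambda>z. (2^j * (d j z)\<^sup>2 + (1/2)^j) / 2"
    have ib: "integrable circ ?b"
      using L2_integrable[OF L2d] by (simp add: d_def)
    have pw: "d j z \<le> ?b z" for z
    proof -
      have "0 \<le> 2^j * (d j z - (1/2)^j)\<^sup>2" by simp
      also have "\<dots> = 2^j * (d j z)\<^sup>2 + (1/2)^j - 2 * d j z"
        by (simp add: power2_eq_square field_simps)
      finally show ?thesis by simp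
    qed
    have "(\<integral>\<^sup>+z. ennreal (d j z) \<partial>circ) \<le> (\<integral>\<^sup>+z. ennreal (?b z) \<partial>circ)"
      by (intro nn_integral_mono ennreal_leI pw)
    also have "\<dots> = ennreal (\<integral>z. ?b z \<partial>circ)"
      by (rule nn_integral_eq_integral[OF ib]) auto
    also have "(\<integral>z. ?b z \<partial>circ) = (2^j * nsq (\<lambda>z. F (r (Suc j)) z - F (r j) z) + (1/2)^j) / 2"
      using L2_integrable[OF L2d] by (simp add: nsq_def d_def)
    also have "\<dots> \<le> (2^j * (1/4)^j + (1/2)^j) / 2"
      using N[of j "r (Suc j)" "r j"] rN by (intro divide_right_mono add_mono mult_left_mono) auto
    also have "\<dots> = (1/2)^j" by (simp flip: power_mult_distrib)
    finally show ?thesis by (simp add: ennreal_leI)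
  qed
  have "(\<integral>\<^sup>+z. (\<Sum>j. ennreal (d j z)) \<partial>circ) = (\<Sum>j. \<integral>\<^sup>+z. ennreal (d j z) \<partial>circ)"
    by (rule nn_integral_suminf) measurable
  also have "\<dots> \<le> (\<Sum>j. ennreal ((1/2)^j))" by (intro suminf_le nd) auto
  also have "\<dots> = ennreal (\<Sum>j. (1/2)^j)" by (intro suminf_ennreal2) auto
  also have "\<dots> < \<infinity>" by simp
  finally have "(\<integral>\<^sup>+z. (\<Sum>j. ennreal (d j z)) \<partial>circ) \<noteq> \<infinity>" by auto
  then have "AE z in circ. (\<Sum>j. ennreal (d j z)) \<noteq> \<infinity>"
    by (intro nn_integral_noteq_infinite) auto
  then have conv: "AE z in circ. (\<lambda>j. F (r j) z) \<longlonglongrightarrow> lim (\<lambda>j. F (r j) z)"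
  proof eventually_elim
    fix z assume fin: "(\<Sum>j. ennreal (d j z)) \<noteq> \<infinity>"
    have "summable (\<lambda>j. d j z)"
      by (rule summable_suminf_not_top) (use fin in \<open>auto simp: d_def\<close>)
    then have "summable (\<lambda>j. F (r (Suc j)) z - F (r j) z)"
      unfolding d_def by (rule summable_norm_cancel)
    then have "convergent (\<lambda>n. \<Sum>j<n. F (r (Suc j)) z - F (r j) z)" by (simp add: summable_iff_convergent)
    then have "convergent (\<lambda>n. (\<Sum>j<n. F (r (Suc j)) z - F (r j) z) + F (r 0) z)"
      by (intro convergent_add convergent_const)
    then have "convergent (\<lambda>j. F (r j) z)" by (simp add: sum_lessThan_telescope[of "\<lambda>j. F (r j) z"])
    then show "(\<lambda>j. F (r j) z) \<longlonglongrightarrow> lim (\<lambda>j. F (r j) z)" by (simp add: convergent_LIMSEQ_iff)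
  qed
  define g where "g z = lim (\<lambda>j. F (r j) z)" for z
  have [measurable]: "g \<in> borel_measurable borel" unfolding g_def by measurable
  have fatou: "(\<integral>\<^sup>+z. ennreal ((cmod (F n z - g z))\<^sup>2) \<partial>circ) \<le> ennreal e"
    if M: "\<forall>m\<ge>M. \<forall>n\<ge>M. nsq (\<lambda>z. F m z - F n z) \<le> e" "n \<ge> M" for n M e
  proof -
    have "(\<integral>\<^sup>+z. ennreal ((cmod (F n z - g z))\<^sup>2) \<partial>circ)
        = (\<integral>\<^sup>+z. liminf (\<lambda>j. ennreal ((cmod (F n z - F (r j) z))\<^sup>2)) \<partial>circ)"
    proof (rule nn_integral_cong_AE)
      show "AE z in circ. ennreal ((cmod (F n z - g z))\<^sup>2) = liminf (\<lambda>j. ennreal ((cmod (F n z - F (r j) z))\<^sup>2))"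
        using conv unfolding g_def[symmetric]
      proof eventually_elim
        fix z assume "(\<lambda>j. F (r j) z) \<longlonglongrightarrow> g z"
        then have "(\<lambda>j. ennreal ((cmod (F n z - F (r j) z))\<^sup>2)) \<longlonglongrightarrow> ennreal ((cmod (F n z - g z))\<^sup>2)"
          by (intro tendsto_intros)
        then show "ennreal ((cmod (F n z - g z))\<^sup>2) = liminf (\<lambda>j. ennreal ((cmod (F n z - F (r j) z))\<^sup>2))"
          by (rule lim_imp_Liminf[symmetric, rotated]) simp
      qed
    qed
    also have "\<dots> \<le> liminf (\<lambda>j. \<integral>\<^sup>+z. ennreal ((cmod (F n z - F (r j) z))\<^sup>2) \<partial>circ)"
      by (rule nn_integral_liminf) measurable
    also have "\<dots> \<le> ennreal e"
    proof (rule Liminf_le)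
      have "(\<integral>\<^sup>+z. ennreal ((cmod (F n z - F (r j) z))\<^sup>2) \<partial>circ) \<le> ennreal e" if "j \<ge> M" for j
      proof -
        have "(\<integral>\<^sup>+z. ennreal ((cmod (F n z - F (r j) z))\<^sup>2) \<partial>circ) = ennreal (nsq (\<lambda>z. F n z - F (r j) z))"
          unfolding nsq_def by (rule nn_integral_eq_integral) (use L2_integrable[OF L2d] in auto)
        also have "\<dots> \<le> ennreal e" using M that rj[of j] by (intro ennreal_leI) auto
        finally show ?thesis .
      qed
      then show "\<forall>\<^sub>F j in sequentially. (\<integral>\<^sup>+z. ennreal ((cmod (F n z - F (r j) z))\<^sup>2) \<partial>circ) \<le> ennreal e"
        using eventually_sequentially by blast
    qed simp
    finally show ?thesis .
  qed
  obtain M1 where M1: "\<forall>m\<ge>M1. \<forall>n\<ge>M1. nsq (\<lambda>z. F m z - F n z) \<le> 1" using Cauchy[of 1] by auto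
  \<comment> \<open>Finiteness of the Fatou bound at a single index already puts \<open>g\<close>
    into \<open>L2\<close>.\<close>
  have L2diff: "L2 (\<lambda>z. F M1 z - g z)"
    unfolding L2_def
    using fatou[OF M1, of M1] by (auto intro!: integrableI_bounded simp: le_less_trans)
  have "L2 g" using L2_diff[OF L2F[of M1] L2diff] by simp
  moreover have "(\<lambda>n. nsq (\<lambda>z. F n z - g z)) \<longlonglongrightarrow> 0"
  proof (rule LIMSEQ_I)
    fix e :: real assume e: "0 < e"
    then obtain M where M: "\<forall>m\<ge>M. \<forall>n\<ge>M. nsq (\<lambda>z. F m z - F n z) \<le> e/2" using Cauchy[of "e/2"] by auto
    have "nsq (\<lambda>z. F n z - g z) \<le> e/2" if "n \<ge> M" for n
    proof -
      have "ennreal (nsq (\<lambda>z. F n z - g z)) = (\<integral>\<^sup>+z. ennreal ((cmod (F n z - g z))\<^sup>2) \<partial>circ)"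
        unfolding nsq_def by (rule nn_integral_eq_integral[symmetric]) (use L2_integrable[OF L2_diff[OF L2F \<open>L2 g\<close>]] in auto)
      also have "\<dots> \<le> ennreal (e/2)" by (rule fatou[OF M that])
      finally show ?thesis using e by simp
    qed
    then show "\<exists>no. \<forall>n\<ge>no. norm (nsq (\<lambda>z. F n z - g z) - 0) < e"
      using e by (intro exI[of _ M]) (force simp: nsq_nonneg)
  qed
  ultimately show ?thesis by blast
qed

section \<open>The Riesz projection\<close>

lemma L2_eqI_fcoeff:
  assumes "L2 f" "L2 g" "\<And>k. fcoeff f k = fcoeff g k"
  shows "AE z in circ. f z = g z"
proof -
  have "AE z in circ. f z - g z = 0"
    using assms by (intro fcoeff_unique) (auto simp: fcoeff_diff L2_imp_integrable)
  then show ?thesis by simp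
qed

section \<open>Trigonometric polynomials and Bessel's inequality\<close>

definition trig :: "(int \<Rightarrow> complex) \<Rightarrow> int set \<Rightarrow> cfun" where
  "trig c F = (\<lambda>z. \<Sum>k\<in>F. c k * z powi k)"

lemma L2_trig: "L2 (trig c F)"
  unfolding trig_def by (intro L2_sum L2_cmult L2_powi)

lemma fcoeff_trig: "finite F \<Longrightarrow> fcoeff (trig c F) k = (if k \<in> F then c k else 0)"
  unfolding trig_def
  by (subst fcoeff_sum) (auto intro!: L2_imp_integrable L2_cmult L2_powi simp: fcoeff_cmult fcoeff_powi if_distrib sum.delta of_bool_def cong: if_cong)

lemma L2inner_trig:
  assumes "L2 f" shows "L2inner f (trig c F) = (\<Sum>k\<in>F. cnj (c k) * fcoeff f k)"
proof -
  have "L2inner f (trig c F) = (\<integral>z. (\<Sum>k\<in>F. cnj (c k) * (f z * cnj z powi k)) \<partial>circ)"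
    unfolding L2inner_def trig_def by (simp add: sum_distrib_left complex_cnj_power_int mult_ac)
  also have "\<dots> = (\<Sum>k\<in>F. cnj (c k) * fcoeff f k)"
    unfolding fcoeff_def using assms
    by (subst Bochner_Integration.integral_sum)
      (auto intro: integrable_mult_right[OF fcoeff_integrable[OF L2_imp_integrable]])
  finally show ?thesis .
qed

lemma nsq_trig: "finite F \<Longrightarrow> nsq (trig c F) = (\<Sum>k\<in>F. (cmod (c k))\<^sup>2)"
proof -
  assume "finite F"
  then have "complex_of_real (nsq (trig c F)) = (\<Sum>k\<in>F. cnj (c k) * c k)"
    unfolding L2inner_self[symmetric] by (simp add: L2inner_trig L2_trig fcoeff_trig)
  also have "\<dots> = of_real (\<Sum>k\<in>F. (cmod (c k))\<^sup>2)"
    by (simp add: complex_norm_square mult.commute del: of_real_power)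
  finally show ?thesis using of_real_eq_iff by blast
qed

lemma Bessel:
  assumes "L2 f" "finite F"
  shows "(\<Sum>k\<in>F. (cmod (fcoeff f k))\<^sup>2) \<le> nsq f"
proof -
  let ?S = "trig (fcoeff f) F"
  let ?s = "\<Sum>k\<in>F. (cmod (fcoeff f k))\<^sup>2"
  have fS: "L2inner f ?S = of_real ?s"
    using assms by (simp add: L2inner_trig complex_norm_square mult.commute del: of_real_power)
  then have Sf: "L2inner ?S f = of_real ?s" by (subst L2inner_commute) simp
  have "complex_of_real (nsq (\<lambda>z. f z - ?S z)) = L2inner f f - L2inner f ?S - (L2inner ?S f - L2inner ?S ?S)"
    unfolding L2inner_self[symmetric]
    using assms by (simp add: L2inner_diff_left L2inner_diff_right L2_trig L2_diff)
  also have "\<dots> = of_real (nsq f - ?s)"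
    by (simp add: fS Sf L2inner_self nsq_trig assms)
  finally have "nsq (\<lambda>z. f z - ?S z) = nsq f - ?s" using of_real_eq_iff by blast
  then show ?thesis using nsq_nonneg[of "\<lambda>z. f z - ?S z"] by simp
qed

text \<open>The partial sums over nonnegative frequencies are Cauchy because Bessel's inequality
  bounds their squared norms; their limit is the Riesz projection. The mode of convergence is
  recorded since orthogonality to all of \<open>H2\<close> is deduced from it.\<close>

lemma analytic_part_exists:
  assumes f: "L2 f"
  shows "\<exists>g. L2 g \<and> (\<forall>k. fcoeff g k = (if k \<ge> 0 then fcoeff f k else 0)) \<and>
     (\<lambda>n. nsq (\<lambda>z. trig (fcoeff f) {0..<int n} z - g z)) \<longlonglongrightarrow> 0"
proof -
  let ?S = "\<lambda>n. trig (fcoeff f) {0..<int n}"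
  define s where "s n = (\<Sum>k\<in>{0..<int n}. (cmod (fcoeff f k))\<^sup>2)" for n
  have "convergent s"
  proof (rule Bseq_mono_convergent)
    show "Bseq s" unfolding s_def
      by (rule BseqI'[of _ "nsq f"]) (auto intro!: Bessel f simp: sum_nonneg)
    show "\<forall>m n. m \<le> n \<longrightarrow> s m \<le> s n" unfolding s_def by (auto intro!: sum_mono2)
  qed
  then have Cs: "Cauchy s" by (simp add: Cauchy_convergent_iff)
  have diff: "nsq (\<lambda>z. ?S m z - ?S n z) = s m - s n" if "n \<le> m" for m n
  proof -
    have split: "{0..<int m} = {0..<int n} \<union> {int n..<int m}" using that by auto
    have "(\<lambda>z. ?S m z - ?S n z) = trig (fcoeff f) {int n..<int m}"
      unfolding trig_def split by (subst sum.union_disjoint) auto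
    then show ?thesis
      unfolding s_def split by (subst sum.union_disjoint) (auto simp: nsq_trig)
  qed
  have flip: "nsq (\<lambda>z. F z - G z) = nsq (\<lambda>z. G z - F z)" for F G
    unfolding nsq_def by (simp add: norm_minus_commute)
  have "nsq (\<lambda>z. ?S m z - ?S n z) = \<bar>s m - s n\<bar>" for m n
  proof (cases "n \<le> m")
    case True then show ?thesis using diff[OF True] nsq_nonneg[of "\<lambda>z. ?S m z - ?S n z"] by simp
  next
    case False
    then show ?thesis using diff[of m n] nsq_nonneg[of "\<lambda>z. ?S n z - ?S m z"] flip[of "?S m" "?S n"] by simp
  qed
  then have "\<exists>N. \<forall>m\<ge>N. \<forall>n\<ge>N. nsq (\<lambda>z. ?S m z - ?S n z) \<le> e" if "e > 0" for e
    using Cs that unfolding Cauchy_def dist_real_def by (metis less_imp_le)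
  from L2_complete[OF L2_trig this] obtain g where g: "L2 g" "(\<lambda>n. nsq (\<lambda>z. ?S n z - g z)) \<longlonglongrightarrow> 0"
    by auto
  have "fcoeff g k = (if k \<ge> 0 then fcoeff f k else 0)" for k
  proof -
    have "(\<lambda>n. L2inner (\<lambda>z. z powi k) (\<lambda>z. ?S n z - g z)) \<longlonglongrightarrow> 0"
      using g by (intro L2inner_tendsto_0 L2_powi L2_diff L2_trig)
    then have "(\<lambda>n. cnj (L2inner (\<lambda>z. z powi k) (\<lambda>z. ?S n z - g z))) \<longlonglongrightarrow> cnj 0"
      by (rule tendsto_cnj)
    then have lim: "(\<lambda>n. fcoeff (?S n) k - fcoeff g k) \<longlonglongrightarrow> 0"
      using g by (simp add: L2inner_commute[symmetric] fcoeff_eq_L2inner[symmetric] fcoeff_diff L2_imp_integrable L2_trig)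
    have "\<forall>\<^sub>F n in sequentially. fcoeff (?S n) k - fcoeff g k = (if k \<ge> 0 then fcoeff f k else 0) - fcoeff g k"
      using eventually_gt_at_top[of "nat k"] by eventually_elim (auto simp: fcoeff_trig)
    then have "(\<lambda>n. (if k \<ge> 0 then fcoeff f k else 0) - fcoeff g k) \<longlonglongrightarrow> 0"
      by (rule Lim_transform_eventually[OF lim])
    then show ?thesis by (simp only: LIMSEQ_const_iff) simp
  qed
  with g show ?thesis by blast
qed

lemma H2D: "f \<in> H2 \<Longrightarrow> L2 f" "f \<in> H2 \<Longrightarrow> k < 0 \<Longrightarrow> fcoeff f k = 0"
  by (auto simp: H2_def)

text \<open>The hypothesis only gives orthogonality to the monomials. It extends to \<open>h\<close>
  because \<open>h\<close> agrees almost everywhere with the \<open>L2\<close> limit of its own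
  partial sums and the inner product is continuous.\<close>

lemma L2inner_H2_zero:
  assumes w: "L2 w" "\<And>k. k \<ge> 0 \<Longrightarrow> fcoeff w k = 0" and h: "h \<in> H2"
  shows "L2inner w h = 0"
proof -
  have L2h: "L2 h" using h by (rule H2D)
  obtain g where g: "L2 g" "\<And>k. fcoeff g k = (if k \<ge> 0 then fcoeff h k else 0)"
      "(\<lambda>n. nsq (\<lambda>z. trig (fcoeff h) {0..<int n} z - g z)) \<longlonglongrightarrow> 0"
    using analytic_part_exists[OF L2h] by blast
  have gh: "AE z in circ. g z = h z"
    using h g by (intro L2_eqI_fcoeff) (auto simp: H2_def)
  have [measurable]: "g \<in> borel_measurable borel" "h \<in> borel_measurable borel" "w \<in> borel_measurable borel"
    using g L2h w by (auto simp: L2D)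
  have "(\<lambda>n. L2inner w (\<lambda>z. trig (fcoeff h) {0..<int n} z - g z)) \<longlonglongrightarrow> 0"
    using w g by (intro L2inner_tendsto_0 L2_diff L2_trig)
  moreover have "L2inner w (\<lambda>z. trig (fcoeff h) {0..<int n} z - g z) = - L2inner w g" for n
    using w g by (simp add: L2inner_diff_right L2_trig L2inner_trig)
  ultimately have "L2inner w g = 0" by (simp add: LIMSEQ_const_iff)
  moreover have "L2inner w h = L2inner w g"
    unfolding L2inner_def by (rule integral_cong_AE) (use gh in auto)
  ultimately show ?thesis by simp
qed

lemma Proj_props:
  assumes f: "L2 f"
  shows "Proj f \<in> H2 \<and> (\<forall>h\<in>H2. L2inner (\<lambda>z. f z - Proj f z) h = 0)"
proof -
  obtain g where g: "L2 g" "\<And>k. fcoeff g k = (if k \<ge> 0 then fcoeff f k else 0)"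
    using analytic_part_exists[OF f] by blast
  then have "g \<in> H2" by (simp add: H2_def)
  moreover have "L2inner (\<lambda>z. f z - g z) h = 0" if "h \<in> H2" for h
    using g f that by (intro L2inner_H2_zero) (auto simp: L2_diff fcoeff_diff L2_imp_integrable)
  ultimately have "\<exists>g. g \<in> H2 \<and> (\<forall>h\<in>H2. L2inner (\<lambda>z. f z - g z) h = 0)" by blast
  then show ?thesis unfolding Proj_def by (rule someI_ex)
qed

lemma Proj_H2: "L2 f \<Longrightarrow> Proj f \<in> H2"
  using Proj_props by blast

lemma L2_Proj: "L2 f \<Longrightarrow> L2 (Proj f)"
  using Proj_H2 H2D by blast

lemma powi_H2: "k \<ge> 0 \<Longrightarrow> (\<lambda>z. z powi k) \<in> H2"
  by (simp add: H2_def L2_powi fcoeff_powi)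

text \<open>\<open>SOME\<close> determines \<open>Proj f\<close> only up to null sets. The
  coefficients do not depend on the representative, and the later rules for \<open>Proj\<close> are
  derived from them.\<close>

lemma fcoeff_Proj:
  assumes f: "L2 f"
  shows "fcoeff (Proj f) k = (if k \<ge> 0 then fcoeff f k else 0)"
proof (cases "k \<ge> 0")
  case True
  then have "fcoeff (\<lambda>z. f z - Proj f z) k = 0"
    unfolding fcoeff_eq_L2inner using Proj_props[OF f] powi_H2 by blast
  then show ?thesis using True f by (simp add: fcoeff_diff L2_imp_integrable L2_Proj)
next
  case False
  then show ?thesis using H2D(2)[OF Proj_H2[OF f]] by simp
qed

section \<open>Widom's identity for a divisor of an inner function\<close>

abbreviation (input) ae_eq :: "cfun \<Rightarrow> cfun \<Rightarrow> bool"  (infix "\<doteq>" 50) where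
  "f \<doteq> g \<equiv> (AE z in circ. f z = g z)"

text \<open>The orthogonal complement of \<open>H2\<close> in \<open>L2\<close>, that is, up to null
  sets, the range of \<open>Qproj\<close>.\<close>

definition coanalytic :: "cfun \<Rightarrow> bool" where
  "coanalytic f \<longleftrightarrow> L2 f \<and> (\<forall>k\<ge>0. fcoeff f k = 0)"

text \<open>Bounded analytic functions, described by their action on \<open>H2\<close>: closure
  under products is immediate and no extension into the disc is involved.\<close>

definition multiplier :: "cfun \<Rightarrow> bool" where
  "multiplier v \<longleftrightarrow> Linf v \<and> (\<forall>h\<in>H2. (\<lambda>z. v z * h z) \<in> H2)"

lemma multiplierD: "multiplier v \<Longrightarrow> Linf v" "multiplier v \<Longrightarrow> h \<in> H2 \<Longrightarrow> (\<lambda>z. v z * h z) \<in> H2"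
  by (auto simp: multiplier_def)

lemma multiplier_mult: "multiplier v \<Longrightarrow> multiplier w \<Longrightarrow> multiplier (\<lambda>z. v z * w z)"
  by (auto simp: multiplier_def Linf_mult mult.assoc)

lemma H2_diff: "f \<in> H2 \<Longrightarrow> g \<in> H2 \<Longrightarrow> (\<lambda>z. f z - g z) \<in> H2"
  by (auto simp: H2_def L2_diff fcoeff_diff L2_imp_integrable)

lemma Proj_eqI:
  assumes "L2 f" "L2 g" "\<And>k. k \<ge> 0 \<Longrightarrow> fcoeff g k = fcoeff f k" "\<And>k. k < 0 \<Longrightarrow> fcoeff g k = 0"
  shows "Proj f \<doteq> g"
  using assms by (intro L2_eqI_fcoeff) (auto simp: L2_Proj fcoeff_Proj)

lemma Proj_cong:
  assumes "L2 f" "L2 g" "f \<doteq> g" shows "Proj f \<doteq> Proj g"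
proof (rule Proj_eqI)
  have "fcoeff f k = fcoeff g k" for k by (intro fcoeff_cong_AE assms L2D)
  then show "fcoeff (Proj g) k = fcoeff f k" if "k \<ge> 0" for k using that assms by (simp add: fcoeff_Proj)
qed (use assms in \<open>auto simp: fcoeff_Proj L2_Proj\<close>)

lemma Proj_add:
  assumes "L2 f" "L2 g" shows "Proj (\<lambda>z. f z + g z) \<doteq> (\<lambda>z. Proj f z + Proj g z)"
  using assms by (intro Proj_eqI) (auto simp: L2_Proj L2_add fcoeff_add fcoeff_Proj L2_imp_integrable)

lemma Proj_H2_id: "f \<in> H2 \<Longrightarrow> Proj f \<doteq> f"
  by (intro Proj_eqI) (auto simp: H2_def)

lemma Proj_coanalytic: "coanalytic f \<Longrightarrow> Proj f \<doteq> (\<lambda>z. 0)"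
  by (intro Proj_eqI) (auto simp: coanalytic_def fcoeff_def intro!: L2_bounded)

lemma L2_Qproj: "L2 f \<Longrightarrow> L2 (Qproj f)"
  unfolding Qproj_def by (intro L2_diff L2_Proj)

lemma coanalytic_Qproj: "L2 f \<Longrightarrow> coanalytic (Qproj f)"
  unfolding coanalytic_def using L2_Qproj[of f]
  by (auto simp: Qproj_def fcoeff_diff L2_imp_integrable L2_Proj fcoeff_Proj)

lemma Qproj_coanalytic: "coanalytic f \<Longrightarrow> Qproj f \<doteq> f"
  using Proj_coanalytic[of f] unfolding Qproj_def by auto

lemma Qproj_cong: "L2 f \<Longrightarrow> L2 g \<Longrightarrow> f \<doteq> g \<Longrightarrow> Qproj f \<doteq> Qproj g"
  using Proj_cong[of f g] unfolding Qproj_def by auto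

text \<open>Adjointness: in the pairing with a power of z the factor \<open>cnj v\<close> moves over
  as \<open>v\<close>, and \<open>v\<close> times an analytic power stays in
  \<open>H2\<close>.\<close>

lemma coanalytic_cnj_mult:
  assumes v: "multiplier v" and f: "coanalytic f"
  shows "coanalytic (\<lambda>z. cnj (v z) * f z)"
proof -
  have L: "L2 (\<lambda>z. cnj (v z) * f z)" using assms by (auto simp: coanalytic_def multiplier_def intro: L2_mult Linf_cnj)
  have "fcoeff (\<lambda>z. cnj (v z) * f z) k = 0" if k: "k \<ge> 0" for k
  proof -
    have "fcoeff (\<lambda>z. cnj (v z) * f z) k = L2inner f (\<lambda>z. v z * z powi k)"
      unfolding fcoeff_def L2inner_def by (simp add: complex_cnj_power_int mult_ac)
    also have "\<dots> = 0"
      using f multiplierD(2)[OF v powi_H2[OF k]] by (intro L2inner_H2_zero) (auto simp: coanalytic_def)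
    finally show ?thesis .
  qed
  with L show ?thesis by (simp add: coanalytic_def)
qed

section \<open>The projection onto the model space\<close>

lemma L2_Pmodel: "Linf v \<Longrightarrow> L2 f \<Longrightarrow> L2 (Pmodel v f)"
  unfolding Pmodel_def by (intro L2_diff L2_Proj L2_Mul Linf_cnj)

lemma Pmodel_cong:
  assumes v: "Linf v" and f: "L2 f" and g: "L2 g" and fg: "f \<doteq> g"
  shows "Pmodel v f \<doteq> Pmodel v g"
proof -
  have "Proj (Mul (\<lambda>w. cnj (v w)) f) \<doteq> Proj (Mul (\<lambda>w. cnj (v w)) g)"
  proof (rule Proj_cong)
    show "Mul (\<lambda>w. cnj (v w)) f \<doteq> Mul (\<lambda>w. cnj (v w)) g" using fg by eventually_elim (simp add: Mul_def)
  qed (intro L2_Mul Linf_cnj v f g)+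
  with Proj_cong[OF f g fg] show ?thesis
    by eventually_elim (simp add: Pmodel_def Mul_def)
qed

lemma Pmodel_add:
  assumes v: "Linf v" and f: "L2 f" and g: "L2 g"
  shows "Pmodel v (\<lambda>z. f z + g z) \<doteq> (\<lambda>z. Pmodel v f z + Pmodel v g z)"
proof -
  have "Proj (\<lambda>z. Mul (\<lambda>w. cnj (v w)) f z + Mul (\<lambda>w. cnj (v w)) g z) \<doteq>
    (\<lambda>z. Proj (Mul (\<lambda>w. cnj (v w)) f) z + Proj (Mul (\<lambda>w. cnj (v w)) g) z)"
    by (intro Proj_add L2_Mul Linf_cnj v f g)
  with Proj_add[OF f g] show ?thesis
    by eventually_elim (simp add: Pmodel_def Mul_def algebra_simps)
qed

lemma Pmodel_H2: "multiplier v \<Longrightarrow> L2 f \<Longrightarrow> Pmodel v f \<in> H2"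
  unfolding Pmodel_def Mul_def
  by (intro H2_diff Proj_H2 multiplierD(2) L2_mult Linf_cnj multiplierD(1))

text \<open>Together with \<open>Pmodel_H2\<close> this places \<open>P_v f\<close> in the model
  space. As v is unimodular, \<open>cnj v P_v f\<close> equals
  \<open>cnj v P f - P (cnj v f)\<close>, which is \<open>Q (cnj v f) - cnj v Q f\<close>, and both
  of these terms are coanalytic.\<close>

lemma coanalytic_cnj_Pmodel:
  assumes v: "multiplier v" and v1: "AE z in circ. cmod (v z) = 1" and f: "L2 f"
  shows "coanalytic (\<lambda>z. cnj (v z) * Pmodel v f z)"
proof -
  note Lv = multiplierD(1)[OF v]
  let ?h = "\<lambda>z. cnj (v z) * f z"
  have Lh: "L2 ?h" by (intro L2_mult Linf_cnj Lv f)
  have Q: "coanalytic (\<lambda>z. cnj (v z) * Qproj f z)"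
    by (intro coanalytic_cnj_mult v coanalytic_Qproj f)
  have L: "L2 (\<lambda>z. cnj (v z) * Pmodel v f z)"
    by (intro L2_mult Linf_cnj Lv L2_Pmodel f)
  have LR: "L2 (\<lambda>z. Qproj ?h z - cnj (v z) * Qproj f z)"
    by (intro L2_diff L2_Qproj L2_mult Linf_cnj Lv f Lh)
  have ae: "(\<lambda>z. cnj (v z) * Pmodel v f z) \<doteq> (\<lambda>z. Qproj ?h z - cnj (v z) * Qproj f z)"
    using v1
  proof eventually_elim
    fix z assume "cmod (v z) = 1"
    then have "cnj (v z) * v z = 1" by (metis complex_norm_square mult.commute of_real_1 one_power2)
    then have *: "cnj (v z) * (v z * x) = x" for x by (simp flip: mult.assoc)
    show "cnj (v z) * Pmodel v f z = Qproj ?h z - cnj (v z) * Qproj f z"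
      by (simp add: Pmodel_def Mul_def Qproj_def right_diff_distrib *)
  qed
  have "fcoeff (\<lambda>z. cnj (v z) * Pmodel v f z) k = 0" if "k \<ge> 0" for k
  proof -
    have "fcoeff (\<lambda>z. cnj (v z) * Pmodel v f z) k = fcoeff (\<lambda>z. Qproj ?h z - cnj (v z) * Qproj f z) k"
      by (rule fcoeff_cong_AE[OF L2D[OF L] L2D[OF LR] ae])
    also have "\<dots> = 0"
      using coanalytic_Qproj[OF Lh] Q that
      by (subst fcoeff_diff) (auto simp: coanalytic_def L2_imp_integrable)
    finally show ?thesis .
  qed
  with L show ?thesis by (simp add: coanalytic_def)
qed

text \<open>The two hypotheses are the working description of the model space: \<open>P\<close>
  fixes \<open>g\<close>, and the term subtracted in \<open>P_v g\<close> vanishes.\<close>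

lemma Pmodel_fixed:
  assumes g: "g \<in> H2" and v: "coanalytic (\<lambda>z. cnj (v z) * g z)"
  shows "Pmodel v g \<doteq> g"
  using Proj_H2_id[OF g] Proj_coanalytic[OF v]
  by eventually_elim (simp add: Pmodel_def Mul_def)

lemma Pmodel_coanalytic:
  assumes v: "multiplier v" and f: "coanalytic f"
  shows "Pmodel v f \<doteq> (\<lambda>z. 0)"
  using Proj_coanalytic[OF f] Proj_coanalytic[OF coanalytic_cnj_mult[OF v f]]
  by eventually_elim (simp add: Pmodel_def Mul_def)

text \<open>For unimodular v both terms in the definition of \<open>P_v\<close> reduce to
  \<open>v h\<close> and cancel.\<close>

lemma Pmodel_mult_H2:
  assumes v: "multiplier v" and v1: "AE z in circ. cmod (v z) = 1" and h: "h \<in> H2"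
  shows "Pmodel v (\<lambda>z. v z * h z) \<doteq> (\<lambda>z. 0)"
proof -
  have Lh: "L2 h" using h by (rule H2D)
  have "(\<lambda>z. cnj (v z) * (v z * h z)) \<doteq> h"
    using v1
  proof eventually_elim
    fix z assume "cmod (v z) = 1"
    then have "cnj (v z) * v z = 1" by (metis complex_norm_square mult.commute of_real_1 one_power2)
    then show "cnj (v z) * (v z * h z) = h z" by (simp flip: mult.assoc)
  qed
  then have "Proj (\<lambda>z. cnj (v z) * (v z * h z)) \<doteq> Proj h"
    by (intro Proj_cong L2_mult Linf_cnj Lh multiplierD(1)[OF v])
  with Proj_H2_id[OF h] Proj_H2_id[OF multiplierD(2)[OF v h]] show ?thesis
    by eventually_elim (simp add: Pmodel_def Mul_def)
qed

lemma Pmodel_Proj: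
  assumes v: "multiplier v" and f: "L2 f"
  shows "Pmodel v (Proj f) \<doteq> Pmodel v f"
proof -
  note Lv = multiplierD(1)[OF v]
  have "Pmodel v (\<lambda>z. Proj f z + Qproj f z) \<doteq> (\<lambda>z. Pmodel v (Proj f) z + Pmodel v (Qproj f) z)"
    by (intro Pmodel_add Lv L2_Proj L2_Qproj f)
  moreover have "(\<lambda>z. Proj f z + Qproj f z) = f" by (simp add: Qproj_def)
  ultimately show ?thesis
    using Pmodel_coanalytic[OF v coanalytic_Qproj[OF f]] by auto
qed

text \<open>\<open>P_u h\<close> is \<open>P h\<close> minus \<open>v s P (cnj u h)\<close>. The
  latter lies in \<open>v H2\<close>, which \<open>P_v\<close> annihilates, and
  \<open>P_v P h = P_v h\<close>.\<close>

lemma Pmodel_Pmodel_factor: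
  assumes v: "multiplier v" and v1: "AE z in circ. cmod (v z) = 1" and s: "multiplier s"
    and u: "Linf u" and us: "u \<doteq> (\<lambda>z. v z * s z)" and h: "L2 h"
  shows "Pmodel v (Pmodel u h) \<doteq> Pmodel v h"
proof -
  note Lv = multiplierD(1)[OF v]
  define p where "p = Proj (Mul (\<lambda>w. cnj (u w)) h)"
  have p: "p \<in> H2" unfolding p_def by (intro Proj_H2 L2_Mul Linf_cnj u h)
  \<comment> \<open>The sign is absorbed here so that the difference becomes a sum, to which
    \<open>Pmodel_add\<close> applies.\<close>
  define q where "q = (\<lambda>z. v z * (s z * - p z))"
  have mp: "(\<lambda>z. - p z) \<in> H2"
    using H2_diff[of "\<lambda>z. 0" p] p H2_diff[OF p p] by simp
  have sp: "(\<lambda>z. s z * - p z) \<in> H2" by (rule multiplierD(2)[OF s mp])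
  have Lq: "L2 q" unfolding q_def by (intro L2_mult Lv H2D(1)[OF sp])
  have "Pmodel u h \<doteq> (\<lambda>z. Proj h z + q z)"
    using us by eventually_elim (simp add: Pmodel_def Mul_def p_def q_def)
  then have "Pmodel v (Pmodel u h) \<doteq> Pmodel v (\<lambda>z. Proj h z + q z)"
    by (intro Pmodel_cong Lv L2_Pmodel L2_add L2_Proj u h Lq)
  moreover have "Pmodel v (\<lambda>z. Proj h z + q z) \<doteq> (\<lambda>z. Pmodel v (Proj h) z + Pmodel v q z)"
    by (intro Pmodel_add Lv L2_Proj h Lq)
  moreover have "Pmodel v q \<doteq> (\<lambda>z. 0)" unfolding q_def by (rule Pmodel_mult_H2[OF v v1 sp])
  ultimately show ?thesis using Pmodel_Proj[OF v h] by eventually_elim simp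
qed

section \<open>The flip and the Hankel operators\<close>

lemma coanalytic_Jop: "f \<in> H2 \<Longrightarrow> coanalytic (Jop f)"
  unfolding coanalytic_def using H2D[of f] by (auto simp: L2_Jop fcoeff_Jop L2D)

lemma Jop_Jop: "Jop (Jop f) \<doteq> f"
  using AE_circ_norm_1
proof eventually_elim
  fix z :: complex assume "cmod z = 1"
  then have "z \<noteq> 0" by auto
  then show "Jop (Jop f) z = f z" by (simp add: Jop_def)
qed

lemma Jop_cong: "f \<doteq> g \<Longrightarrow> Jop f \<doteq> Jop g"
  using AE_circ_inverse[of "\<lambda>z. f z = g z"] by (auto simp: Jop_def)

text \<open>Frequency k >= 0 of \<open>Jop f\<close> is frequency -k-1 < 0 of \<open>f\<close>,
  exactly what \<open>Qproj\<close> keeps.\<close>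

lemma Proj_Jop: "L2 f \<Longrightarrow> Proj (Jop f) \<doteq> Jop (Qproj f)"
  by (intro Proj_eqI)
    (auto simp: L2_Jop L2_Qproj fcoeff_Jop L2D Qproj_def fcoeff_diff L2_imp_integrable L2_Proj fcoeff_Proj L2_diff)

text \<open>When \<open>Jop f\<close> is already coanalytic, the inner \<open>Qproj\<close> does
  nothing. Agreement with \<open>k\<close> is asked only almost everywhere, which allows two flips
  in a row to be cancelled.\<close>

lemma Hankel_eqI:
  assumes a: "Linf a" and f: "L2 f" and k: "coanalytic k" and eq: "Jop f \<doteq> k"
  shows "Hankel a f \<doteq> Proj (\<lambda>z. a z * k z)"
proof -
  have Lk: "L2 k" using k by (simp add: coanalytic_def)
  have "Qproj (Jop f) \<doteq> Qproj k" by (intro Qproj_cong L2_Jop f Lk eq)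
  then have "Qproj (Jop f) \<doteq> k" using Qproj_coanalytic[OF k] by eventually_elim simp
  then have "(\<lambda>z. a z * Qproj (Jop f) z) \<doteq> (\<lambda>z. a z * k z)" by eventually_elim simp
  then show ?thesis
    unfolding Hankel_def Mul_def o_def
    by (intro Proj_cong L2_mult a L2_Qproj L2_Jop f Lk)
qed

lemma L2_Hankel: "Linf a \<Longrightarrow> L2 f \<Longrightarrow> L2 (Hankel a f)"
  unfolding Hankel_def o_def by (intro L2_Proj L2_Mul L2_Qproj L2_Jop)

text \<open>The operator algebra, separated from boundary behaviour: \<open>u\<close> enters only as
  a bounded function with a factorisation. It is applied with a partial product as \<open>v\<close>,
  the radial limit as \<open>u\<close> and the boundary value of the remaining factors as
  \<open>s\<close>.\<close>

lemma Widom_identity: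
  assumes v: "multiplier v" and v1: "AE z in circ. cmod (v z) = 1" and s: "multiplier s"
    and u: "Linf u" and us: "u \<doteq> (\<lambda>z. v z * s z)" and a: "Linf a" and b: "Linf b" and f: "L2 f"
  shows "(Pmodel v \<circ> TTO u (\<lambda>w. a w * b w) \<circ> Pmodel v) f \<doteq>
    (\<lambda>z. (Pmodel v \<circ> TTO u a \<circ> Pmodel v \<circ> TTO u b \<circ> Pmodel v) f z
      + (Pmodel v \<circ> Hankel a \<circ> Hankel (tilde b) \<circ> Pmodel v) f z
      + (Rop v \<circ> Hankel (tilde a) \<circ> Hankel b \<circ> Rop_adj v) f z)"
proof -
  note Lv = multiplierD(1)[OF v]
  note factor = Pmodel_Pmodel_factor[OF v v1 s u us]
  define g where "g = Pmodel v f"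
  have g: "g \<in> H2" unfolding g_def by (rule Pmodel_H2[OF v f])
  have Lg: "L2 g" using g by (rule H2D)
  have vg: "coanalytic (\<lambda>z. cnj (v z) * g z)" unfolding g_def by (rule coanalytic_cnj_Pmodel[OF v v1 f])
  \<comment> \<open>The model space of v lies in that of u: \<open>cnj u * k\<close> is
    \<open>cnj s\<close> times the coanalytic \<open>cnj v * k\<close>, and \<open>cnj s\<close>
    preserves coanalyticity.\<close>
  have Pu_fixed: "Pmodel u k \<doteq> k" if k: "k \<in> H2" "coanalytic (\<lambda>z. cnj (v z) * k z)" for k
  proof (rule Pmodel_fixed[OF k(1)])
    have Lk: "L2 k" using k(1) by (rule H2D)
    have c: "coanalytic (\<lambda>z. cnj (s z) * (cnj (v z) * k z))" by (rule coanalytic_cnj_mult[OF s k(2)])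
    have L: "L2 (\<lambda>z. cnj (u z) * k z)" by (intro L2_mult Linf_cnj u Lk)
    have "(\<lambda>z. cnj (u z) * k z) \<doteq> (\<lambda>z. cnj (s z) * (cnj (v z) * k z))"
      using us by eventually_elim (simp add: mult_ac)
    then have "fcoeff (\<lambda>z. cnj (u z) * k z) j = fcoeff (\<lambda>z. cnj (s z) * (cnj (v z) * k z)) j" for j
      using c by (intro fcoeff_cong_AE L2D L) (auto simp: coanalytic_def)
    then show "coanalytic (\<lambda>z. cnj (u z) * k z)" using c L by (simp add: coanalytic_def)
  qed
  \<comment> \<open>On the model space of v and under \<open>P_v\<close>, the inner
    \<open>P_u\<close> acts as the identity and the outer one is absorbed, which leaves plain
    multiplication by \<open>c\<close>.\<close>
  have TTO: "Pmodel v (TTO u c k) \<doteq> Pmodel v (\<lambda>z. c z * k z)"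
    if c: "Linf c" and k: "k \<in> H2" "coanalytic (\<lambda>z. cnj (v z) * k z)" for c k
  proof -
    have Lk: "L2 k" using k(1) by (rule H2D)
    have "Mul c (Pmodel u k) \<doteq> (\<lambda>z. c z * k z)"
      using Pu_fixed[OF k] by eventually_elim (simp add: Mul_def)
    then have "Pmodel v (Mul c (Pmodel u k)) \<doteq> Pmodel v (\<lambda>z. c z * k z)"
      by (intro Pmodel_cong Lv L2_Mul L2_mult L2_Pmodel u Lk c)
    moreover have "Pmodel v (Pmodel u (Mul c (Pmodel u k))) \<doteq> Pmodel v (Mul c (Pmodel u k))"
      by (intro factor L2_Mul L2_Pmodel u Lk c)
    ultimately show ?thesis unfolding TTO_def o_def by eventually_elim simp
  qed
  define h where "h = (\<lambda>z. b z * g z)"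
  have Lh: "L2 h" unfolding h_def by (intro L2_mult b Lg)
  define p where "p = Proj (\<lambda>z. cnj (v z) * h z)"
  have Lvh: "L2 (\<lambda>z. cnj (v z) * h z)" by (intro L2_mult Linf_cnj Lv Lh)
  have p: "p \<in> H2" unfolding p_def by (rule Proj_H2[OF Lvh])
  have Lp: "L2 p" using p by (rule H2D)
  have Lap: "L2 (\<lambda>z. a z * p z)" by (intro L2_mult a Lp)
  have Pmv: "Pmodel v h z = Proj h z - v z * p z" for z
    by (simp add: Pmodel_def Mul_def p_def)

  have lhs: "Pmodel v (TTO u (\<lambda>w. a w * b w) g) \<doteq> Pmodel v (\<lambda>z. a z * h z)"
    using TTO[OF Linf_mult[OF a b] g vg] by (simp add: h_def mult.assoc)

  have "Pmodel v (TTO u b g) \<doteq> Pmodel v h"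
    unfolding h_def by (rule TTO[OF b g vg])
  then have t: "(\<lambda>z. a z * Pmodel v (TTO u b g) z) \<doteq> (\<lambda>z. a z * Pmodel v h z)"
    by eventually_elim simp
  have LT: "L2 (TTO u b g)" unfolding TTO_def o_def by (intro L2_Pmodel L2_Mul u b Lg)
  have first: "Pmodel v (TTO u a (Pmodel v (TTO u b g))) \<doteq> Pmodel v (\<lambda>z. a z * Pmodel v h z)"
  proof -
    have "Pmodel v (TTO u a (Pmodel v (TTO u b g))) \<doteq> Pmodel v (\<lambda>z. a z * Pmodel v (TTO u b g) z)"
      by (intro TTO a Pmodel_H2 v coanalytic_cnj_Pmodel v1 LT)
    moreover have "Pmodel v (\<lambda>z. a z * Pmodel v (TTO u b g) z) \<doteq> Pmodel v (\<lambda>z. a z * Pmodel v h z)"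
      by (intro Pmodel_cong[OF _ _ _ t] Lv L2_mult a L2_Pmodel LT Lh)
    ultimately show ?thesis by eventually_elim simp
  qed

  \<comment> \<open>As \<open>g\<close> is analytic, \<open>Jop g\<close> is coanalytic, and the
    inner Hankel operator yields \<open>P J h = J Q h\<close>. The flip in the outer one cancels
    this \<open>J\<close> and leaves the coanalytic \<open>Q h\<close>.\<close>
  have second: "Pmodel v (Hankel a (Hankel (tilde b) g)) \<doteq> Pmodel v (\<lambda>z. a z * Qproj h z)"
  proof -
    have LH: "L2 (Hankel (tilde b) g)" by (intro L2_Hankel Linf_tilde b Lg)
    have "Hankel (tilde b) g \<doteq> Proj (\<lambda>z. tilde b z * Jop g z)"
      by (rule Hankel_eqI[OF Linf_tilde[OF b] Lg coanalytic_Jop[OF g]]) simp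
    moreover have "(\<lambda>z. tilde b z * Jop g z) = Jop h"
      by (simp add: tilde_def Jop_def h_def fun_eq_iff)
    ultimately have "Hankel (tilde b) g \<doteq> Jop (Qproj h)"
      using Proj_Jop[OF Lh] by auto
    then have "Jop (Hankel (tilde b) g) \<doteq> Jop (Jop (Qproj h))" by (rule Jop_cong)
    then have "Jop (Hankel (tilde b) g) \<doteq> Qproj h"
      using Jop_Jop[of "Qproj h"] by eventually_elim simp
    then have "Hankel a (Hankel (tilde b) g) \<doteq> Proj (\<lambda>z. a z * Qproj h z)"
      by (rule Hankel_eqI[OF a LH coanalytic_Qproj[OF Lh]])
    then have "Pmodel v (Hankel a (Hankel (tilde b) g)) \<doteq> Pmodel v (Proj (\<lambda>z. a z * Qproj h z))"
      by (intro Pmodel_cong Lv L2_Hankel a LH L2_Proj L2_mult L2_Qproj Lh)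
    moreover have "Pmodel v (Proj (\<lambda>z. a z * Qproj h z)) \<doteq> Pmodel v (\<lambda>z. a z * Qproj h z)"
      by (intro Pmodel_Proj v L2_mult a L2_Qproj Lh)
    ultimately show ?thesis by eventually_elim simp
  qed

  \<comment> \<open>The flip in \<open>Rop_adj\<close> cancels the one in \<open>Hankel b\<close>,
    and the result is \<open>p\<close>. The remaining two flips conjugate \<open>P\<close> into
    \<open>Q\<close>, which gives \<open>P_v (v Q (a p))\<close>.\<close>
  have third: "Rop v (Hankel (tilde a) (Hankel b (Rop_adj v f))) \<doteq> Pmodel v (\<lambda>z. v z * (a z * p z))"
  proof -
    let ?k = "\<lambda>z. cnj (v z) * g z"
    have Lk: "L2 ?k" using vg by (simp add: coanalytic_def)
    have "Rop_adj v f = Jop ?k" by (simp add: Rop_adj_def Mul_def g_def)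
    moreover have "Hankel b (Jop ?k) \<doteq> Proj (\<lambda>z. b z * ?k z)"
      by (rule Hankel_eqI[OF b L2_Jop[OF Lk] vg Jop_Jop])
    moreover have "(\<lambda>z. b z * ?k z) = (\<lambda>z. cnj (v z) * h z)" by (simp add: h_def mult_ac)
    ultimately have H1: "Hankel b (Rop_adj v f) \<doteq> p" by (simp add: p_def)
    define q where "q = Hankel b (Rop_adj v f)"
    have Lq: "L2 q" unfolding q_def Rop_adj_def o_def
      by (intro L2_Hankel b L2_Jop L2_Mul Linf_cnj Lv L2_Pmodel f)
    have "Jop q \<doteq> Jop p" unfolding q_def by (rule Jop_cong[OF H1])
    then have "Hankel (tilde a) q \<doteq> Proj (\<lambda>z. tilde a z * Jop p z)"
      by (rule Hankel_eqI[OF Linf_tilde[OF a] Lq coanalytic_Jop[OF p]])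
    moreover have "(\<lambda>z. tilde a z * Jop p z) = Jop (\<lambda>z. a z * p z)"
      by (simp add: tilde_def Jop_def fun_eq_iff)
    ultimately have "Hankel (tilde a) q \<doteq> Jop (Qproj (\<lambda>z. a z * p z))"
      using Proj_Jop[OF Lap] by auto
    then have "Jop (Hankel (tilde a) q) \<doteq> Jop (Jop (Qproj (\<lambda>z. a z * p z)))" by (rule Jop_cong)
    then have "Mul v (Jop (Hankel (tilde a) q)) \<doteq> (\<lambda>z. v z * Qproj (\<lambda>z. a z * p z) z)"
      using Jop_Jop[of "Qproj (\<lambda>z. a z * p z)"] by eventually_elim (simp add: Mul_def)
    then have "Pmodel v (Mul v (Jop (Hankel (tilde a) q))) \<doteq> Pmodel v (\<lambda>z. v z * Qproj (\<lambda>z. a z * p z) z)"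
      by (intro Pmodel_cong Lv L2_Mul L2_Jop L2_Hankel Linf_tilde a Lq L2_mult L2_Qproj Lap)
    \<comment> \<open>Adding \<open>v P (a p)\<close> completes \<open>Q (a p)\<close> to
      \<open>a p\<close>; the added term lies in \<open>v H2\<close>, so \<open>P_v\<close> does not
      notice it.\<close>
    moreover have "Pmodel v (\<lambda>z. v z * Qproj (\<lambda>z. a z * p z) z + v z * Proj (\<lambda>z. a z * p z) z) \<doteq>
       (\<lambda>z. Pmodel v (\<lambda>z. v z * Qproj (\<lambda>z. a z * p z) z) z + Pmodel v (\<lambda>z. v z * Proj (\<lambda>z. a z * p z) z) z)"
      by (intro Pmodel_add Lv L2_mult L2_Proj L2_Qproj Lap)
    moreover have "(\<lambda>z. v z * Qproj (\<lambda>z. a z * p z) z + v z * Proj (\<lambda>z. a z * p z) z) = (\<lambda>z. v z * (a z * p z))"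
      by (simp add: Qproj_def algebra_simps)
    moreover have "Pmodel v (\<lambda>z. v z * Proj (\<lambda>z. a z * p z) z) \<doteq> (\<lambda>z. 0)"
      by (rule Pmodel_mult_H2[OF v v1 Proj_H2[OF Lap]])
    ultimately show ?thesis unfolding Rop_def o_def q_def by auto
  qed

  let ?A = "\<lambda>z. a z * Pmodel v h z" and ?B = "\<lambda>z. a z * Qproj h z" and ?C = "\<lambda>z. v z * (a z * p z)"
  have LA: "L2 ?A" and LB: "L2 ?B" and LC: "L2 ?C"
    by (intro L2_mult a L2_Pmodel Lv Lh L2_Qproj Lap)+
  have sum: "(\<lambda>z. ?A z + ?B z + ?C z) = (\<lambda>z. a z * h z)"
    by (simp add: Pmv Qproj_def algebra_simps)
  have "Pmodel v (\<lambda>z. ?A z + ?B z + ?C z) \<doteq> (\<lambda>z. Pmodel v (\<lambda>z. ?A z + ?B z) z + Pmodel v ?C z)"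
    by (intro Pmodel_add Lv L2_add LA LB LC)
  moreover have "Pmodel v (\<lambda>z. ?A z + ?B z) \<doteq> (\<lambda>z. Pmodel v ?A z + Pmodel v ?B z)"
    by (intro Pmodel_add Lv LA LB)
  ultimately have "Pmodel v (\<lambda>z. a z * h z) \<doteq> (\<lambda>z. Pmodel v ?A z + Pmodel v ?B z + Pmodel v ?C z)"
    unfolding sum by eventually_elim simp
  with lhs first second third show ?thesis
    unfolding o_def g_def[symmetric] by eventually_elim simp
qed

section \<open>A maximal inequality for radial limits\<close>

text \<open>For unimodular w this is the usual kernel (1 - |a|^2) / |w - a|^2, written with the
  denominator of the Cauchy kernel.\<close>

definition poisson :: "complex \<Rightarrow> complex \<Rightarrow> real" where
  "poisson a w = (1 - (cmod a)\<^sup>2) / (cmod (1 - a * cnj w))\<^sup>2"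

lemma borel_measurable_poisson [measurable (raw)]:
  assumes [measurable]: "f \<in> borel_measurable M" "g \<in> borel_measurable M"
  shows "(\<lambda>x. poisson (f x) (g x)) \<in> borel_measurable M"
  unfolding poisson_def by measurable

lemma poisson_nonneg: "cmod a < 1 \<Longrightarrow> 0 \<le> poisson a w"
  unfolding poisson_def by (simp add: power_le_one_iff abs_square_le_1)

lemma one_minus_mult_cnj_ne_0:
  assumes "cmod a < 1" "cmod w \<le> 1"
  shows "1 - a * cnj w \<noteq> 0" "1 - cnj a * w \<noteq> 0"
proof -
  have "cmod (a * cnj w) < 1" "cmod (cnj a * w) < 1"
    using assms mult_left_mono[of "cmod w" 1 "cmod a"] by (auto simp: norm_mult)
  then show "1 - a * cnj w \<noteq> 0" "1 - cnj a * w \<noteq> 0" by (metis less_irrefl norm_one right_minus_eq)+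
qed

text \<open>With q = a \<open>cnj w\<close> the kernel is the sum of q^n over n >= 0 plus that of
  its conjugate over n >= 1. The first part is the Cauchy kernel; the second is analytic in w and
  vanishes at 0.\<close>

lemma poisson_eq_Cauchy:
  assumes "cmod a < 1" "cmod w = 1"
  shows "complex_of_real (poisson a w) = 1 / (1 - a * cnj w) + cnj a * w / (1 - cnj a * w)"
proof -
  define q where "q = a * cnj w"
  have nq: "cmod q = cmod a" using assms by (simp add: q_def norm_mult)
  have ne: "1 - q \<noteq> 0" "1 - cnj q \<noteq> 0"
    using one_minus_mult_cnj_ne_0[of a w] assms by (auto simp: q_def)
  have "complex_of_real (poisson a w) = (1 - q * cnj q) / ((1 - q) * (1 - cnj q))"
    unfolding poisson_def q_def[symmetric] nq[symmetric]
    by (simp add: complex_norm_square del: of_real_power)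
  also have "\<dots> = 1 / (1 - q) + cnj q / (1 - cnj q)"
    using ne by (simp add: field_simps)
  finally show ?thesis by (simp add: q_def)
qed

text \<open>Herglotz kernel: it exhibits the Poisson kernel as the real part of an analytic
  function, which is what the semigroup law uses.\<close>

lemma Re_Cayley: "cmod q < 1 \<Longrightarrow> Re ((1 + q) / (1 - q)) = (1 - (cmod q)\<^sup>2) / (cmod (1 - q))\<^sup>2"
proof -
  have "(1 + q) / (1 - q) = ((1 + q) * cnj (1 - q)) / of_real ((cmod (1 - q))\<^sup>2)"
    by (rule complex_div_cnj)
  then have "Re ((1 + q) / (1 - q)) = Re ((1 + q) * cnj (1 - q)) / (cmod (1 - q))\<^sup>2"
    by (simp only: Re_divide_of_real)
  also have "Re ((1 + q) * cnj (1 - q)) = 1 - (cmod q)\<^sup>2"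
    unfolding cmod_power2 by (simp add: algebra_simps power2_eq_square)
  finally show ?thesis .
qed

lemma poisson_le:
  assumes "cmod a < 1" "cmod w = 1" shows "poisson a w \<le> 1 / (1 - cmod a)\<^sup>2"
proof -
  have "1 - cmod a \<le> cmod (1 - a * cnj w)"
    using norm_triangle_ineq2[of 1 "a * cnj w"] assms by (simp add: norm_mult)
  then show ?thesis
    unfolding poisson_def using assms by (intro frac_le power_mono) auto
qed

text \<open>In the splitting \<open>poisson_eq_Cauchy\<close>, the Cauchy part reproduces
  \<open>f a\<close>, and the mean value property sends the analytic part to its value at the
  origin, which is 0.\<close>

lemma Poisson_formula:
  fixes f :: "complex \<Rightarrow> complex"
  assumes [measurable]: "f \<in> borel_measurable borel" and hol: "f holomorphic_on cball 0 1" and a: "cmod a < 1"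
  shows "(\<integral>w. poisson a w * f w \<partial>circ) = f a" and "integrable circ (\<lambda>w. poisson a w * f w)"
proof -
  have "compact (f ` cball 0 1)"
    by (rule compact_continuous_image[OF holomorphic_on_imp_continuous_on[OF hol] compact_cball])
  then obtain C where C: "\<And>z. cmod z \<le> 1 \<Longrightarrow> cmod (f z) \<le> C"
    using compact_imp_bounded bounded_iff by (metis (no_types, lifting) image_eqI mem_cball_0)
  have lower: "1 - cmod a \<le> cmod (1 - a * cnj w)" "1 - cmod a \<le> cmod (1 - cnj a * w)" if "cmod w = 1" for w
    using norm_triangle_ineq2[of 1 "a * cnj w"] norm_triangle_ineq2[of 1 "cnj a * w"] that by (auto simp: norm_mult)
  have i1: "integrable circ (\<lambda>w. f w / (1 - a * cnj w))"
  proof (rule integrable_circ_bounded[where C="C / (1 - cmod a)"])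
    fix w :: complex assume w: "cmod w = 1"
    have "0 \<le> C" using C[of 0] norm_ge_zero[of "f 0"] by (simp del: norm_ge_zero)
    then show "cmod (f w / (1 - a * cnj w)) \<le> C / (1 - cmod a)"
      unfolding norm_divide using lower[OF w] a C[of w] w by (intro frac_le) auto
  qed measurable
  have i2: "integrable circ (\<lambda>w. f w * (cnj a * w / (1 - cnj a * w)))"
  proof (rule integrable_circ_bounded[where C="C * (1 / (1 - cmod a))"])
    fix w :: complex assume w: "cmod w = 1"
    have "cmod (cnj a * w / (1 - cnj a * w)) \<le> 1 / (1 - cmod a)"
      unfolding norm_divide using lower[OF w] a w by (intro frac_le) (auto simp: norm_mult)
    then show "cmod (f w * (cnj a * w / (1 - cnj a * w))) \<le> C * (1 / (1 - cmod a))"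
      unfolding norm_mult[of "f w"] using C[of w] w order_trans[OF norm_ge_zero C[of w]] by (intro mult_mono) auto
  qed measurable
  have ae: "AE w in circ. poisson a w * f w = f w / (1 - a * cnj w) + f w * (cnj a * w / (1 - cnj a * w))"
    using AE_circ_norm_1 by eventually_elim (simp add: poisson_eq_Cauchy a algebra_simps)
  show "integrable circ (\<lambda>w. poisson a w * f w)"
    by (subst integrable_cong_AE[OF _ _ ae]) (use i1 i2 in auto)
  have "(\<integral>w. poisson a w * f w \<partial>circ) = (\<integral>w. f w / (1 - a * cnj w) + f w * (cnj a * w / (1 - cnj a * w)) \<partial>circ)"
    by (rule integral_cong_AE[OF _ _ ae]) measurable
  also have "\<dots> = (\<integral>w. f w / (1 - a * cnj w) \<partial>circ) + (\<integral>w. f w * (cnj a * w / (1 - cnj a * w)) \<partial>circ)"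
    by (rule Bochner_Integration.integral_add[OF i1 i2])
  also have "(\<integral>w. f w / (1 - a * cnj w) \<partial>circ) = f a"
    by (intro circ_Cauchy hol a) measurable
  also have "(\<integral>w. f w * (cnj a * w / (1 - cnj a * w)) \<partial>circ) = f 0 * (cnj a * 0 / (1 - cnj a * 0))"
    using one_minus_mult_cnj_ne_0[OF a] by (intro circ_mean_value holomorphic_intros hol) auto
  finally show "(\<integral>w. poisson a w * f w \<partial>circ) = f a" by simp
qed

lemma nn_integral_poisson:
  assumes "cmod a < 1" shows "(\<integral>\<^sup>+w. ennreal (poisson a w) \<partial>circ) = 1"
proof -
  have "integrable circ (poisson a)"
    using poisson_le poisson_nonneg assms by (intro integrable_circ_bounded[of _ "1 / (1 - cmod a)\<^sup>2"]) auto
  moreover have "complex_of_real (\<integral>w. poisson a w \<partial>circ) = of_real 1"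
    using Poisson_formula(1)[of "\<lambda>_. 1" a] assms by simp
  then have "(\<integral>w. poisson a w \<partial>circ) = 1" by (simp only: of_real_eq_iff)
  ultimately show ?thesis
    using assms by (subst nn_integral_eq_integral) (auto simp: poisson_nonneg)
qed

text \<open>On the circle the second kernel is the real part of \<open>f\<close>, which is
  holomorphic on the closed disc. The Poisson formula therefore evaluates the integral as
  \<open>Re (f (r * \<zeta>))\<close>, and this is the kernel of radius r s.\<close>

lemma poisson_semigroup:
  fixes \<zeta> \<eta> :: complex and r s :: real
  assumes "cmod \<zeta> = 1" "cmod \<eta> = 1" "0 \<le> r" "r < 1" "0 \<le> s" "s < 1"
  shows "(\<integral>\<^sup>+w. ennreal (poisson (r * \<zeta>) w) * ennreal (poisson (s * \<eta>) w) \<partial>circ) = ennreal (poisson (r * s * \<zeta>) \<eta>)"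
proof -
  define f where "f w = (1 + s * cnj \<eta> * w) / (1 - s * cnj \<eta> * w)" for w
  have a: "cmod (r * \<zeta>) < 1" "cmod (s * \<eta>) < 1" using assms by (auto simp: norm_mult)
  have [measurable]: "f \<in> borel_measurable borel" unfolding f_def by measurable
  have ne: "1 - s * cnj \<eta> * w \<noteq> 0" if "cmod w \<le> 1" for w
    using one_minus_mult_cnj_ne_0(2)[OF a(2) that] by simp
  have hol: "f holomorphic_on cball 0 1"
    unfolding f_def using ne by (intro holomorphic_intros) auto
  note P = Poisson_formula[OF _ hol a(1)]
  have Ref: "Re (f w) = poisson (s * \<eta>) w" if "cmod w = 1" for w
  proof -
    have "cmod (s * cnj \<eta> * w) = s" using assms that by (simp add: norm_mult)
    then have "Re (f w) = (1 - s\<^sup>2) / (cmod (1 - s * cnj \<eta> * w))\<^sup>2"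
      using Re_Cayley[of "s * cnj \<eta> * w"] assms by (simp add: f_def)
    moreover have "cmod (1 - s * cnj \<eta> * w) = cmod (1 - s * \<eta> * cnj w)"
      using complex_mod_cnj[of "1 - s * \<eta> * cnj w"] by simp
    ultimately show ?thesis using assms by (simp add: poisson_def norm_mult)
  qed
  have ae: "AE w in circ. Re (poisson (r * \<zeta>) w * f w) = poisson (r * \<zeta>) w * poisson (s * \<eta>) w"
    using AE_circ_norm_1 by eventually_elim (simp add: Ref)
  have int: "integrable circ (\<lambda>w. poisson (r * \<zeta>) w * poisson (s * \<eta>) w)"
    using integrable_Re[OF P(2)] by (subst integrable_cong_AE[OF _ _ ae, symmetric]) auto
  have "(\<integral>w. poisson (r * \<zeta>) w * poisson (s * \<eta>) w \<partial>circ) = (\<integral>w. Re (poisson (r * \<zeta>) w * f w) \<partial>circ)"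
    by (rule integral_cong_AE[symmetric, OF _ _ ae]) measurable
  also have "\<dots> = Re (f (r * \<zeta>))"
    using P by (subst integral_Re) auto
  also have "\<dots> = (1 - (r * s)\<^sup>2) / (cmod (1 - r * s * \<zeta> * cnj \<eta>))\<^sup>2"
  proof -
    have "cmod (s * cnj \<eta> * (r * \<zeta>)) = r * s" using assms by (simp add: norm_mult)
    moreover have "r * s < 1" using assms mult_left_mono[of s 1 r] by simp
    ultimately show ?thesis
      using Re_Cayley[of "s * cnj \<eta> * (r * \<zeta>)"] by (simp add: f_def mult_ac)
  qed
  also have "\<dots> = poisson (r * s * \<zeta>) \<eta>"
    using assms by (simp add: poisson_def norm_mult)
  finally show ?thesis
    using int a by (subst ennreal_mult[symmetric])
      (auto simp: poisson_nonneg nn_integral_eq_integral)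
qed

text \<open>The factor is 2 * 4. Since rs >= r^2, the numerator is at most 1 - r^4 <= 2 (1 - r^2);
  passing from \<open>r * s\<close> to \<open>r\<close> at most doubles the modulus |1 - rsq| in the
  denominator, whose square enters.\<close>

lemma poisson_le_min:
  fixes \<zeta> \<eta> :: complex and r s :: real
  assumes "cmod \<zeta> = 1" "cmod \<eta> = 1" "0 \<le> r" "r \<le> s" "s < 1"
  shows "poisson (r * s * \<zeta>) \<eta> \<le> 8 * poisson (r * \<zeta>) \<eta>"
proof -
  define q where "q = \<zeta> * cnj \<eta>"
  have q: "cmod q = 1" using assms by (simp add: q_def norm_mult)
  have r1: "r < 1" "r * s \<le> r" "0 \<le> r * s" using assms mult_left_mono[of s 1 r] by auto
  have rr: "r * r \<le> r * s" using assms by (intro mult_left_mono) auto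
  have num: "1 - (r * s)\<^sup>2 \<le> 2 * (1 - r\<^sup>2)"
  proof -
    have "(r * r)\<^sup>2 \<le> (r * s)\<^sup>2" using assms rr by (intro power_mono) auto
    moreover have "r\<^sup>2 \<le> 1" using assms r1 by (simp add: power_le_one)
    moreover have "(1 - r\<^sup>2)\<^sup>2 \<ge> 0" by simp
    ultimately show ?thesis by (simp add: power2_eq_square algebra_simps)
  qed
  have "cmod (1 - r * q) \<le> cmod (1 - r * s * q) + cmod ((r * s - r) * q)"
    using norm_triangle_ineq[of "1 - r * s * q" "(r * s - r) * q"] by (simp add: algebra_simps)
  also have "cmod ((r * s - r) * q) = r - r * s"
    using q r1 by (simp only: norm_mult of_real_mult[symmetric] of_real_diff[symmetric] norm_of_real) simp
  \<comment> \<open>The displacement is at most 1 - rs, the least value that |1 - rsq| can take for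
    unimodular q.\<close>
  also have "r - r * s \<le> 1 - r * s" using r1 by simp
  also have "1 - r * s \<le> cmod (1 - r * s * q)"
    using norm_triangle_ineq2[of 1 "r * s * q"] q r1 by (simp add: norm_mult)
  finally have den: "cmod (1 - r * q) \<le> 2 * cmod (1 - r * s * q)" by simp
  have "1 - r \<le> cmod (1 - r * q)"
    using norm_triangle_ineq2[of 1 "r * q"] q assms by (simp add: norm_mult)
  then have pos: "0 < cmod (1 - r * q)"
    using r1 by linarith
  have "(cmod (1 - r * q))\<^sup>2 \<le> 4 * (cmod (1 - r * s * q))\<^sup>2"
    using power_mono[OF den, of 2] by (simp add: power_mult_distrib)
  then have "1 / (4 * (cmod (1 - r * s * q))\<^sup>2) \<le> 1 / (cmod (1 - r * q))\<^sup>2"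
    using pos by (intro frac_le) auto
  then have "(1 - (r * s)\<^sup>2) * (1 / (4 * (cmod (1 - r * s * q))\<^sup>2)) \<le> (2 * (1 - r\<^sup>2)) * (1 / (cmod (1 - r * q))\<^sup>2)"
    using num r1 assms by (intro mult_mono) (auto simp: power_le_one)
  then have "(1 - (r * s)\<^sup>2) / (cmod (1 - r * s * q))\<^sup>2 \<le> 8 * ((1 - r\<^sup>2) / (cmod (1 - r * q))\<^sup>2)"
  proof -
    have "x * (1 / (4 * d)) \<le> 2 * y * (1 / e) \<Longrightarrow> x / d \<le> 8 * (y / e)" for x y d e :: real
    proof -
      assume "x * (1 / (4 * d)) \<le> 2 * y * (1 / e)"
      moreover define X Y where "X = x / d" and "Y = y / e"
      moreover have "x * (1 / (4 * d)) = X / 4" "2 * y * (1 / e) = 2 * Y" by (simp_all add: X_def Y_def)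
      ultimately have "X / 4 \<le> 2 * Y" by metis
      then have "X \<le> 8 * Y" by linarith
      then show ?thesis by (simp only: X_def Y_def)
    qed
    then show ?thesis using \<open>(1 - (r * s)\<^sup>2) * _ \<le> _\<close> by blast
  qed
  then show ?thesis using assms by (simp add: poisson_def norm_mult q_def mult.assoc)
qed

lemma poisson_commute:
  fixes \<zeta> \<eta> :: complex and r :: real
  assumes "cmod \<zeta> = 1" "cmod \<eta> = 1" "0 \<le> r"
  shows "poisson (r * \<zeta>) \<eta> = poisson (r * \<eta>) \<zeta>"
proof -
  have "cmod (1 - r * \<zeta> * cnj \<eta>) = cmod (1 - r * \<eta> * cnj \<zeta>)"
    using complex_mod_cnj[of "1 - r * \<eta> * cnj \<zeta>"] by (simp add: mult_ac)
  then show ?thesis using assms by (simp add: poisson_def norm_mult)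
qed

text \<open>The smaller radius supplies the bound. Keeping both terms gives one estimate, linear in
  the two kernels, that can be integrated even when each radius depends on its own point.\<close>

lemma poisson_product_le:
  fixes \<zeta> \<eta> :: complex and r s :: real
  assumes "cmod \<zeta> = 1" "cmod \<eta> = 1" "0 \<le> r" "r < 1" "0 \<le> s" "s < 1"
  shows "poisson (r * s * \<zeta>) \<eta> \<le> 8 * poisson (r * \<zeta>) \<eta> + 8 * poisson (s * \<eta>) \<zeta>"
proof -
  have nn: "0 \<le> poisson (r * \<zeta>) \<eta>" "0 \<le> poisson (s * \<eta>) \<zeta>"
    using assms by (auto intro!: poisson_nonneg simp: norm_mult)
  show ?thesis
  proof (cases "r \<le> s")
    case True
    then show ?thesis using poisson_le_min[of \<zeta> \<eta> r s] assms nn by simp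
  next
    case False
    then show ?thesis
      using poisson_le_min[of \<zeta> \<eta> s r] poisson_commute[of \<zeta> \<eta> s] assms nn by (simp add: mult.commute)
  qed
qed

section \<open>Linearised maximal operator\<close>

interpretation circ_pair: pair_sigma_finite circ circ
  by standard

lemma nn_integral_circ_swap:
  assumes "(\<lambda>(x, y). f x y) \<in> borel_measurable (circ \<Otimes>\<^sub>M circ)"
  shows "(\<integral>\<^sup>+x. (\<integral>\<^sup>+y. f x y \<partial>circ) \<partial>circ) = (\<integral>\<^sup>+y. (\<integral>\<^sup>+x. f x y \<partial>circ) \<partial>circ)"
  using circ_pair.Fubini'[OF assms] by simp

text \<open>Kolmogorov--Seliverstov: for a measurable choice \<open>\<rho>\<close> of radii the operator
  \<open>T h(\<zeta>) = \<integral> poisson (\<rho>(\<zeta>) \<zeta>) w h(w) dw\<close> is bounded because the kernel of \<open>T T\<^sup>*\<close>, computed by the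
  semigroup law, is dominated by the kernels of \<open>T\<close> and \<open>T\<^sup>*\<close>. This bounds the square norm of
  \<open>T\<^sup>* 1\<^sub>E\<close>.\<close>

lemma nn_integral_linearized_poisson_square:
  fixes \<rho> :: "complex \<Rightarrow> real"
  assumes [measurable]: "\<rho> \<in> borel_measurable borel" "E \<in> sets borel"
    and \<rho>: "\<And>\<zeta>. 0 \<le> \<rho> \<zeta>" "\<And>\<zeta>. \<rho> \<zeta> < 1"
  shows "(\<integral>\<^sup>+w. (\<integral>\<^sup>+\<zeta>. indicator E \<zeta> * ennreal (poisson (complex_of_real (\<rho> \<zeta>) * \<zeta>) w) \<partial>circ)\<^sup>2 \<partial>circ) \<le> 16 * emeasure circ E"
proof -
  let ?k = "\<lambda>(\<zeta>::complex) w. indicator E \<zeta> * ennreal (poisson (complex_of_real (\<rho> \<zeta>) * \<zeta>) w)"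
  \<comment> \<open>The Poisson kernel has total mass 1, so integrating over w first leaves the
    indicator of \<open>E\<close>.\<close>
  have sum1: "(\<integral>\<^sup>+\<zeta>. (\<integral>\<^sup>+w. ?k \<zeta> w \<partial>circ) \<partial>circ) \<le> emeasure circ E"
  proof -
    have "AE \<zeta> in circ. (\<integral>\<^sup>+w. ?k \<zeta> w \<partial>circ) \<le> indicator E \<zeta>"
      using AE_circ_norm_1
    proof eventually_elim
      fix \<zeta> assume "cmod \<zeta> = 1"
      then have "cmod (\<rho> \<zeta> * \<zeta>) < 1" using \<rho> by (simp add: norm_mult)
      then show "(\<integral>\<^sup>+w. ?k \<zeta> w \<partial>circ) \<le> indicator E \<zeta>"
        by (subst nn_integral_cmult) (auto simp: nn_integral_poisson)
    qed
    then have "(\<integral>\<^sup>+\<zeta>. (\<integral>\<^sup>+w. ?k \<zeta> w \<partial>circ) \<partial>circ) \<le> (\<integral>\<^sup>+\<zeta>. indicator E \<zeta> \<partial>circ)"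
      by (rule nn_integral_mono_AE)
    then show ?thesis by simp
  qed
  \<comment> \<open>The square is written as a double integral over two points of \<open>E\<close>.
    Once w is integrated first, the semigroup law applies to the product of kernels.\<close>
  have "(\<integral>\<^sup>+w. (\<integral>\<^sup>+\<zeta>. ?k \<zeta> w \<partial>circ)\<^sup>2 \<partial>circ) = (\<integral>\<^sup>+w. (\<integral>\<^sup>+\<zeta>. (\<integral>\<^sup>+\<eta>. ?k \<zeta> w * ?k \<eta> w \<partial>circ) \<partial>circ) \<partial>circ)"
    by (simp add: power2_eq_square nn_integral_cmult nn_integral_multc)
  also have "\<dots> = (\<integral>\<^sup>+\<zeta>. (\<integral>\<^sup>+w. (\<integral>\<^sup>+\<eta>. ?k \<zeta> w * ?k \<eta> w \<partial>circ) \<partial>circ) \<partial>circ)"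
    by (rule nn_integral_circ_swap) measurable
  also have "\<dots> = (\<integral>\<^sup>+\<zeta>. (\<integral>\<^sup>+\<eta>. (\<integral>\<^sup>+w. ?k \<zeta> w * ?k \<eta> w \<partial>circ) \<partial>circ) \<partial>circ)"
    by (intro nn_integral_cong nn_integral_circ_swap) measurable
  also have "\<dots> \<le> (\<integral>\<^sup>+\<zeta>. (\<integral>\<^sup>+\<eta>. 8 * ?k \<zeta> \<eta> + 8 * ?k \<eta> \<zeta> \<partial>circ) \<partial>circ)"
  proof (rule nn_integral_mono_AE)
    show "AE \<zeta> in circ. (\<integral>\<^sup>+\<eta>. (\<integral>\<^sup>+w. ?k \<zeta> w * ?k \<eta> w \<partial>circ) \<partial>circ) \<le> (\<integral>\<^sup>+\<eta>. 8 * ?k \<zeta> \<eta> + 8 * ?k \<eta> \<zeta> \<partial>circ)"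
      using AE_circ_norm_1
    proof eventually_elim
      fix \<zeta> assume \<zeta>: "cmod \<zeta> = 1"
      have "AE \<eta> in circ. (\<integral>\<^sup>+w. ?k \<zeta> w * ?k \<eta> w \<partial>circ) \<le> 8 * ?k \<zeta> \<eta> + 8 * ?k \<eta> \<zeta>"
        using AE_circ_norm_1
      proof eventually_elim
        fix \<eta> assume \<eta>: "cmod \<eta> = 1"
        have nn: "0 \<le> poisson (\<rho> \<zeta> * \<zeta>) \<eta>" "0 \<le> poisson (\<rho> \<eta> * \<eta>) \<zeta>"
          using \<zeta> \<eta> \<rho> by (auto intro!: poisson_nonneg simp: norm_mult)
        have "(\<integral>\<^sup>+w. ?k \<zeta> w * ?k \<eta> w \<partial>circ)
            = (\<integral>\<^sup>+w. indicator E \<zeta> * indicator E \<eta> * (ennreal (poisson (\<rho> \<zeta> * \<zeta>) w) * ennreal (poisson (\<rho> \<eta> * \<eta>) w)) \<partial>circ)"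
          by (simp add: mult_ac)
        also have "\<dots> = indicator E \<zeta> * indicator E \<eta> * ennreal (poisson (\<rho> \<zeta> * \<rho> \<eta> * \<zeta>) \<eta>)"
          using \<zeta> \<eta> \<rho> by (subst nn_integral_cmult) (auto simp: poisson_semigroup)
        also have "\<dots> \<le> indicator E \<zeta> * indicator E \<eta> * ennreal (8 * poisson (\<rho> \<zeta> * \<zeta>) \<eta> + 8 * poisson (\<rho> \<eta> * \<eta>) \<zeta>)"
          using \<zeta> \<eta> \<rho> by (intro mult_left_mono ennreal_leI poisson_product_le) auto
        also have "\<dots> \<le> 8 * ?k \<zeta> \<eta> + 8 * ?k \<eta> \<zeta>"
          using nn by (auto simp: indicator_def ennreal_mult)
        finally show "(\<integral>\<^sup>+w. ?k \<zeta> w * ?k \<eta> w \<partial>circ) \<le> 8 * ?k \<zeta> \<eta> + 8 * ?k \<eta> \<zeta>" .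
      qed
      then show "(\<integral>\<^sup>+\<eta>. (\<integral>\<^sup>+w. ?k \<zeta> w * ?k \<eta> w \<partial>circ) \<partial>circ) \<le> (\<integral>\<^sup>+\<eta>. 8 * ?k \<zeta> \<eta> + 8 * ?k \<eta> \<zeta> \<partial>circ)"
        by (rule nn_integral_mono_AE)
    qed
  qed
  also have "\<dots> = 8 * (\<integral>\<^sup>+\<zeta>. (\<integral>\<^sup>+\<eta>. ?k \<zeta> \<eta> \<partial>circ) \<partial>circ) + 8 * (\<integral>\<^sup>+\<zeta>. (\<integral>\<^sup>+\<eta>. ?k \<eta> \<zeta> \<partial>circ) \<partial>circ)"
    by (subst nn_integral_add, measurable)+ (simp add: nn_integral_cmult nn_integral_add)
  \<comment> \<open>The transposed kernel has the same double integral by Tonelli, hence 8 + 8 =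
    16.\<close>
  also have "(\<integral>\<^sup>+\<zeta>. (\<integral>\<^sup>+\<eta>. ?k \<eta> \<zeta> \<partial>circ) \<partial>circ) = (\<integral>\<^sup>+\<zeta>. (\<integral>\<^sup>+\<eta>. ?k \<zeta> \<eta> \<partial>circ) \<partial>circ)"
    by (rule nn_integral_circ_swap) measurable
  also have "8 * (\<integral>\<^sup>+\<zeta>. (\<integral>\<^sup>+\<eta>. ?k \<zeta> \<eta> \<partial>circ) \<partial>circ) + 8 * (\<integral>\<^sup>+\<zeta>. (\<integral>\<^sup>+\<eta>. ?k \<zeta> \<eta> \<partial>circ) \<partial>circ)
      = 16 * (\<integral>\<^sup>+\<zeta>. (\<integral>\<^sup>+\<eta>. ?k \<zeta> \<eta> \<partial>circ) \<partial>circ)"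
    by (simp flip: distrib_right)
  also have "\<dots> \<le> 16 * emeasure circ E" by (intro mult_left_mono sum1) auto
  finally show ?thesis .
qed

text \<open>Duality: with m the measure of the exceptional set, \<epsilon> m is at most the pairing
  of the adjoint of T at the indicator with |f|. Cauchy-Schwarz and the preceding bound give
  (\<epsilon> m)^2 <= 16 m \<open>nsq f\<close>, and one factor m cancels. Countably many radii keep
  the set Borel and permit a measurable choice of radius.\<close>

lemma radial_maximal_inequality:
  fixes r :: "nat \<Rightarrow> real" and f :: "complex \<Rightarrow> complex"
  assumes [measurable]: "f \<in> borel_measurable borel" and hol: "f holomorphic_on cball 0 1"
    and r: "\<And>i. 0 \<le> r i" "\<And>i. r i < 1" and \<epsilon>: "\<epsilon> > 0"
  shows "\<epsilon>\<^sup>2 * measure circ {\<zeta>. \<exists>i. cmod (f (r i * \<zeta>)) > \<epsilon>} \<le> 16 * nsq f"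
proof -
  define E :: "complex set" where "E = {\<zeta>. \<exists>i. cmod (f (r i * \<zeta>)) > \<epsilon>}"
  have [measurable]: "E \<in> sets borel" unfolding E_def by measurable
  \<comment> \<open>The first radius at which the bound is exceeded. Outside \<open>E\<close> the
    \<open>LEAST\<close> is unspecified, but the result is still some \<open>r i\<close>, so 0 <=
    \<rho> < 1 holds everywhere.\<close>
  define \<rho> where "\<rho> \<zeta> = r (LEAST i. cmod (f (r i * \<zeta>)) > \<epsilon>)" for \<zeta> :: complex
  have [measurable]: "\<rho> \<in> borel_measurable borel" unfolding \<rho>_def by measurable
  have \<rho>: "0 \<le> \<rho> \<zeta>" "\<rho> \<zeta> < 1" for \<zeta> :: complex by (auto simp: \<rho>_def r)
  have E: "cmod (f (\<rho> \<zeta> * \<zeta>)) > \<epsilon>" if "\<zeta> \<in> E" for \<zeta> :: complex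
    using that unfolding E_def \<rho>_def by (auto intro: LeastI)
  have "compact (f ` cball 0 1)"
    by (rule compact_continuous_image[OF holomorphic_on_imp_continuous_on[OF hol] compact_cball])
  then obtain C where C: "\<And>z. cmod z \<le> 1 \<Longrightarrow> cmod (f z) \<le> C"
    using compact_imp_bounded bounded_iff by (metis (no_types, lifting) image_eqI mem_cball_0)
  have L2f: "L2 f" by (rule L2_bounded[of _ C]) (auto intro: C)
  let ?k = "\<lambda>(\<zeta>::complex) w. indicator E \<zeta> * ennreal (poisson (complex_of_real (\<rho> \<zeta>) * \<zeta>) w)"
  have le: "AE \<zeta> in circ. ennreal \<epsilon> * indicator E \<zeta> \<le> (\<integral>\<^sup>+w. ?k \<zeta> w * ennreal (cmod (f w)) \<partial>circ)"
    using AE_circ_norm_1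
  proof eventually_elim
    fix \<zeta> assume \<zeta>: "cmod \<zeta> = 1"
    show "ennreal \<epsilon> * indicator E \<zeta> \<le> (\<integral>\<^sup>+w. ?k \<zeta> w * ennreal (cmod (f w)) \<partial>circ)"
    proof (cases "\<zeta> \<in> E")
      case True
      have a: "cmod (\<rho> \<zeta> * \<zeta>) < 1" using \<zeta> \<rho> by (simp add: norm_mult)
      note P = Poisson_formula[OF _ hol a]
      have "ennreal \<epsilon> \<le> ennreal (cmod (\<integral>w. poisson (\<rho> \<zeta> * \<zeta>) w * f w \<partial>circ))"
        using E[OF True] P(1) by (intro ennreal_leI) simp
      also have "\<dots> \<le> (\<integral>\<^sup>+w. ennreal (cmod (poisson (\<rho> \<zeta> * \<zeta>) w * f w)) \<partial>circ)"
        by (rule integral_norm_bound_ennreal[OF P(2)]) measurable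
      also have "\<dots> = (\<integral>\<^sup>+w. ?k \<zeta> w * ennreal (cmod (f w)) \<partial>circ)"
        using True poisson_nonneg[OF a] by (intro nn_integral_cong) (simp add: norm_mult ennreal_mult)
      finally show ?thesis using True by simp
    qed simp
  qed
  have "ennreal \<epsilon> * emeasure circ E = (\<integral>\<^sup>+\<zeta>. ennreal \<epsilon> * indicator E \<zeta> \<partial>circ)"
    by (simp add: nn_integral_cmult_indicator)
  also have "\<dots> \<le> (\<integral>\<^sup>+\<zeta>. (\<integral>\<^sup>+w. ?k \<zeta> w * ennreal (cmod (f w)) \<partial>circ) \<partial>circ)"
    by (rule nn_integral_mono_AE[OF le])
  also have "\<dots> = (\<integral>\<^sup>+w. (\<integral>\<^sup>+\<zeta>. ?k \<zeta> w * ennreal (cmod (f w)) \<partial>circ) \<partial>circ)"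
    by (rule nn_integral_circ_swap) measurable
  also have "\<dots> = (\<integral>\<^sup>+w. (\<integral>\<^sup>+\<zeta>. ?k \<zeta> w \<partial>circ) * ennreal (cmod (f w)) \<partial>circ)"
    by (simp add: nn_integral_multc)
  finally have "(ennreal \<epsilon> * emeasure circ E)\<^sup>2 \<le> (\<integral>\<^sup>+w. (\<integral>\<^sup>+\<zeta>. ?k \<zeta> w \<partial>circ) * ennreal (cmod (f w)) \<partial>circ)\<^sup>2"
    by (rule power_mono) simp
  also have "\<dots> \<le> (\<integral>\<^sup>+w. (\<integral>\<^sup>+\<zeta>. ?k \<zeta> w \<partial>circ)\<^sup>2 \<partial>circ) * (\<integral>\<^sup>+w. (ennreal (cmod (f w)))\<^sup>2 \<partial>circ)"
    by (rule Cauchy_Schwarz_nn_integral) measurable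
  also have "(\<integral>\<^sup>+w. (ennreal (cmod (f w)))\<^sup>2 \<partial>circ) = ennreal (nsq f)"
    unfolding nsq_def using L2_integrable[OF L2f]
    by (subst nn_integral_eq_integral[symmetric]) (auto simp: ennreal_power)
  also have "(\<integral>\<^sup>+w. (\<integral>\<^sup>+\<zeta>. ?k \<zeta> w \<partial>circ)\<^sup>2 \<partial>circ) * ennreal (nsq f) \<le> 16 * emeasure circ E * ennreal (nsq f)"
    by (intro mult_right_mono nn_integral_linearized_poisson_square \<rho>) auto
  also have "(ennreal \<epsilon> * emeasure circ E)\<^sup>2 = ennreal ((\<epsilon> * measure circ E)\<^sup>2)"
    using \<epsilon> by (simp add: circ.emeasure_eq_measure ennreal_power flip: ennreal_mult)
  also have "16 * emeasure circ E * ennreal (nsq f) = ennreal (16 * measure circ E * nsq f)"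
    by (simp add: circ.emeasure_eq_measure nsq_nonneg ennreal_mult)
  finally have "ennreal ((\<epsilon> * measure circ E)\<^sup>2) \<le> ennreal (16 * measure circ E * nsq f)" .
  then have "(\<epsilon> * measure circ E)\<^sup>2 \<le> 16 * measure circ E * nsq f"
    by (simp add: nsq_nonneg)
  then have "measure circ E * (\<epsilon>\<^sup>2 * measure circ E) \<le> measure circ E * (16 * nsq f)"
    by (simp add: power2_eq_square mult_ac)
  then have "\<epsilon>\<^sup>2 * measure circ E \<le> 16 * nsq f"
    using measure_nonneg[of circ E] nsq_nonneg[of f] by (cases "measure circ E = 0") auto
  then show ?thesis by (simp add: E_def)
qed

section \<open>Multipliers of the Hardy space and radial limits\<close>

lemma multiplierI:
  assumes "Linf v" "\<And>h k. h \<in> H2 \<Longrightarrow> k < 0 \<Longrightarrow> fcoeff (\<lambda>z. v z * h z) k = 0"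
  shows "multiplier v"
  using assms unfolding multiplier_def H2_def by (auto intro: L2_mult)

lemma multiplier_ident: "multiplier (\<lambda>z. z)"
proof -
  have L: "Linf (\<lambda>z. z)" by (rule Linf_bounded[of _ 1]) auto
  have "fcoeff (\<lambda>z. z * h z) k = 0" if "h \<in> H2" "k < 0" for h k
    using fcoeff_shift[of h 1 k] that H2D[of h] by (simp add: L2D)
  with L show ?thesis by (rule multiplierI)
qed

lemma multiplier_const: "multiplier (\<lambda>z. c)"
proof -
  have "Linf (\<lambda>z. c)" by (rule Linf_bounded[of _ "cmod c"]) auto
  then show ?thesis by (auto simp: multiplier_def H2_def L2_cmult fcoeff_cmult)
qed

lemma multiplier_diff: "multiplier v \<Longrightarrow> multiplier w \<Longrightarrow> multiplier (\<lambda>z. v z - w z)"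
proof -
  assume v: "multiplier v" and w: "multiplier w"
  have [measurable]: "v \<in> borel_measurable borel" "w \<in> borel_measurable borel"
    using v w by (auto simp: multiplier_def LinfD)
  obtain C D where C: "AE z in circ. cmod (v z) \<le> C" and D: "AE z in circ. cmod (w z) \<le> D"
    using v w by (auto simp: multiplier_def Linf_def)
  have "AE z in circ. cmod (v z - w z) \<le> C + D"
    using C D by eventually_elim (rule order_trans[OF norm_triangle_ineq4], simp)
  then have "Linf (\<lambda>z. v z - w z)" by (auto simp: Linf_def)
  moreover have "(\<lambda>z. (v z - w z) * h z) \<in> H2" if "h \<in> H2" for h
    using H2_diff[OF multiplierD(2)[OF v that] multiplierD(2)[OF w that]] by (simp add: left_diff_distrib)
  ultimately show ?thesis by (auto simp: multiplier_def)
qed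

text \<open>For g = h / (1 - \<open>cnj c\<close> z) the coefficients at negative j satisfy g_j =
  \<open>cnj c\<close> g_(j-1). Iterating towards minus infinity gains powers of |c| against
  coefficients bounded by Cauchy-Schwarz, so all negative ones vanish.\<close>

lemma multiplier_geometric:
  assumes c: "cmod c < 1"
  shows "multiplier (\<lambda>z. 1 / (1 - cnj c * z))"
proof -
  have lower: "1 - cmod c \<le> cmod (1 - cnj c * z)" if "cmod z = 1" for z
    using norm_triangle_ineq2[of 1 "cnj c * z"] that by (simp add: norm_mult)
  have L: "Linf (\<lambda>z. 1 / (1 - cnj c * z))"
    using lower c by (intro Linf_bounded[of _ "1 / (1 - cmod c)"]) (auto simp: norm_divide intro!: frac_le)
  have "fcoeff (\<lambda>z. 1 / (1 - cnj c * z) * h z) k = 0" if h: "h \<in> H2" and k: "k < 0" for h k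
  proof -
    define g where "g z = 1 / (1 - cnj c * z) * h z" for z
    have Lh: "L2 h" using h by (rule H2D)
    have Lg: "L2 g" unfolding g_def by (intro L2_mult L Lh)
    have Lzg: "L2 (\<lambda>z. cnj c * (z powi 1 * g z))"
      using L2_mult[OF multiplierD(1)[OF multiplier_ident] Lg] by (simp add: L2_cmult)
    have "AE z in circ. g z - cnj c * (z powi 1 * g z) = h z"
      using AE_circ_norm_1
    proof eventually_elim
      fix z :: complex assume "cmod z = 1"
      then have "1 - cnj c * z \<noteq> 0" using one_minus_mult_cnj_ne_0(2)[OF c, of z] by simp
      moreover have "g z - cnj c * (z powi 1 * g z) = (1 - cnj c * z) * g z" by (simp add: algebra_simps)
      ultimately show "g z - cnj c * (z powi 1 * g z) = h z" by (simp add: g_def)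
    qed
    then have "fcoeff (\<lambda>z. g z - cnj c * (z powi 1 * g z)) j = fcoeff h j" for j
      by (intro fcoeff_cong_AE L2D L2_diff Lg Lh Lzg)
    then have "fcoeff g j - cnj c * fcoeff (\<lambda>z. z powi 1 * g z) j = fcoeff h j" for j
      using Lg Lzg by (simp only: fcoeff_diff L2_imp_integrable fcoeff_cmult)
    then have "fcoeff g j - cnj c * fcoeff g (j - 1) = fcoeff h j" for j
      by (simp only: fcoeff_shift[OF L2D[OF Lg]])
    then have rec: "fcoeff g j = cnj c * fcoeff g (j - 1)" if "j < 0" for j
      using H2D(2)[OF h that] by (metis eq_iff_diff_eq_0)
    have iter: "fcoeff g k = cnj c ^ m * fcoeff g (k - int m)" for m
    proof (induction m)
      case (Suc m)
      then show ?case using rec[of "k - int m"] k by (simp add: algebra_simps)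
    qed simp
    have bound: "(cmod (fcoeff g j))\<^sup>2 \<le> nsq g * nsq (\<lambda>z. z powi 0)" for j
    proof -
      have "nsq (\<lambda>z. z powi j) = nsq (\<lambda>z. z powi 0)"
        unfolding nsq_def
      proof (rule integral_cong_AE)
        show "AE z in circ. (cmod (z powi j))\<^sup>2 = (cmod (z powi 0))\<^sup>2"
          using AE_circ_norm_1 by eventually_elim (simp add: norm_power_int)
      qed measurable
      then show ?thesis
        using L2inner_Cauchy_Schwarz[OF Lg L2_powi, of j] by (simp add: fcoeff_eq_L2inner)
    qed
    have "(\<lambda>m. (cmod c ^ m)\<^sup>2 * (nsq g * nsq (\<lambda>z. z powi 0))) \<longlonglongrightarrow> 0\<^sup>2 * (nsq g * nsq (\<lambda>z. z powi 0))"
      using c by (intro tendsto_intros LIMSEQ_power_zero) auto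
    moreover have "(cmod (fcoeff g k))\<^sup>2 \<le> (cmod c ^ m)\<^sup>2 * (nsq g * nsq (\<lambda>z. z powi 0))" for m
      by (subst iter[of m]) (auto simp: norm_mult norm_power power_mult_distrib intro!: mult_left_mono bound[simplified])
    ultimately have "(cmod (fcoeff g k))\<^sup>2 \<le> 0"
      by (intro LIMSEQ_le_const[where x="0::real"]) auto
    then show ?thesis by (simp add: g_def[abs_def])
  qed
  with L show ?thesis by (rule multiplierI)
qed

section \<open>Blaschke factors\<close>

lemma borel_measurable_bfactor [measurable (raw)]:
  assumes [measurable]: "f \<in> borel_measurable M"
  shows "(\<lambda>x. bfactor c (f x)) \<in> borel_measurable M"
  unfolding bfactor_def by (cases "c = 0") (simp_all)

lemma multiplier_bfactor:
  assumes c: "cmod c < 1" shows "multiplier (bfactor c)"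
proof (cases "c = 0")
  case True
  then have "bfactor c = (\<lambda>z. z)" by (simp add: bfactor_def fun_eq_iff)
  then show ?thesis by (simp add: multiplier_ident)
next
  case False
  then have eq: "bfactor c = (\<lambda>z. (c - z) * (1 / (1 - cnj c * z)) * (complex_of_real (cmod c) / c))"
    by (simp add: bfactor_def fun_eq_iff)
  show ?thesis
    unfolding eq
    by (intro multiplier_mult multiplier_diff multiplier_const multiplier_ident multiplier_geometric c)
qed

lemma cmod_bfactor_le_1:
  assumes c: "cmod c < 1" and z: "cmod z \<le> 1" shows "cmod (bfactor c z) \<le> 1"
proof (cases "c = 0")
  case False
  have ne: "1 - cnj c * z \<noteq> 0" using one_minus_mult_cnj_ne_0[OF c z] by simp
  have "(cmod (1 - cnj c * z))\<^sup>2 - (cmod (c - z))\<^sup>2 = (1 - (cmod c)\<^sup>2) * (1 - (cmod z)\<^sup>2)"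
    unfolding cmod_power2 by (simp add: power2_eq_square algebra_simps)
  moreover have "\<dots> \<ge> 0" using c z by (intro mult_nonneg_nonneg) (auto simp: abs_square_le_1)
  ultimately have "(cmod (c - z))\<^sup>2 \<le> (cmod (1 - cnj c * z))\<^sup>2" by linarith
  then have "cmod (c - z) \<le> cmod (1 - cnj c * z)" by (rule power2_le_imp_le) simp
  then show ?thesis using False ne by (simp add: bfactor_def norm_mult norm_divide)
qed (use z in \<open>simp add: bfactor_def\<close>)

lemma cmod_bfactor_eq_1:
  assumes c: "cmod c < 1" and z: "cmod z = 1" shows "cmod (bfactor c z) = 1"
proof (cases "c = 0")
  case False
  have ne: "1 - cnj c * z \<noteq> 0" using one_minus_mult_cnj_ne_0[OF c, of z] z by simp
  have "(cmod (1 - cnj c * z))\<^sup>2 - (cmod (c - z))\<^sup>2 = (1 - (cmod c)\<^sup>2) * (1 - (cmod z)\<^sup>2)"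
    unfolding cmod_power2 by (simp add: power2_eq_square algebra_simps)
  then have "(cmod (1 - cnj c * z))\<^sup>2 = (cmod (c - z))\<^sup>2" using z by simp
  then have "cmod (c - z) = cmod (1 - cnj c * z)"
    by simp
  then show ?thesis using False ne by (simp add: bfactor_def norm_mult norm_divide)
qed (use z in \<open>simp add: bfactor_def\<close>)

lemma bfactor_0: "bfactor c 0 = of_real (cmod c)"
  by (simp add: bfactor_def)

lemma isCont_bfactor: "cnj c * z \<noteq> 1 \<Longrightarrow> isCont (bfactor c) z"
  unfolding bfactor_def[abs_def] by (cases "c = 0") (auto intro!: continuous_intros)

lemma holomorphic_bfactor: "cmod c < 1 \<Longrightarrow> bfactor c holomorphic_on ball 0 1"
  unfolding bfactor_def[abs_def] using one_minus_mult_cnj_ne_0(2)[of c]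
  by (cases "c = 0") (auto intro!: holomorphic_intros)

text \<open>The rotation |c|/c in the factor makes its value at 0 positive, and because of it the
  numerator of the difference contains 1 - |c|, the summable quantity. The bound is stated on the
  whole plane off the pole, since the product is also studied outside the disc.\<close>

lemma bfactor_minus_1:
  assumes "cnj c * z \<noteq> 1" and c: "cmod c < 1"
  shows "cmod (bfactor c z - 1) \<le> (1 - cmod c) * (1 + cmod z) / cmod (1 - cnj c * z)"
proof (cases "c = 0")
  case True
  then show ?thesis using norm_triangle_ineq4[of z 1] by (simp add: bfactor_def)
next
  case False
  have ne: "1 - cnj c * z \<noteq> 0" using assms by simp
  have cc: "c * cnj c = of_real (cmod c) * of_real (cmod c)"
    by (metis complex_norm_square power2_eq_square of_real_mult)
  have "bfactor c z - 1 = ((c - z) * of_real (cmod c) - c * (1 - cnj c * z)) / (c * (1 - cnj c * z))"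
    using False ne by (simp add: bfactor_def field_simps)
  also have "(c - z) * of_real (cmod c) - c * (1 - cnj c * z) = - ((1 - of_real (cmod c)) * (c + of_real (cmod c) * z))"
    using cc by (simp add: algebra_simps)
  finally have "cmod (bfactor c z - 1) = cmod (1 - of_real (cmod c)) * cmod (c + of_real (cmod c) * z) / (cmod c * cmod (1 - cnj c * z))"
    by (simp add: norm_mult norm_divide)
  also have "cmod (1 - of_real (cmod c)) = 1 - cmod c"
    using c norm_of_real[of "1 - cmod c", where 'a=complex] by (simp del: norm_of_real)
  also have "(1 - cmod c) * cmod (c + of_real (cmod c) * z) / (cmod c * cmod (1 - cnj c * z))
     \<le> (1 - cmod c) * (cmod c * (1 + cmod z)) / (cmod c * cmod (1 - cnj c * z))"
    using c norm_triangle_ineq[of c "of_real (cmod c) * z"]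
    by (intro divide_right_mono mult_left_mono) (auto simp: norm_mult algebra_simps)
  also have "\<dots> = (1 - cmod c) * (1 + cmod z) / cmod (1 - cnj c * z)"
    using False by simp
  finally show ?thesis .
qed

lemma multiplier_prod: "(\<And>k. k \<in> A \<Longrightarrow> multiplier (v k)) \<Longrightarrow> multiplier (\<lambda>z. \<Prod>k\<in>A. v k z)"
  by (induction A rule: infinite_finite_induct) (auto intro: multiplier_const multiplier_mult)

text \<open>Each negative coefficient of \<open>s h\<close> is a limit of vanishing ones, by
  dominated convergence with majorant \<open>C * cmod (h z)\<close>.\<close>

lemma multiplier_limit:
  assumes w: "\<And>j::nat. multiplier (w j)" and bd: "\<And>j z. cmod z = 1 \<Longrightarrow> cmod (w j z) \<le> C"
    and [measurable]: "s \<in> borel_measurable borel" and lim: "AE z in circ. (\<lambda>j. w j z) \<longlonglongrightarrow> s z"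
  shows "multiplier s"
proof -
  have [measurable]: "w j \<in> borel_measurable borel" for j using w by (auto simp: multiplier_def LinfD)
  have "AE z in circ. cmod (s z) \<le> C"
    using lim AE_circ_norm_1
  proof eventually_elim
    fix z assume "(\<lambda>j. w j z) \<longlonglongrightarrow> s z" "cmod z = 1"
    then show "cmod (s z) \<le> C"
      using bd by (intro LIMSEQ_le_const2[OF tendsto_norm]) auto
  qed
  then have L: "Linf s" by (auto simp: Linf_def)
  have "fcoeff (\<lambda>z. s z * h z) k = 0" if h: "h \<in> H2" and k: "k < 0" for h k
  proof -
    have Lh: "L2 h" using h by (rule H2D)
    have [measurable]: "h \<in> borel_measurable borel" using Lh by (rule L2D)
    have "(\<lambda>j. fcoeff (\<lambda>z. w j z * h z) k) \<longlonglongrightarrow> fcoeff (\<lambda>z. s z * h z) k"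
      unfolding fcoeff_def
    proof (rule integral_dominated_convergence[where w="\<lambda>z. C * cmod (h z)"])
      show "integrable circ (\<lambda>z. C * cmod (h z))" using L2_imp_integrable[OF Lh] by simp
      show "AE z in circ. (\<lambda>j. w j z * h z * cnj z powi k) \<longlonglongrightarrow> s z * h z * cnj z powi k"
        using lim by eventually_elim (intro tendsto_intros)
      show "AE z in circ. norm (w j z * h z * cnj z powi k) \<le> C * cmod (h z)" for j
        using AE_circ_norm_1 by eventually_elim (auto simp: norm_mult norm_power_int intro!: mult_right_mono bd)
    qed measurable
    moreover have "fcoeff (\<lambda>z. w j z * h z) k = 0" for j
      using multiplierD(2)[OF w h] k by (rule H2D(2))
    ultimately show ?thesis by (simp add: LIMSEQ_const_iff)
  qed
  with L show ?thesis by (rule multiplierI)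
qed

text \<open>Wherever the limit along the radius exists, it is the limit \<open>x\<close> along one fixed sequence, and by
  continuity its existence is tested on rational radii.\<close>

lemma borel_measurable_radial_limit:
  fixes D :: "complex \<Rightarrow> complex"
  assumes [measurable]: "D \<in> borel_measurable borel"
    and cont: "\<And>\<zeta>. eventually (\<lambda>r. isCont D (of_real r * \<zeta>)) (at_left (1::real))"
  shows "(\<lambda>\<zeta>. Lim (at_left (1::real)) (\<lambda>r. D (of_real r * \<zeta>))) \<in> borel_measurable borel"
proof -
  define p where "p n = 1 - 1 / (real n + 2)" for n :: nat
  have plim: "filterlim p (at_left 1) sequentially"
    unfolding p_def by real_asymp
  define x where "x \<zeta> = lim (\<lambda>n. D (of_real (p n) * \<zeta>))" for \<zeta>
  have [measurable]: "x \<in> borel_measurable borel" unfolding x_def by measurable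
  \<comment> \<open>Convergence to \<open>x\<close> along rational radii, written with countable
    quantifiers so that the set is Borel. The bound is not strict, so it passes to real radii by
    continuity.\<close>
  define C where "C = {\<zeta>. \<forall>n::nat. \<exists>m::nat. \<forall>i::rat. 1 - 1 / (real m + 1) < of_rat i \<and> of_rat i < (1::real) \<longrightarrow>
      dist (D (of_real (of_rat i) * \<zeta>)) (x \<zeta>) \<le> 1 / (real n + 1)}"
  have [measurable]: "C \<in> sets borel" unfolding C_def by measurable
  have conv_x: "x \<zeta> = L" if "((\<lambda>r. D (of_real r * \<zeta>)) \<longlongrightarrow> L) (at_left (1::real))" for \<zeta> L
    unfolding x_def using filterlim_compose[OF that plim] by (intro limI)
  have inC: "\<zeta> \<in> C" if lim: "((\<lambda>r. D (of_real r * \<zeta>)) \<longlongrightarrow> L) (at_left (1::real))" for \<zeta> L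
    unfolding C_def
  proof (intro CollectI allI)
    fix n :: nat
    have "eventually (\<lambda>r. dist (D (of_real r * \<zeta>)) L < 1 / (real n + 1)) (at_left (1::real))"
      by (rule tendstoD[OF lim]) simp
    then obtain b where b: "b < 1" "\<And>r. b < r \<Longrightarrow> r < 1 \<Longrightarrow> dist (D (of_real r * \<zeta>)) L < 1 / (real n + 1)"
      unfolding eventually_at_left_field by blast
    obtain m :: nat where m: "1 / (real m + 1) < 1 - b"
      using reals_Archimedean[of "1 - b"] b by (auto simp: inverse_eq_divide add.commute)
    show "\<exists>m::nat. \<forall>i::rat. 1 - 1 / (real m + 1) < of_rat i \<and> of_rat i < (1::real) \<longrightarrow>
      dist (D (of_real (of_rat i) * \<zeta>)) (x \<zeta>) \<le> 1 / (real n + 1)"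
      using m b(2) conv_x[OF lim] by (intro exI[of _ m]) (auto intro!: less_imp_le)
  qed
  have limC: "((\<lambda>r. D (of_real r * \<zeta>)) \<longlongrightarrow> x \<zeta>) (at_left (1::real))" if \<zeta>: "\<zeta> \<in> C" for \<zeta>
  proof (rule tendstoI)
    fix e :: real assume "e > 0"
    then obtain n :: nat where n: "1 / (real n + 1) < e"
      using reals_Archimedean[of e] by (auto simp: inverse_eq_divide add.commute)
    from \<zeta> obtain m :: nat where m: "\<And>i::rat. 1 - 1 / (real m + 1) < of_rat i \<Longrightarrow> of_rat i < (1::real) \<Longrightarrow>
      dist (D (of_real (of_rat i) * \<zeta>)) (x \<zeta>) \<le> 1 / (real n + 1)" unfolding C_def by blast
    have near: "eventually (\<lambda>r. r \<in> {1 - 1 / (real m + 1)<..<1}) (at_left (1::real))"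
      by (rule eventually_at_left_real) simp
    show "eventually (\<lambda>r. dist (D (of_real r * \<zeta>)) (x \<zeta>) < e) (at_left (1::real))"
      using near cont[of \<zeta>]
    proof eventually_elim
      fix r :: real assume r: "r \<in> {1 - 1 / (real m + 1)<..<1}" and c: "isCont D (of_real r * \<zeta>)"
      have g: "isCont (\<lambda>r. D (of_real r * \<zeta>)) r"
        by (rule isCont_o2[where g=D and f="\<lambda>r. of_real r * \<zeta>", OF _ c]) (intro continuous_intros)
      have "dist (D (of_real r * \<zeta>)) (x \<zeta>) \<le> 1 / (real n + 1)"
      proof (rule ccontr)
        assume "\<not> ?thesis"
        then have pos: "dist (D (of_real r * \<zeta>)) (x \<zeta>) > 1 / (real n + 1)" by simp
        have "((\<lambda>r. dist (D (of_real r * \<zeta>)) (x \<zeta>)) \<longlongrightarrow> dist (D (of_real r * \<zeta>)) (x \<zeta>)) (at r)"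
          using g unfolding isCont_def by (intro tendsto_intros)
        from order_tendstoD(1)[OF this pos]
        obtain d where d: "d > 0" "\<And>s. s \<noteq> r \<Longrightarrow> dist s r < d \<Longrightarrow> dist (D (of_real s * \<zeta>)) (x \<zeta>) > 1 / (real n + 1)"
          unfolding eventually_at by auto
        have "r < min (r + d) 1" using d r by auto
        from of_rat_dense[OF this] obtain i :: rat where i: "r < of_rat i" "of_rat i < min (r + d) 1" by blast
        then show False using d(2)[of "of_rat i"] m[of i] r by (auto simp: dist_real_def)
      qed
      then show "dist (D (of_real r * \<zeta>)) (x \<zeta>) < e" using n by simp
    qed
  qed
  \<comment> \<open>\<open>Lim\<close> is a definite description: where no limit exists its
    predicate is constantly false, so its value is one and the same constant at all such
    points.\<close>
  have "Lim (at_left (1::real)) (\<lambda>r. D (of_real r * \<zeta>)) = (if \<zeta> \<in> C then x \<zeta> else (THE L. False))" for \<zeta>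
  proof (cases "\<zeta> \<in> C")
    case True
    then show ?thesis using tendsto_Lim[OF _ limC[OF True]] by (simp add: trivial_limit_at_left_real)
  next
    case False
    then have "\<not> ((\<lambda>r. D (of_real r * \<zeta>)) \<longlongrightarrow> L) (at_left (1::real))" for L using inC by blast
    then show ?thesis using False by (simp add: Topological_Spaces.Lim_def)
  qed
  then show ?thesis by simp
qed

section \<open>Tails of the Blaschke product\<close>

lemma partial_blaschke_lessThan: "partial_blaschke lam n z = (\<Prod>k<n. bfactor (lam (Suc k)) z)"
  unfolding partial_blaschke_def
  by (rule prod.reindex_bij_witness[of _ Suc "\<lambda>k. k - 1"]) auto

text \<open>The product of all factors after the first \<open>N\<close>. As a \<open>lim\<close> of
  finite products it is Borel on the whole plane, even at points where they diverge.\<close>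

definition blaschke_tail :: "(nat \<Rightarrow> complex) \<Rightarrow> nat \<Rightarrow> cfun" where
  "blaschke_tail lam N z = lim (\<lambda>M. \<Prod>k<M. bfactor (lam (Suc (N + k))) z)"

lemma borel_measurable_blaschke_tail [measurable]: "blaschke_tail lam N \<in> borel_measurable borel"
  unfolding blaschke_tail_def[abs_def] by measurable

locale blaschke_sequence =
  fixes lam :: "nat \<Rightarrow> complex"
  assumes in_disc: "\<And>k. k \<ge> 1 \<Longrightarrow> cmod (lam k) < 1"
    and blaschke_cond: "summable (\<lambda>k. 1 - cmod (lam (Suc k)))"
begin

lemma in_disc_Suc: "cmod (lam (Suc k)) < 1"
  using in_disc by simp

section \<open>Convergence of the tails off the circle\<close>

lemma cmod_lam_tendsto: "(\<lambda>k. cmod (lam (Suc k))) \<longlonglongrightarrow> 1"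
  using tendsto_diff[OF tendsto_const[of 1] summable_LIMSEQ_zero[OF blaschke_cond]] by simp

lemma not_pole: "cmod z \<le> 1 \<Longrightarrow> cnj (lam (Suc k)) * z \<noteq> 1"
  using one_minus_mult_cnj_ne_0(2)[OF in_disc_Suc[of k], of z] by auto

text \<open>The zeros tend to the circle in modulus, and so do the poles of the factors; away from
  the circle the denominators are eventually bounded below. Asking for this only eventually admits
  sets \<open>K\<close> containing poles of early factors.\<close>

lemma eventually_bfactor_minus_1:
  assumes K: "compact K" "K \<inter> sphere 0 1 = {}"
  shows "\<exists>C. \<forall>\<^sub>F k in sequentially. \<forall>z\<in>K. cmod (bfactor (lam (Suc k)) z - 1) \<le> C * (1 - cmod (lam (Suc k)))"
proof -
  obtain R where R: "R > 0" "\<And>z. z \<in> K \<Longrightarrow> cmod z \<le> R"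
    using compact_imp_bounded[OF K(1)] by (auto simp: bounded_pos)
  obtain d where d: "d > 0" "\<And>z. z \<in> K \<Longrightarrow> d \<le> \<bar>cmod z - 1\<bar>"
  proof (cases "K = {}")
    case False
    have "continuous_on K (\<lambda>z. \<bar>cmod z - 1\<bar>)" by (intro continuous_intros)
    from continuous_attains_inf[OF K(1) False this]
    obtain z0 where "z0 \<in> K" "\<And>z. z \<in> K \<Longrightarrow> \<bar>cmod z0 - 1\<bar> \<le> \<bar>cmod z - 1\<bar>" by blast
    then show ?thesis using K(2) by (intro that[of "\<bar>cmod z0 - 1\<bar>"]) auto
  qed (use that[of 1] in auto)
  \<comment> \<open>With R bounding |z| and d the distance of |z| from 1, this threshold makes (1 -
    |c|) |z| at most d/2, so |c| |z| stays d/2 away from 1.\<close>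
  have "\<forall>\<^sub>F k in sequentially. 1 - d / (2 * R) < cmod (lam (Suc k))"
    using cmod_lam_tendsto d R by (intro order_tendstoD(1)) auto
  then have "\<forall>\<^sub>F k in sequentially. \<forall>z\<in>K. cmod (bfactor (lam (Suc k)) z - 1) \<le> (1 + R) / (d / 2) * (1 - cmod (lam (Suc k)))"
  proof eventually_elim
    fix k assume k: "1 - d / (2 * R) < cmod (lam (Suc k))"
    let ?c = "lam (Suc k)"
    show "\<forall>z\<in>K. cmod (bfactor ?c z - 1) \<le> (1 + R) / (d / 2) * (1 - cmod ?c)"
    proof
      fix z assume z: "z \<in> K"
      have "(1 - cmod ?c) * cmod z \<le> d / (2 * R) * R"
        using k R z in_disc_Suc[of k] d by (intro mult_mono) (auto simp: less_imp_le)
      then have 1: "cmod z - cmod ?c * cmod z \<le> d / 2" using R(1) by (simp add: algebra_simps)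
      have 2: "cmod ?c * cmod z \<le> cmod z"
        using in_disc_Suc[of k] mult_right_mono[of "cmod ?c" 1 "cmod z"] by simp
      have "\<bar>1 - cmod ?c * cmod z\<bar> \<ge> d / 2"
        using d(2)[OF z] d(1) 1 2 by linarith
      also have "\<bar>1 - cmod ?c * cmod z\<bar> \<le> cmod (1 - cnj ?c * z)"
        using norm_triangle_ineq3[of 1 "cnj ?c * z"] by (simp add: norm_mult)
      finally have low: "d / 2 \<le> cmod (1 - cnj ?c * z)" .
      then have "cnj ?c * z \<noteq> 1" using d(1) by auto
      then have "cmod (bfactor ?c z - 1) \<le> (1 - cmod ?c) * (1 + cmod z) / cmod (1 - cnj ?c * z)"
        using in_disc_Suc[of k] by (rule bfactor_minus_1)
      also have "\<dots> \<le> (1 - cmod ?c) * (1 + R) / (d / 2)"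
        using low R(2)[OF z] d(1) R(1) in_disc_Suc[of k] by (intro frac_le mult_mono) auto
      also have "\<dots> = (1 + R) / (d / 2) * (1 - cmod ?c)" by (metis times_divide_eq_left mult.commute)
      finally show "cmod (bfactor ?c z - 1) \<le> (1 + R) / (d / 2) * (1 - cmod ?c)" .
    qed
  qed
  then show ?thesis by blast
qed

lemma uniform_limit_blaschke_tail:
  assumes K: "compact K" "K \<inter> sphere 0 1 = {}"
    and np: "\<And>k z. z \<in> K \<Longrightarrow> cnj (lam (Suc (N + k))) * z \<noteq> 1"
  shows "uniform_limit K (\<lambda>M z. \<Prod>k<M. bfactor (lam (Suc (N + k))) z) (blaschke_tail lam N) sequentially"
    and "continuous_on K (blaschke_tail lam N)"
proof -
  have cont: "continuous_on K (bfactor (lam (Suc (N + k))))" for k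
    using np by (intro continuous_at_imp_continuous_on ballI isCont_bfactor) auto
  obtain C where "\<forall>\<^sub>F k in sequentially. \<forall>z\<in>K. cmod (bfactor (lam (Suc k)) z - 1) \<le> C * (1 - cmod (lam (Suc k)))"
    using eventually_bfactor_minus_1[OF K] by blast
  then have "\<forall>\<^sub>F k in sequentially. \<forall>z\<in>K. cmod (bfactor (lam (Suc (k + N))) z - 1) \<le> C * (1 - cmod (lam (Suc (k + N))))"
    by (rule eventually_sequentially_seg[THEN iffD2])
  then have "\<forall>\<^sub>F k in sequentially. \<forall>z\<in>K. norm (cmod (bfactor (lam (Suc (N + k))) z - 1)) \<le> C * (1 - cmod (lam (Suc (N + k))))"
    by (simp add: add.commute)
  moreover have "summable (\<lambda>k. C * (1 - cmod (lam (Suc (N + k)))))"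
    using summable_ignore_initial_segment[OF blaschke_cond, of N] by (intro summable_mult) (simp add: add.commute)
  ultimately have "uniformly_convergent_on K (\<lambda>M z. \<Sum>k<M. cmod (bfactor (lam (Suc (N + k))) z - 1))"
    unfolding uniformly_convergent_on_def by (intro exI, rule Weierstrass_m_test_ev)
  then have "uniformly_convergent_on K (\<lambda>M z. \<Prod>k<M. bfactor (lam (Suc (N + k))) z)"
    by (intro uniformly_convergent_on_prod' cont K)
  then show ul: "uniform_limit K (\<lambda>M z. \<Prod>k<M. bfactor (lam (Suc (N + k))) z) (blaschke_tail lam N) sequentially"
    unfolding blaschke_tail_def[abs_def] by (simp add: uniformly_convergent_uniform_limit_iff)
  show "continuous_on K (blaschke_tail lam N)"
    by (rule uniform_limit_theorem[OF _ ul]) (auto intro!: always_eventually continuous_intros cont)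
qed

lemma blaschke_tail_LIMSEQ:
  assumes "cmod z \<noteq> 1" "\<And>k. cnj (lam (Suc (N + k))) * z \<noteq> 1"
  shows "(\<lambda>M. \<Prod>k<M. bfactor (lam (Suc (N + k))) z) \<longlonglongrightarrow> blaschke_tail lam N z"
  using uniform_limit_blaschke_tail(1)[of "{z}" N] assms
  by (intro tendsto_uniform_limitI[where S="{z}" and x=z]) auto

lemma blaschke_tail_LIMSEQ_disc:
  "cmod z < 1 \<Longrightarrow> (\<lambda>M. \<Prod>k<M. bfactor (lam (Suc (N + k))) z) \<longlonglongrightarrow> blaschke_tail lam N z"
  using not_pole by (intro blaschke_tail_LIMSEQ) auto

lemma blaschke_tail_0_eq:
  assumes "cmod z \<noteq> 1" "\<And>k. cnj (lam (Suc (N + k))) * z \<noteq> 1"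
  shows "blaschke_tail lam 0 z = partial_blaschke lam N z * blaschke_tail lam N z"
proof -
  have "(\<lambda>M. partial_blaschke lam N z * (\<Prod>k<M. bfactor (lam (Suc (N + k))) z))
      \<longlonglongrightarrow> partial_blaschke lam N z * blaschke_tail lam N z"
    by (intro tendsto_mult tendsto_const blaschke_tail_LIMSEQ assms)
  moreover have "partial_blaschke lam N z * (\<Prod>k<M. bfactor (lam (Suc (N + k))) z) = (\<Prod>k<M + N. bfactor (lam (Suc k)) z)" for M
  proof -
    have split: "{..<M + N} = {..<N} \<union> {N..<M + N}" by auto
    have "(\<Prod>k<M + N. bfactor (lam (Suc k)) z) = (\<Prod>k<N. bfactor (lam (Suc k)) z) * (\<Prod>k=N..<M + N. bfactor (lam (Suc k)) z)"
      unfolding split by (rule prod.union_disjoint) auto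
    also have "(\<Prod>k=N..<M + N. bfactor (lam (Suc k)) z) = (\<Prod>k<M. bfactor (lam (Suc (N + k))) z)"
      by (rule prod.reindex_bij_witness[of _ "\<lambda>k. N + k" "\<lambda>k. k - N"]) auto
    finally show ?thesis by (simp add: partial_blaschke_lessThan)
  qed
  ultimately have "(\<lambda>M. \<Prod>k<M. bfactor (lam (Suc k)) z) \<longlonglongrightarrow> partial_blaschke lam N z * blaschke_tail lam N z"
    by (simp add: LIMSEQ_offset)
  then show ?thesis by (simp add: blaschke_tail_def limI)
qed

text \<open>This includes poles off the circle: division by zero makes a factor 0 there, and
  absolute convergence depends only on late factors.\<close>

lemma blaschke_disc_eq_tail:
  assumes "cmod z \<noteq> 1" shows "blaschke_disc lam z = blaschke_tail lam 0 z"
proof -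
  obtain C where "\<forall>\<^sub>F k in sequentially. \<forall>z\<in>{z}. cmod (bfactor (lam (Suc k)) z - 1) \<le> C * (1 - cmod (lam (Suc k)))"
    using eventually_bfactor_minus_1[of "{z}"] assms by auto
  then have "summable (\<lambda>k. cmod (bfactor (lam (Suc k)) z - 1))"
    by (intro summable_comparison_test_ev[OF _ summable_mult[OF blaschke_cond, of C]]) (simp add: eventually_mono)
  then have "convergent_prod (\<lambda>k. bfactor (lam (Suc k)) z)"
    by (intro abs_convergent_prod_imp_convergent_prod) (simp add: abs_convergent_prod_conv_summable)
  then have "(\<lambda>n. \<Prod>k\<le>n. bfactor (lam (Suc k)) z) \<longlonglongrightarrow> blaschke_disc lam z"
    unfolding blaschke_disc_def by (rule convergent_prod_LIMSEQ)
  then show ?thesis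
    unfolding blaschke_tail_def by (simp add: LIMSEQ_lessThan_iff_atMost limI)
qed

text \<open>Serves measurability of the boundary function on the whole plane. For |\<zeta>| <= 1 the
  radius lies in the open disc. For |\<zeta>| > 1 only finitely many factors have poles near the
  relevant part of the ray, and radii close to 1 avoid them, even if \<zeta> itself is a
  pole.\<close>

lemma eventually_isCont_radial:
  "\<forall>\<^sub>F r in at_left (1::real). isCont (blaschke_tail lam 0) (of_real r * \<zeta>)"
proof (cases "cmod \<zeta> \<le> 1")
  case True
  have near: "\<forall>\<^sub>F r in at_left (1::real). r \<in> {0<..<1}" by (rule eventually_at_left_real) simp
  then show ?thesis
  proof eventually_elim
    fix r :: real assume r: "r \<in> {0<..<1}"
    have "r * cmod \<zeta> \<le> r" using True r by (simp add: mult_left_le)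
    moreover have "cmod (of_real r * \<zeta>) = r * cmod \<zeta>" using r by (simp add: norm_mult)
    ultimately have z: "cmod (of_real r * \<zeta>) < 1" using r by (metis greaterThanLessThan_iff le_less_trans)
    then obtain s where s: "cmod (of_real r * \<zeta>) < s" "s < 1" using dense by blast
    have "continuous_on (cball 0 s) (blaschke_tail lam 0)"
      using s not_pole by (intro uniform_limit_blaschke_tail(2)) auto
    then show "isCont (blaschke_tail lam 0) (of_real r * \<zeta>)"
      using s by (intro continuous_on_interior) (auto simp: interior_cball)
  qed
next
  case False
  then have \<zeta>: "1 < cmod \<zeta>" by simp
  obtain R where R: "1 < R" "R < cmod \<zeta>" using dense[OF \<zeta>] by blast
  have "1 / R < 1" using R by simp
  then have "\<forall>\<^sub>F k in sequentially. 1 / R < cmod (lam (Suc k))"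
    by (rule order_tendstoD(1)[OF cmod_lam_tendsto])
  \<comment> \<open>From here on the poles have modulus below \<open>R\<close>, so this tail is
    continuous on |z| >= R near \<zeta>.\<close>
  then obtain N where N: "\<And>k. k \<ge> N \<Longrightarrow> 1 / R < cmod (lam (Suc k))"
    unfolding eventually_sequentially by blast
  have np: "cnj (lam (Suc (N + k))) * z \<noteq> 1" if z: "R \<le> cmod z" for z k
  proof
    assume "cnj (lam (Suc (N + k))) * z = 1"
    then have "cmod (lam (Suc (N + k))) * cmod z = 1" by (metis complex_mod_cnj norm_mult norm_one)
    moreover have "1 / R * R < cmod (lam (Suc (N + k))) * cmod z"
      using N[of "N + k"] z R by (intro mult_less_le_imp_less) auto
    ultimately show False using R by simp
  qed
  let ?A = "cball 0 (cmod \<zeta> + 1) - ball 0 R"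
  have cont: "continuous_on ?A (blaschke_tail lam N)"
    using R np by (intro uniform_limit_blaschke_tail(2) compact_diff) auto
  have near: "\<forall>\<^sub>F r in at_left (1::real). r \<in> {R / cmod \<zeta><..<1}"
    using R \<zeta> by (intro eventually_at_left_real) (simp add: divide_less_eq)
  \<comment> \<open>Each early factor has at most one pole on the ray. If it sits at \<zeta> itself,
    every radius in (0,1) misses it; otherwise radii near 1 do.\<close>
  have fin: "\<forall>\<^sub>F r in at_left (1::real). \<forall>k\<in>{..<N}. cnj (lam (Suc k)) * (of_real r * \<zeta>) \<noteq> 1"
  proof (rule eventually_ball_finite)
    show "\<forall>k\<in>{..<N}. \<forall>\<^sub>F r in at_left (1::real). cnj (lam (Suc k)) * (of_real r * \<zeta>) \<noteq> 1"
    proof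
      fix k
      let ?q = "cnj (lam (Suc k)) * \<zeta>"
      show "\<forall>\<^sub>F r in at_left (1::real). cnj (lam (Suc k)) * (of_real r * \<zeta>) \<noteq> 1"
      proof (cases "?q = 1")
        case True
        have "\<forall>\<^sub>F r in at_left (1::real). r \<in> {0<..<1}" by (rule eventually_at_left_real) simp
        then show ?thesis
          by eventually_elim (use True in \<open>auto simp: mult.left_commute[of "cnj _"]\<close>)
      next
        case False
        have "((\<lambda>r. of_real r * ?q) \<longlongrightarrow> of_real 1 * ?q) (at_left (1::real))" by (intro tendsto_intros)
        then have "\<forall>\<^sub>F r in at_left (1::real). of_real r * ?q \<noteq> 1"
          using False by (intro tendsto_imp_eventually_ne) auto
        then show ?thesis by eventually_elim (simp add: mult.left_commute)
      qed
    qed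
  qed simp
  show ?thesis
    using near fin
  proof eventually_elim
    fix r :: real assume r: "r \<in> {R / cmod \<zeta><..<1}" and f: "\<forall>k\<in>{..<N}. cnj (lam (Suc k)) * (of_real r * \<zeta>) \<noteq> 1"
    let ?z = "of_real r * \<zeta>"
    have "0 < R / cmod \<zeta>" using R \<zeta> by (intro divide_pos_pos) auto
    then have r0: "0 < r" using r by (meson greaterThanLessThan_iff less_trans)
    have z: "R < cmod ?z" "cmod ?z < cmod \<zeta> + 1"
    proof -
      show "R < cmod ?z" using r r0 pos_divide_less_eq[OF less_trans[OF zero_less_one \<zeta>], of R r]
        by (simp add: norm_mult)
      have "r * cmod \<zeta> \<le> 1 * cmod \<zeta>" using r by (intro mult_right_mono) auto
      then show "cmod ?z < cmod \<zeta> + 1" using r0 by (simp add: norm_mult)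
    qed
    let ?U = "ball 0 (cmod \<zeta> + 1) - cball 0 R"
    have U: "open ?U" "?z \<in> ?U" using z by (auto intro!: open_Diff)
    have "continuous_on ?U (blaschke_tail lam N)"
      by (rule continuous_on_subset[OF cont]) auto
    then have c1: "isCont (blaschke_tail lam N) ?z" using U continuous_on_eq_continuous_at by blast
    have c2: "isCont (partial_blaschke lam N) ?z"
      unfolding partial_blaschke_lessThan[abs_def]
      using f by (intro continuous_prod isCont_bfactor) auto
    have ev: "\<forall>\<^sub>F w in nhds ?z. blaschke_tail lam 0 w = partial_blaschke lam N w * blaschke_tail lam N w"
      using R np by (intro eventually_nhds_in_open[OF U, THEN eventually_mono] blaschke_tail_0_eq) auto
    have "isCont (\<lambda>w. partial_blaschke lam N w * blaschke_tail lam N w) ?z"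
      using c1 c2 by (intro continuous_intros)
    then show "isCont (blaschke_tail lam 0) ?z"
      using isCont_cong[OF ev] by simp
  qed
qed

lemma blaschke_bdry_eq:
  "blaschke_bdry lam \<zeta> = Lim (at_left (1::real)) (\<lambda>r. blaschke_tail lam 0 (of_real r * \<zeta>))"
proof -
  have "\<forall>\<^sub>F r in at_left (1::real). cmod (of_real r * \<zeta>) \<noteq> 1"
  proof (cases "cmod \<zeta> = 1")
    case True
    have "\<forall>\<^sub>F r in at_left (1::real). r \<in> {0<..<1}" by (rule eventually_at_left_real) simp
    then show ?thesis by eventually_elim (use True in \<open>auto simp: norm_mult\<close>)
  next
    case False
    have "((\<lambda>r. cmod (of_real r * \<zeta>)) \<longlongrightarrow> cmod (of_real 1 * \<zeta>)) (at_left (1::real))" by (intro tendsto_intros)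
    then show ?thesis using False by (intro tendsto_imp_eventually_ne) auto
  qed
  then have "\<forall>\<^sub>F r in at_left (1::real). blaschke_disc lam (of_real r * \<zeta>) = blaschke_tail lam 0 (of_real r * \<zeta>)"
    by eventually_elim (rule blaschke_disc_eq_tail)
  then show ?thesis
    unfolding blaschke_bdry_def Topological_Spaces.Lim_def by (simp only: tendsto_cong)
qed

lemma borel_measurable_blaschke_bdry [measurable]: "blaschke_bdry lam \<in> borel_measurable borel"
  unfolding blaschke_bdry_eq[abs_def]
  by (rule borel_measurable_radial_limit[OF borel_measurable_blaschke_tail eventually_isCont_radial])

section \<open>Mean-square distance of the tails from 1\<close>

lemma cmod_blaschke_tail_le_1: "cmod z < 1 \<Longrightarrow> cmod (blaschke_tail lam N z) \<le> 1"
  by (rule LIMSEQ_le_const2[OF tendsto_norm[OF blaschke_tail_LIMSEQ_disc]])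
    (auto intro!: prod_le_1 cmod_bfactor_le_1 in_disc_Suc simp: prod_norm[symmetric])

lemma holomorphic_blaschke_tail: "blaschke_tail lam N holomorphic_on ball 0 1"
proof (rule holomorphic_uniform_sequence)
  fix z :: complex assume z: "z \<in> ball 0 1"
  then obtain d where d: "d > 0" "cball z d \<subseteq> ball 0 1" by (meson open_ball open_contains_cball)
  moreover have "uniform_limit (cball z d) (\<lambda>M z. \<Prod>k<M. bfactor (lam (Suc (N + k))) z) (blaschke_tail lam N) sequentially"
    using d not_pole by (intro uniform_limit_blaschke_tail) (force simp: dist_norm)+
  ultimately show "\<exists>d>0. cball z d \<subseteq> ball 0 1 \<and>
    uniform_limit (cball z d) (\<lambda>M z. \<Prod>k<M. bfactor (lam (Suc (N + k))) z) (blaschke_tail lam N) sequentially"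
    by blast
qed (auto intro!: holomorphic_intros holomorphic_bfactor in_disc_Suc)

definition tail_sum :: "nat \<Rightarrow> real" where
  "tail_sum N = (\<Sum>k. 1 - cmod (lam (Suc (N + k))))"

lemma tail_sum_tendsto_0: "tail_sum \<longlonglongrightarrow> 0"
  unfolding tail_sum_def[abs_def] using suminf_exist_split2[OF blaschke_cond] by (simp add: add.commute)

text \<open>At the origin the factors are the moduli of the zeros, and a product of numbers 1 - x_k
  with x_k in [0,1] is at least 1 minus the sum of the x_k.\<close>

lemma Re_blaschke_tail_0: "1 - tail_sum N \<le> Re (blaschke_tail lam N 0)"
proof -
  have "(\<lambda>M. Re (\<Prod>k<M. bfactor (lam (Suc (N + k))) 0)) \<longlonglongrightarrow> Re (blaschke_tail lam N 0)"
    by (intro tendsto_Re blaschke_tail_LIMSEQ_disc) simp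
  moreover have "1 - tail_sum N \<le> Re (\<Prod>k<M. bfactor (lam (Suc (N + k))) 0)" for M
  proof -
    have s: "summable (\<lambda>k. 1 - cmod (lam (Suc (N + k))))"
      using summable_ignore_initial_segment[OF blaschke_cond, of N] by (simp add: add.commute)
    have "1 - tail_sum N \<le> 1 - (\<Sum>k<M. 1 - cmod (lam (Suc (N + k))))"
      unfolding tail_sum_def using in_disc_Suc by (intro diff_left_mono sum_le_suminf s) (auto simp: less_imp_le)
    also have "\<dots> \<le> (\<Prod>k<M. 1 - (1 - cmod (lam (Suc (N + k)))))"
      using in_disc_Suc by (intro Weierstrass_prod_ineq) (auto simp: less_imp_le)
    also have "\<dots> = Re (\<Prod>k<M. bfactor (lam (Suc (N + k))) 0)"
      by (simp add: bfactor_0 flip: of_real_prod)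
    finally show ?thesis .
  qed
  ultimately show ?thesis by (intro LIMSEQ_le_const) auto
qed

text \<open>For |B| <= 1 one has |1 - B|^2 = 1 - 2 Re B + |B|^2 <= 2 Re (1 - B), and the mean value
  property evaluates the right-hand side at the origin. The dilation by \<rho> provides holomorphy
  on the closed disc, and the bound does not depend on \<rho>.\<close>

lemma nsq_one_minus_blaschke_tail:
  assumes \<rho>: "0 < \<rho>" "\<rho> < 1"
  shows "nsq (\<lambda>w. 1 - blaschke_tail lam N (of_real \<rho> * w)) \<le> 2 * tail_sum N"
    and "(\<lambda>w. 1 - blaschke_tail lam N (of_real \<rho> * w)) holomorphic_on cball 0 1"
proof -
  let ?f = "\<lambda>w. 1 - blaschke_tail lam N (of_real \<rho> * w)"
  have in1: "cmod (of_real \<rho> * w) < 1" if "cmod w \<le> 1" for w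
  proof -
    have "\<rho> * cmod w \<le> \<rho> * 1" using that \<rho> by (intro mult_left_mono) auto
    moreover have "cmod (of_real \<rho> * w) = \<rho> * cmod w" using \<rho> by (simp add: norm_mult)
    ultimately show ?thesis using \<rho> by linarith
  qed
  have "(blaschke_tail lam N \<circ> (\<lambda>w. of_real \<rho> * w)) holomorphic_on cball 0 1"
    by (rule holomorphic_on_compose_gen[OF _ holomorphic_blaschke_tail])
      (use in1 in \<open>auto intro!: holomorphic_intros\<close>)
  then show hol: "?f holomorphic_on cball 0 1"
    by (intro holomorphic_intros) (simp add: o_def)
  have le: "(cmod (?f w))\<^sup>2 \<le> 2 * Re (?f w)" if "cmod w = 1" for w
  proof -
    let ?B = "blaschke_tail lam N (of_real \<rho> * w)"
    have "(cmod ?B)\<^sup>2 \<le> 1" using cmod_blaschke_tail_le_1[OF in1, of w N] that by (simp add: abs_square_le_1)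
    moreover have "(cmod (?f w))\<^sup>2 = 1 - 2 * Re ?B + (cmod ?B)\<^sup>2"
      unfolding cmod_power2 by (simp add: power2_eq_square algebra_simps)
    ultimately show ?thesis by simp
  qed
  have bd: "cmod (?f w) \<le> 2" if "cmod w = 1" for w
    using norm_triangle_ineq4[of 1 "blaschke_tail lam N (of_real \<rho> * w)"] cmod_blaschke_tail_le_1[OF in1, of w N] that by simp
  have int: "integrable circ ?f" by (rule integrable_circ_bounded[where C=2]) (use bd in auto)
  have "L2 ?f" by (rule L2_bounded[where C=2]) (use bd in auto)
  then have "nsq ?f \<le> (\<integral>w. 2 * Re (?f w) \<partial>circ)"
    unfolding nsq_def
  proof (intro integral_mono_AE L2_integrable)
    show "integrable circ (\<lambda>w. 2 * Re (?f w))" using int by (intro integrable_mult_right integrable_Re)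
    show "AE w in circ. (cmod (?f w))\<^sup>2 \<le> 2 * Re (?f w)"
      using AE_circ_norm_1 by eventually_elim (rule le)
  qed
  also have "\<dots> = 2 * Re (\<integral>w. ?f w \<partial>circ)"
    by (simp only: integral_mult_right_zero integral_Re[OF int])
  also have "(\<integral>w. ?f w \<partial>circ) = ?f 0" by (rule circ_mean_value[OF _ hol]) measurable
  also have "2 * Re (?f 0) \<le> 2 * tail_sum N" using Re_blaschke_tail_0[of N] by simp
  finally show "nsq ?f \<le> 2 * tail_sum N" .
qed

end

section \<open>Boundary values of the Blaschke product\<close>

context blaschke_sequence
begin

text \<open>Where the radial maximal function of 1 minus the tail exceeds \<epsilon>. Restricting to
  rational radii keeps the set Borel; continuity recovers the others.\<close>

definition large_tail_set :: "nat \<Rightarrow> real \<Rightarrow> complex set" where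
  "large_tail_set N \<epsilon> = {\<zeta>. \<exists>i::rat. 0 \<le> (of_rat i :: real) \<and> of_rat i < (1::real) \<and>
     cmod (1 - blaschke_tail lam N (of_real (of_rat i) * \<zeta>)) > \<epsilon>}"

lemma large_tail_set_measurable [measurable]: "large_tail_set N \<epsilon> \<in> sets borel"
  unfolding large_tail_set_def by measurable

text \<open>The maximal inequality needs a function holomorphic on the closed disc. So finitely many
  radii are treated at a time, after a dilation beyond the largest of them, and the finite set of
  radii then grows. The constant is 16 * 2.\<close>

lemma measure_large_tail_set:
  assumes \<epsilon>: "\<epsilon> > 0"
  shows "\<epsilon>\<^sup>2 * measure circ (large_tail_set N \<epsilon>) \<le> 32 * tail_sum N"
proof -
  \<comment> \<open>Enumerates the rationals in [0,1); all other rationals are sent to the harmless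
    radius 0.\<close>
  define q :: "nat \<Rightarrow> real" where
    "q i = (let x = of_rat (from_nat i :: rat) in if 0 \<le> x \<and> x < 1 then x else 0)" for i
  have q: "0 \<le> q i" "q i < 1" for i by (auto simp: q_def Let_def)
  define A where "A n = {\<zeta>. \<exists>i\<in>{..n}. cmod (1 - blaschke_tail lam N (of_real (q i) * \<zeta>)) > \<epsilon>}" for n :: nat
  have [measurable]: "A n \<in> sets borel" for n unfolding A_def by measurable
  have sub: "large_tail_set N \<epsilon> \<subseteq> (\<Union>n. A n)"
  proof
    fix \<zeta> assume "\<zeta> \<in> large_tail_set N \<epsilon>"
    then obtain i :: rat where i: "0 \<le> (of_rat i :: real)" "of_rat i < (1::real)"
      "cmod (1 - blaschke_tail lam N (of_real (of_rat i) * \<zeta>)) > \<epsilon>" unfolding large_tail_set_def by blast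
    then have "q (to_nat i) = of_rat i" by (simp add: q_def)
    then have "\<zeta> \<in> A (to_nat i)" unfolding A_def using i by (auto intro!: bexI[of _ "to_nat i"])
    then show "\<zeta> \<in> (\<Union>n. A n)" by blast
  qed
  have An: "\<epsilon>\<^sup>2 * measure circ (A n) \<le> 32 * tail_sum N" for n
  proof -
    \<comment> \<open>Halfway between the largest radius in use and 1, so that each
      \<open>q i / \<rho>\<close> is again below 1.\<close>
    define \<rho> where "\<rho> = (1 + Max (q ` {..n})) / 2"
    have M: "Max (q ` {..n}) < 1" "0 \<le> Max (q ` {..n})"
      using q by (auto intro!: Max_ge_iff[THEN iffD2])
    then have \<rho>: "0 < \<rho>" "\<rho> < 1" by (auto simp: \<rho>_def)
    have q\<rho>: "q i < \<rho>" if "i \<le> n" for i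
    proof -
      have "q i \<le> Max (q ` {..n})" using that by (intro Max_ge) auto
      also have "\<dots> < \<rho>" using M by (simp add: \<rho>_def)
      finally show ?thesis .
    qed
    define r where "r i = (if i \<le> n then q i / \<rho> else 0)" for i
    have r: "0 \<le> r i" "r i < 1" for i using q q\<rho> \<rho> by (auto simp: r_def divide_less_eq)
    let ?f = "\<lambda>w. 1 - blaschke_tail lam N (of_real \<rho> * w)"
    let ?R = "{\<zeta>. \<exists>i. cmod (?f (of_real (r i) * \<zeta>)) > \<epsilon>}"
    have "A n \<subseteq> ?R"
    proof
      fix \<zeta> assume "\<zeta> \<in> A n"
      then obtain i where i: "i \<le> n" "cmod (1 - blaschke_tail lam N (of_real (q i) * \<zeta>)) > \<epsilon>"
        by (auto simp: A_def)
      have eq: "of_real \<rho> * (of_real (r i) * \<zeta>) = of_real (q i) * \<zeta>"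
        using \<rho> i(1) by (simp add: r_def)
      have "cmod (?f (of_real (r i) * \<zeta>)) > \<epsilon>" unfolding eq by (rule i(2))
      then show "\<zeta> \<in> ?R" by blast
    qed
    then have "measure circ (A n) \<le> measure circ ?R"
      by (intro circ.finite_measure_mono) (auto, measurable)
    then have "\<epsilon>\<^sup>2 * measure circ (A n) \<le> \<epsilon>\<^sup>2 * measure circ ?R" by (intro mult_left_mono) auto
    also have "\<dots> \<le> 16 * nsq ?f"
      by (intro radial_maximal_inequality nsq_one_minus_blaschke_tail \<rho> r \<epsilon>) measurable
    also have "\<dots> \<le> 32 * tail_sum N" using nsq_one_minus_blaschke_tail(1)[OF \<rho>, of N] by simp
    finally show ?thesis .
  qed
  have "incseq A" unfolding A_def incseq_def by fastforce
  then have "(\<lambda>n. measure circ (A n)) \<longlonglongrightarrow> measure circ (\<Union>n. A n)"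
    by (intro circ.finite_Lim_measure_incseq) auto
  then have "(\<lambda>n. \<epsilon>\<^sup>2 * measure circ (A n)) \<longlonglongrightarrow> \<epsilon>\<^sup>2 * measure circ (\<Union>n. A n)" by (intro tendsto_intros)
  then have "\<epsilon>\<^sup>2 * measure circ (\<Union>n. A n) \<le> 32 * tail_sum N"
    by (rule LIMSEQ_le_const2) (use An in auto)
  moreover have "\<epsilon>\<^sup>2 * measure circ (large_tail_set N \<epsilon>) \<le> \<epsilon>\<^sup>2 * measure circ (\<Union>n. A n)"
    using sub by (intro mult_left_mono circ.finite_measure_mono) auto
  ultimately show ?thesis by linarith
qed

text \<open>By continuity a violation at r would persist at nearby radii, among them a rational one
  between r and 1.\<close>

lemma tail_close_to_1:
  assumes \<zeta>: "cmod \<zeta> = 1" "\<zeta> \<notin> large_tail_set N \<epsilon>" and r: "0 < r" "r < 1"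
  shows "cmod (1 - blaschke_tail lam N (of_real r * \<zeta>)) \<le> \<epsilon>"
proof (rule ccontr)
  assume "\<not> ?thesis"
  then have pos: "cmod (1 - blaschke_tail lam N (of_real r * \<zeta>)) > \<epsilon>" by simp
  have "of_real r * \<zeta> \<in> ball 0 1" using r \<zeta> by (simp add: norm_mult)
  then have c: "isCont (blaschke_tail lam N) (of_real r * \<zeta>)"
    using holomorphic_on_imp_continuous_on[OF holomorphic_blaschke_tail] continuous_on_eq_continuous_at[OF open_ball] by blast
  have "isCont (\<lambda>r. blaschke_tail lam N (of_real r * \<zeta>)) r"
    by (rule isCont_o2[where g="blaschke_tail lam N" and f="\<lambda>r. of_real r * \<zeta>", OF _ c]) (intro continuous_intros)
  then have "((\<lambda>r. cmod (1 - blaschke_tail lam N (of_real r * \<zeta>))) \<longlongrightarrow> cmod (1 - blaschke_tail lam N (of_real r * \<zeta>))) (at r)"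
    unfolding isCont_def by (intro tendsto_intros)
  from order_tendstoD(1)[OF this pos]
  obtain d where d: "d > 0" "\<And>s. s \<noteq> r \<Longrightarrow> dist s r < d \<Longrightarrow> cmod (1 - blaschke_tail lam N (of_real s * \<zeta>)) > \<epsilon>"
    unfolding eventually_at by auto
  have "r < min (r + d) 1" using d r by auto
  from of_rat_dense[OF this] obtain i :: rat where i: "r < of_rat i" "of_rat i < min (r + d) 1" by blast
  then have "cmod (1 - blaschke_tail lam N (of_real (of_rat i) * \<zeta>)) > \<epsilon>"
    by (intro d(2)) (auto simp: dist_real_def)
  moreover have "0 \<le> (of_rat i :: real)" "of_rat i < (1::real)" using i r by linarith+
  ultimately show False using \<zeta>(2) unfolding large_tail_set_def by blast
qed

lemma cmod_partial_blaschke_le_1: "cmod z \<le> 1 \<Longrightarrow> cmod (partial_blaschke lam n z) \<le> 1"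
  unfolding partial_blaschke_def prod_norm[symmetric]
  by (intro prod_le_1) (auto intro!: cmod_bfactor_le_1 in_disc)

lemma cmod_partial_blaschke_eq_1: "cmod z = 1 \<Longrightarrow> cmod (partial_blaschke lam n z) = 1"
  unfolding partial_blaschke_def prod_norm[symmetric]
  by (intro prod.neutral) (auto intro!: cmod_bfactor_eq_1 in_disc)

lemma partial_blaschke_radial:
  assumes "cmod \<zeta> = 1"
  shows "((\<lambda>r. partial_blaschke lam n (of_real r * \<zeta>)) \<longlongrightarrow> partial_blaschke lam n \<zeta>) (at_left (1::real))"
proof -
  have "isCont (partial_blaschke lam n) \<zeta>"
    unfolding partial_blaschke_lessThan[abs_def]
    using not_pole assms by (intro continuous_prod isCont_bfactor) auto
  moreover have "((\<lambda>r. of_real r * \<zeta>) \<longlongrightarrow> of_real 1 * \<zeta>) (at_left (1::real))" by (intro tendsto_intros)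
  ultimately show ?thesis using isCont_tendsto_compose[of \<zeta> "partial_blaschke lam n"] by simp
qed

text \<open>Since partial products have modulus at most 1 in the disc, the j-th one differs from the
  full product by at most \<open>(1/2)^j\<close> along the entire radius. This uniformity permits
  the interchange of the limits in r and j.\<close>

lemma radial_limit_of_partial_products:
  assumes \<zeta>: "cmod \<zeta> = 1" and N: "\<forall>\<^sub>F j in sequentially. \<zeta> \<notin> large_tail_set (N j) ((1/2)^j)"
  shows "(\<lambda>j. partial_blaschke lam (N j) \<zeta>) \<longlonglongrightarrow> blaschke_bdry lam \<zeta>"
proof -
  let ?D = "\<lambda>r. blaschke_tail lam 0 (of_real r * \<zeta>)"
  let ?u = "\<lambda>j r. partial_blaschke lam (N j) (of_real r * \<zeta>)"
  have close: "cmod (?D r - ?u j r) \<le> (1/2)^j"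
    if j: "\<zeta> \<notin> large_tail_set (N j) ((1/2)^j)" and r: "r \<in> {0<..<1}" for j r
  proof -
    let ?z = "of_real r * \<zeta>"
    have z: "cmod ?z < 1" using r \<zeta> by (simp add: norm_mult)
    then have "?D r = ?u j r * blaschke_tail lam (N j) ?z"
      using not_pole by (intro blaschke_tail_0_eq) auto
    then have "?D r - ?u j r = - (?u j r * (1 - blaschke_tail lam (N j) ?z))" by (simp add: algebra_simps)
    then have "cmod (?D r - ?u j r) = cmod (?u j r) * cmod (1 - blaschke_tail lam (N j) ?z)"
      by (simp add: norm_mult)
    also have "\<dots> \<le> 1 * (1/2)^j"
      using z r by (intro mult_mono cmod_partial_blaschke_le_1 tail_close_to_1[OF \<zeta> j]) auto
    finally show ?thesis by simp
  qed
  have near: "\<forall>\<^sub>F r in at_left (1::real). r \<in> {0<..<1}" by (rule eventually_at_left_real) simp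
  obtain J where J: "\<And>j. j \<ge> J \<Longrightarrow> \<zeta> \<notin> large_tail_set (N j) ((1/2)^j)"
    using N unfolding eventually_sequentially by blast
  define x where "x j = partial_blaschke lam (N j) \<zeta>" for j
  \<comment> \<open>The full product serves as a common comparison inside the disc; only the finite
    products, continuous up to \<zeta>, are taken to the boundary, so no radial limit is
    presupposed.\<close>
  have dist_x: "cmod (x i - x j) \<le> (1/2)^i + (1/2)^j" if "i \<ge> J" "j \<ge> J" for i j
  proof (rule tendsto_upperbound)
    show "((\<lambda>r. cmod (?u i r - ?u j r)) \<longlongrightarrow> cmod (x i - x j)) (at_left 1)"
      unfolding x_def by (intro tendsto_intros partial_blaschke_radial \<zeta>)
    show "\<forall>\<^sub>F r in at_left 1. cmod (?u i r - ?u j r) \<le> (1/2)^i + (1/2)^j"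
      using near
    proof eventually_elim
      fix r :: real assume r: "r \<in> {0<..<1}"
      have "cmod (?u i r - ?u j r) \<le> cmod (?D r - ?u i r) + cmod (?D r - ?u j r)"
        using norm_triangle_ineq4[of "?D r - ?u j r" "?D r - ?u i r"] by simp
      also have "\<dots> \<le> (1/2)^i + (1/2)^j" by (intro add_mono close J that r)
      finally show "cmod (?u i r - ?u j r) \<le> (1/2)^i + (1/2)^j" .
    qed
  qed (simp add: trivial_limit_at_left_real)
  have half: "(\<lambda>j. (1/2)^j :: real) \<longlonglongrightarrow> 0" by (intro LIMSEQ_power_zero) auto
  have "Cauchy x"
  proof (rule CauchyI)
    fix e :: real assume "0 < e"
    then have "\<forall>\<^sub>F j in sequentially. (1/2)^j < e / 2" by (intro order_tendstoD(2)[OF half]) auto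
    then obtain K where K: "\<And>j. j \<ge> K \<Longrightarrow> (1/2)^j < e / 2" unfolding eventually_sequentially by blast
    show "\<exists>M. \<forall>m\<ge>M. \<forall>n\<ge>M. norm (x m - x n) < e"
    proof (intro exI allI impI)
      fix m n assume mn: "max J K \<le> m" "max J K \<le> n"
      show "norm (x m - x n) < e" using dist_x[of m n] K[of m] K[of n] mn by auto
    qed
  qed
  then obtain L where L: "x \<longlonglongrightarrow> L" using Cauchy_convergent convergent_def by blast
  have xL: "cmod (x j - L) \<le> (1/2)^j" if "j \<ge> J" for j
  proof (rule LIMSEQ_le)
    show "(\<lambda>i. cmod (x j - x i)) \<longlonglongrightarrow> cmod (x j - L)" by (intro tendsto_intros L)
    show "(\<lambda>i. (1/2)^j + (1/2)^i :: real) \<longlonglongrightarrow> (1/2)^j" using tendsto_add[OF tendsto_const half] by simp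
    show "\<exists>K. \<forall>i\<ge>K. cmod (x j - x i) \<le> (1/2)^j + (1/2)^i" using dist_x that by blast
  qed
  have "(?D \<longlongrightarrow> L) (at_left 1)"
  proof (rule tendstoI)
    fix e :: real assume e: "0 < e"
    then have "\<forall>\<^sub>F j in sequentially. (1/2)^j < e / 3" by (intro order_tendstoD(2)[OF half]) auto
    then obtain K where K: "\<And>j. j \<ge> K \<Longrightarrow> (1/2)^j < e / 3" unfolding eventually_sequentially by blast
    define j where "j = max J K"
    have j: "j \<ge> J" "(1/2)^j < e / 3" using K by (auto simp: j_def)
    have "\<forall>\<^sub>F r in at_left 1. dist (?u j r) (x j) < e / 3"
      unfolding x_def using e by (intro tendstoD partial_blaschke_radial \<zeta>) auto
    then show "\<forall>\<^sub>F r in at_left 1. dist (?D r) L < e"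
      using near
    proof eventually_elim
      fix r :: real assume d: "dist (?u j r) (x j) < e / 3" and r: "r \<in> {0<..<1}"
      have "dist (?D r) L \<le> dist (?D r) (?u j r) + dist (?u j r) (x j) + dist (x j) L"
        by (meson add_mono dist_triangle order_refl order_trans)
      also have "\<dots> < e / 3 + e / 3 + e / 3"
        using d j close[OF J[OF j(1)] r] xL[OF j(1)] unfolding dist_norm by linarith
      finally show "dist (?D r) L < e" by simp
    qed
  qed
  then have "blaschke_bdry lam \<zeta> = L"
    unfolding blaschke_bdry_eq by (intro tendsto_Lim) (simp add: trivial_limit_at_left_real)
  then show ?thesis using L by (simp add: x_def[abs_def])
qed

lemma partial_blaschke_subsequence:
  "\<exists>N. (\<forall>j. j \<le> N j) \<and> (AE \<zeta> in circ. (\<lambda>j. partial_blaschke lam (N j) \<zeta>) \<longlonglongrightarrow> blaschke_bdry lam \<zeta>)"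
proof -
  \<comment> \<open>\<open>(1/8)^j\<close> is the square of \<open>(1/2)^j\<close> times
    \<open>(1/2)^j\<close>: with \<epsilon> = \<open>(1/2)^j\<close> the exceptional sets get
    measure at most \<open>(1/2)^j\<close>, summable as Borel-Cantelli requires.\<close>
  have "\<exists>N. j \<le> N \<and> 32 * tail_sum N \<le> (1/8)^j" for j
  proof -
    have "(\<lambda>N. 32 * tail_sum N) \<longlonglongrightarrow> 32 * 0" by (intro tendsto_intros tail_sum_tendsto_0)
    then have "\<forall>\<^sub>F N in sequentially. 32 * tail_sum N < (1/8)^j" by (rule order_tendstoD(2)) simp
    with eventually_ge_at_top[of j] have "\<forall>\<^sub>F N in sequentially. j \<le> N \<and> 32 * tail_sum N \<le> (1/8)^j"
      by eventually_elim auto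
    from eventually_happens'[OF sequentially_bot this] show ?thesis by blast
  qed
  then obtain N where N: "\<And>j. j \<le> N j" "\<And>j. 32 * tail_sum (N j) \<le> (1/8)^j" by metis
  have small: "measure circ (large_tail_set (N j) ((1/2)^j)) \<le> (1/2)^j" for j
  proof -
    have "((1/2)^j)\<^sup>2 * measure circ (large_tail_set (N j) ((1/2)^j)) \<le> (1/8)^j"
      using measure_large_tail_set[of "(1/2)^j" "N j"] N(2)[of j] by simp
    also have "(1/8::real)^j = ((1/2)^j)\<^sup>2 * (1/2)^j"
      by (simp add: power2_eq_square flip: power_mult_distrib)
    finally show ?thesis by (simp only: mult_le_cancel_left_pos zero_less_power half_gt_zero zero_less_one)
  qed
  have "AE \<zeta> in circ. \<forall>\<^sub>F j in sequentially. \<zeta> \<in> space circ - large_tail_set (N j) ((1/2)^j)"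
  proof (rule borel_cantelli_AE1)
    show "summable (\<lambda>j. measure circ (large_tail_set (N j) ((1/2)^j)))"
      by (rule summable_comparison_test'[of "\<lambda>j. (1/2)^j"]) (use small in auto)
  qed (auto simp: circ.emeasure_eq_measure)
  with AE_circ_norm_1 have "AE \<zeta> in circ. (\<lambda>j. partial_blaschke lam (N j) \<zeta>) \<longlonglongrightarrow> blaschke_bdry lam \<zeta>"
    by eventually_elim (rule radial_limit_of_partial_products, auto)
  with N(1) show ?thesis by blast
qed

lemma multiplier_partial_blaschke: "multiplier (partial_blaschke lam n)"
  unfolding partial_blaschke_def by (intro multiplier_prod multiplier_bfactor in_disc) auto

text \<open>Unimodularity of the partial product forces \<open>s\<close> to be its conjugate times
  the boundary function. It is a multiplier because it is the almost everywhere limit of finite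
  products of the factors after the n-th, all bounded by 1 on the circle.\<close>

lemma blaschke_bdry_factor:
  shows "Linf (blaschke_bdry lam)"
    and "\<exists>s. multiplier s \<and> blaschke_bdry lam \<doteq> (\<lambda>z. partial_blaschke lam n z * s z)"
proof -
  obtain N where N: "\<And>j. j \<le> N j"
    and lim: "AE \<zeta> in circ. (\<lambda>j. partial_blaschke lam (N j) \<zeta>) \<longlonglongrightarrow> blaschke_bdry lam \<zeta>"
    using partial_blaschke_subsequence by blast
  have "AE z in circ. cmod (blaschke_bdry lam z) \<le> 1"
    using lim AE_circ_norm_1
  proof eventually_elim
    fix z assume "(\<lambda>j. partial_blaschke lam (N j) z) \<longlonglongrightarrow> blaschke_bdry lam z" "cmod z = 1"
    then show "cmod (blaschke_bdry lam z) \<le> 1"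
      using cmod_partial_blaschke_le_1 by (intro LIMSEQ_le_const2[OF tendsto_norm]) auto
  qed
  then show "Linf (blaschke_bdry lam)" by (auto simp: Linf_def)
  have [measurable]: "partial_blaschke lam n \<in> borel_measurable borel"
    using multiplier_partial_blaschke by (auto simp: multiplier_def LinfD)
  define s where "s z = cnj (partial_blaschke lam n z) * blaschke_bdry lam z" for z
  \<comment> \<open>The shift to \<open>N (n + j)\<close> ensures that the upper index is at least
    n, so the first n factors can be split off for every j.\<close>
  define w where "w j z = (\<Prod>k\<in>{n<..N (n + j)}. bfactor (lam k) z)" for j z
  have un: "cnj (partial_blaschke lam n z) * partial_blaschke lam n z = 1" if "cmod z = 1" for z
    using cmod_partial_blaschke_eq_1[OF that, of n]
    by (metis complex_norm_square mult.commute of_real_1 one_power2)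
  have split: "partial_blaschke lam (N (n + j)) z = partial_blaschke lam n z * w j z" for j z
  proof -
    have split: "{1..N (n + j)} = {1..n} \<union> {n<..N (n + j)}" using N[of "n + j"] by auto
    show ?thesis unfolding partial_blaschke_def w_def split by (rule prod.union_disjoint) auto
  qed
  have "multiplier s"
  proof (rule multiplier_limit[where w=w and C=1])
    show "multiplier (w j)" for j
      unfolding w_def by (intro multiplier_prod multiplier_bfactor in_disc) auto
    show "cmod (w j z) \<le> 1" if "cmod z = 1" for j z
      unfolding w_def prod_norm[symmetric] using that by (intro prod_le_1) (auto intro!: cmod_bfactor_le_1 in_disc)
    show "s \<in> borel_measurable borel" unfolding s_def by measurable
    show "AE z in circ. (\<lambda>j. w j z) \<longlonglongrightarrow> s z"
      using lim AE_circ_norm_1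
    proof eventually_elim
      fix z assume l: "(\<lambda>j. partial_blaschke lam (N j) z) \<longlonglongrightarrow> blaschke_bdry lam z" and z: "cmod z = 1"
      have "(\<lambda>j. partial_blaschke lam (N (n + j)) z) \<longlonglongrightarrow> blaschke_bdry lam z"
        using LIMSEQ_ignore_initial_segment[OF l, of n] by (simp add: add.commute)
      then have "(\<lambda>j. cnj (partial_blaschke lam n z) * partial_blaschke lam (N (n + j)) z) \<longlonglongrightarrow> s z"
        unfolding s_def by (intro tendsto_intros)
      then show "(\<lambda>j. w j z) \<longlonglongrightarrow> s z"
        unfolding split mult.assoc[symmetric] un[OF z] by simp
    qed
  qed
  moreover have "blaschke_bdry lam \<doteq> (\<lambda>z. partial_blaschke lam n z * s z)"
    using AE_circ_norm_1
  proof eventually_elim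
    fix z :: complex assume "cmod z = 1"
    then have "partial_blaschke lam n z * cnj (partial_blaschke lam n z) = 1" using un by (simp add: mult.commute)
    then show "blaschke_bdry lam z = partial_blaschke lam n z * s z" by (simp add: s_def flip: mult.assoc)
  qed
  ultimately show "\<exists>s. multiplier s \<and> blaschke_bdry lam \<doteq> (\<lambda>z. partial_blaschke lam n z * s z)" by blast
qed

end

theorem theorem2p2:
  fixes lam :: "nat \<Rightarrow> complex" and a b :: "complex \<Rightarrow> complex" and n :: nat
  assumes in_disc: "\<And>k. k \<ge> 1 \<Longrightarrow> cmod (lam k) < 1"
    and ordered: "\<And>k. k \<ge> 1 \<Longrightarrow> cmod (lam k) \<le> cmod (lam (Suc k))"
    and blaschke_cond: "summable (\<lambda>k. 1 - cmod (lam (Suc k)))"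
    and a: "Linf a" and b: "Linf b"
    and n: "n \<ge> 1"
  shows "\<forall>f. L2 f \<longrightarrow>
    (AE z in circ.
      (Pmodel (partial_blaschke lam n) \<circ> TTO (blaschke_bdry lam) (\<lambda>w. a w * b w)
         \<circ> Pmodel (partial_blaschke lam n)) f z
      = (Pmodel (partial_blaschke lam n) \<circ> TTO (blaschke_bdry lam) a
           \<circ> Pmodel (partial_blaschke lam n) \<circ> TTO (blaschke_bdry lam) b
           \<circ> Pmodel (partial_blaschke lam n)) f z
        + (Pmodel (partial_blaschke lam n) \<circ> Hankel a \<circ> Hankel (tilde b)
           \<circ> Pmodel (partial_blaschke lam n)) f z
        + (Rop (partial_blaschke lam n) \<circ> Hankel (tilde a) \<circ> Hankel b
           \<circ> Rop_adj (partial_blaschke lam n)) f z)"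
proof (intro allI impI)
  fix f assume f: "L2 f"
  interpret blaschke_sequence lam by standard (fact in_disc blaschke_cond)+
  obtain s where s: "multiplier s" "blaschke_bdry lam \<doteq> (\<lambda>z. partial_blaschke lam n z * s z)"
    using blaschke_bdry_factor(2) by blast
  have v1: "AE z in circ. cmod (partial_blaschke lam n z) = 1"
    using AE_circ_norm_1 by eventually_elim (rule cmod_partial_blaschke_eq_1)
  show "AE z in circ.
      (Pmodel (partial_blaschke lam n) \<circ> TTO (blaschke_bdry lam) (\<lambda>w. a w * b w)
         \<circ> Pmodel (partial_blaschke lam n)) f z
      = (Pmodel (partial_blaschke lam n) \<circ> TTO (blaschke_bdry lam) a
           \<circ> Pmodel (partial_blaschke lam n) \<circ> TTO (blaschke_bdry lam) b
           \<circ> Pmodel (partial_blaschke lam n)) f z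
        + (Pmodel (partial_blaschke lam n) \<circ> Hankel a \<circ> Hankel (tilde b)
           \<circ> Pmodel (partial_blaschke lam n)) f z
        + (Rop (partial_blaschke lam n) \<circ> Hankel (tilde a) \<circ> Hankel b
           \<circ> Rop_adj (partial_blaschke lam n)) f z"
    by (rule Widom_identity[OF multiplier_partial_blaschke v1 s(1) blaschke_bdry_factor(1) s(2) a b f])
qed

end
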